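(* Let $\Omega_\lambda=(1+\lambda)\Omega$ and $c(\lambda)=c_{\Omega_\lambda}$ for $\lambda\in(-\varepsilon_0,\varepsilon_0)$. The map $\lambda\mapsto c(\lambda)$ is one-sided differentiable at $0$, with $$c'_+(0)=\lim_{\lambda\to0^+}\frac{c(\lambda)-c(0)}{\lambda}=\max_{\mu\in\mathcal{M}(\Omega)}\langle\mu,(-x,v)\cdot\nabla L(x,v)\rangle_\Omega,$$ $$c'_-(0)=\lim_{\lambda\to0^-}\frac{c(\lambda)-c(0)}{\lambda}=\min_{\mu\in\mathcal{M}(\Omega)}\langle\mu,(-x,v)\cdot\nabla L(x,v)\rangle_\Omega.$$
   Context: Standing assumptions. $\varepsilon>0$ is fixed, $p>2$, $U\subset\mathbb{R}^n$ is open and bounded with smooth boundary, $f\in C^1(\overline U)$, and $H(x,\xi)=|\xi|^p-f(x)$. $\Omega\subset\mathbb{R}^n$ is open, bounded, connected, with $C^2$ boundary, $\overline\Omega\subset U$, star-shaped with respect to the origin, and there is $\kappa>0$ such that $\overline{B(0,\kappa)}\subset\Omega$ and $\mathrm{dist}(x,\overline\Omega)\ge\kappa s$ for all $x\in(1+s)\partial\Omega$ and all $s>0$. The number $\varepsilon_0\in(0,1)$ is such that $(1+\lambda)\Omega\subset U$ for $|\lambda|<\varepsilon_0$. Viscosity subsolutions. For an open set $\mathcal{O}$ and $c\in\mathbb{R}$, $w$ satisfies $H(x,Dw)-\varepsilon\Delta w\le c$ in $\mathcal{O}$ if for every $x\in\mathcal{O}$ and $\varphi\in C^2(\mathcal{O})$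 such that $w-\varphi$ has a local maximum at $x$, $H(x,D\varphi(x))-\varepsilon\Delta\varphi(x)\le c$. Additive eigenvalue. $c_{\mathcal{O}}=\min\{c\in\mathbb{R}: H(x,Du)-\varepsilon\Delta u\le c\text{ in }\mathcal{O}\text{ has a (continuous viscosity) solution}\}$. Lagrangian. $L(x,v)=\sup_{\xi\in\mathbb{R}^n}(\xi\cdot v-H(x,\xi))$ is the Legendre transform of $H$, $\nabla L=(D_xL,D_vL)$, so $(-x,v)\cdot\nabla L(x,v)=-x\cdot D_xL(x,v)+v\cdot D_vL(x,v)$. Viscosity Mather measures. For a measure $\mu$ on $\overline\Omega\times\mathbb{R}^n$ and $\varphi\in C(\overline\Omega\times\mathbb{R}^n)\cap L^1(\mu)$, $\langle\mu,\varphi\rangle_\Omega=\int_{\overline\Omega\times\mathbb{R}^n}\varphi\,d\mu$. Let $\Phi^+(\overline\Omega\times\mathbb{R}^n)=\{\phi: \phi(x,v)=tL(x,v)+\chi(x),\ t>0,\ \chi\in C(\overline\Omega)\}$ and, for such $\phi$, $H_\phi(x,\xi)=\sup_{v}(\xi\cdot v-\phi(x,v))$. Let $\mathcal{G}_{0,\Omega}$ be the set of $\phi\in\Phi^+(\overline\Omega\times\mathbb{R}^n)$ for which there exists $u\in C(\overline\Omega)$ with $H_\phi(x,Du)-\varepsilon\Delta u\le0$ in $\Omega$ (viscosity sense). Let $\mathcal{G}'_{0,\Omega}$ be the set of Radon measures $\mu$ on $\overline\Omega\times\mathbb{R}^n$ (with $L\in L^1(\mu)$) such that $\langle\mu,g\rangle_\Omega\ge0$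 for all $g\in\mathcal{G}_{0,\Omega}$. Then $\mathcal{M}(\Omega)$ is the set of probability measures $\mu\in\mathcal{G}'_{0,\Omega}$ with $\langle\mu,L\rangle_\Omega=-c_\Omega$. *)

theory Defs
  imports "HOL-Probability.Probability_Measure"
begin

section \<open>Differential calculus on Euclidean space\<close>

definition partial :: "'a::euclidean_space \<Rightarrow> ('a \<Rightarrow> real) \<Rightarrow> 'a \<Rightarrow> real" where
  "partial i f x = frechet_derivative f (at x) i"

definition grad :: "('a::euclidean_space \<Rightarrow> real) \<Rightarrow> 'a \<Rightarrow> 'a" where
  "grad f x = (\<Sum>i\<in>Basis. partial i f x *\<^sub>R i)"

definition laplacian :: "('a::euclidean_space \<Rightarrow> real) \<Rightarrow> 'a \<Rightarrow> real" where
  "laplacian f x = (\<Sum>i\<in>Basis. partial i (partial i f) x)"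

text \<open>The class \<open>C\<^sup>k(S)\<close>; meant for open \<open>S\<close> only, since derivatives are taken in full
  neighbourhoods.\<close>

primrec Ck_on :: "nat \<Rightarrow> ('a::euclidean_space \<Rightarrow> real) \<Rightarrow> 'a set \<Rightarrow> bool" where
  "Ck_on 0 f S \<longleftrightarrow> continuous_on S f"
| "Ck_on (Suc k) f S \<longleftrightarrow>
     (\<forall>x\<in>S. f differentiable (at x)) \<and> (\<forall>i\<in>Basis. Ck_on k (partial i f) S)"

text \<open>The class \<open>C\<^sup>1\<close> of the closure of an open set \<open>S\<close>: \<open>f\<close> is \<open>C\<^sup>1\<close> in \<open>S\<close>, and \<open>f\<close> and its
  partial derivatives extend continuously to the closure.\<close>

definition C1_closure :: "('a::euclidean_space \<Rightarrow> real) \<Rightarrow> 'a set \<Rightarrow> bool" where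
  "C1_closure f S \<longleftrightarrow>
     continuous_on (closure S) f \<and> Ck_on 1 f S \<and>
     (\<forall>i\<in>Basis. \<exists>g. continuous_on (closure S) g \<and> (\<forall>x\<in>S. g x = partial i f x))"

text \<open>Near each boundary point, \<open>S\<close> is the region on one side of the graph of a function of
  the class \<open>F\<close> over the hyperplane orthogonal to a unit vector \<open>e\<close> (a coordinate axis after rotation,
  not necessarily the normal).  The graph function is given on the whole space but evaluated only
  on the hyperplane, so it plays the role of a function of \<open>n - 1\<close> variables.\<close>

definition graph_boundary :: "('a::euclidean_space \<Rightarrow> real) set \<Rightarrow> 'a set \<Rightarrow> bool" where
  "graph_boundary F S \<longleftrightarrow>
     (\<forall>x\<in>frontier S. \<exists>r>0. \<exists>e. norm e = 1 \<and> (\<exists>\<gamma>\<in>F.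
        S \<inter> ball x r = {y \<in> ball x r. y \<bullet> e > \<gamma> (y - (y \<bullet> e) *\<^sub>R e)}))"

definition C2_boundary :: "'a::euclidean_space set \<Rightarrow> bool" where
  "C2_boundary S \<longleftrightarrow> graph_boundary {\<gamma>. Ck_on 2 \<gamma> UNIV} S"

definition smooth_boundary :: "'a::euclidean_space set \<Rightarrow> bool" where
  "smooth_boundary S \<longleftrightarrow> graph_boundary {\<gamma>. \<forall>k. Ck_on k \<gamma> UNIV} S"

definition star_shaped_at_0 :: "'a::euclidean_space set \<Rightarrow> bool" where
  "star_shaped_at_0 S \<longleftrightarrow> (\<forall>x\<in>S. closed_segment 0 x \<subseteq> S)"

section \<open>Viscosity subsolutions and the additive eigenvalue\<close>

text \<open>\<open>G(x, Dw) - \<epsilon> \<Delta>w \<le> c\<close> in the open set \<open>S\<close>, for a Hamiltonian \<open>G\<close>.\<close>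

definition visc_subsol ::
    "real \<Rightarrow> ('a::euclidean_space \<Rightarrow> 'a \<Rightarrow> real) \<Rightarrow> 'a set \<Rightarrow> real \<Rightarrow> ('a \<Rightarrow> real) \<Rightarrow> bool" where
  "visc_subsol \<epsilon> G S c w \<longleftrightarrow>
     (\<forall>x\<in>S. \<forall>\<phi>. Ck_on 2 \<phi> S \<longrightarrow> (\<forall>\<^sub>F y in nhds x. w y - \<phi> y \<le> w x - \<phi> x) \<longrightarrow>
        G x (grad \<phi> x) - \<epsilon> * laplacian \<phi> x \<le> c)"

definition Ham :: "real \<Rightarrow> ('a::euclidean_space \<Rightarrow> real) \<Rightarrow> 'a \<Rightarrow> 'a \<Rightarrow> real" where
  "Ham p f x \<xi> = norm \<xi> powr p - f x"

definition eigenvalue ::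
    "real \<Rightarrow> ('a::euclidean_space \<Rightarrow> 'a \<Rightarrow> real) \<Rightarrow> 'a set \<Rightarrow> real" where
  "eigenvalue \<epsilon> G S = (LEAST c. \<exists>u. continuous_on S u \<and> visc_subsol \<epsilon> G S c u)"

section \<open>Lagrangian and viscosity Mather measures\<close>

definition Lag :: "real \<Rightarrow> ('a::euclidean_space \<Rightarrow> real) \<Rightarrow> 'a \<Rightarrow> 'a \<Rightarrow> real" where
  "Lag p f x v = (SUP \<xi>. \<xi> \<bullet> v - Ham p f x \<xi>)"

text \<open>The function \<open>(-x, v) \<cdot> \<nabla>L(x, v)\<close> with \<open>\<nabla>L = (D\<^sub>xL, D\<^sub>vL)\<close>.\<close>

definition scaling_Lag ::
    "real \<Rightarrow> ('a::euclidean_space \<Rightarrow> real) \<Rightarrow> 'a \<times> 'a \<Rightarrow> real" where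
  "scaling_Lag p f = (\<lambda>(x, v).
     (- x) \<bullet> grad (\<lambda>y. Lag p f y v) x + v \<bullet> grad (\<lambda>w. Lag p f x w) v)"

text \<open>Members of \<open>\<Phi>\<^sup>+\<close> are functions on the product of the closure of \<open>\<Omega>\<close> with the whole space;
  their values elsewhere are irrelevant and left free.\<close>

definition Phi_plus ::
    "real \<Rightarrow> ('a::euclidean_space \<Rightarrow> real) \<Rightarrow> 'a set \<Rightarrow> ('a \<times> 'a \<Rightarrow> real) set" where
  "Phi_plus p f \<Omega> = {\<phi>. \<exists>t>0. \<exists>h. continuous_on (closure \<Omega>) h \<and>
     (\<forall>x\<in>closure \<Omega>. \<forall>v. \<phi> (x, v) = t * Lag p f x v + h x)}"

definition Ham_of :: "('a::euclidean_space \<times> 'a \<Rightarrow> real) \<Rightarrow> 'a \<Rightarrow> 'a \<Rightarrow> real" where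
  "Ham_of \<phi> x \<xi> = (SUP v. \<xi> \<bullet> v - \<phi> (x, v))"

definition G0 ::
    "real \<Rightarrow> real \<Rightarrow> ('a::euclidean_space \<Rightarrow> real) \<Rightarrow> 'a set \<Rightarrow> ('a \<times> 'a \<Rightarrow> real) set" where
  "G0 \<epsilon> p f \<Omega> = {\<phi> \<in> Phi_plus p f \<Omega>.
     \<exists>u. continuous_on (closure \<Omega>) u \<and> visc_subsol \<epsilon> (Ham_of \<phi>) \<Omega> 0 u}"

text \<open>Borel measures on a closed subset of a Euclidean space are Radon as soon as they are finite
  on compact sets, regularity being automatic.\<close>

definition radon_measure_on :: "'b::euclidean_space set \<Rightarrow> 'b measure \<Rightarrow> bool" where
  "radon_measure_on X \<mu> \<longleftrightarrow> sets \<mu> = sets (restrict_space borel X) \<and>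
     (\<forall>K\<subseteq>X. compact K \<longrightarrow> emeasure \<mu> K < \<infinity>)"

text \<open>The pairing of \<open>\<mu>\<close> with \<open>g\<close> is defined only for \<open>\<mu>\<close>-integrable \<open>g\<close>; as the Bochner
  integral of a non-integrable function is \<open>0\<close>, integrability is required explicitly.  For finite
  \<open>\<mu>\<close> it follows from integrability of \<open>L\<close>.\<close>

definition G0_dual ::
    "real \<Rightarrow> real \<Rightarrow> ('a::euclidean_space \<Rightarrow> real) \<Rightarrow> 'a set \<Rightarrow> ('a \<times> 'a) measure set" where
  "G0_dual \<epsilon> p f \<Omega> = {\<mu>. radon_measure_on (closure \<Omega> \<times> UNIV) \<mu> \<and>
     integrable \<mu> (\<lambda>(x, v). Lag p f x v) \<and>
     (\<forall>g\<in>G0 \<epsilon> p f \<Omega>. integrable \<mu> g \<and> integral\<^sup>L \<mu> g \<ge> 0)}"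

definition Mather_measures ::
    "real \<Rightarrow> real \<Rightarrow> ('a::euclidean_space \<Rightarrow> real) \<Rightarrow> 'a set \<Rightarrow> ('a \<times> 'a) measure set" where
  "Mather_measures \<epsilon> p f \<Omega> = {\<mu> \<in> G0_dual \<epsilon> p f \<Omega>. prob_space \<mu> \<and>
     (\<integral>(x, v). Lag p f x v \<partial>\<mu>) = - eigenvalue \<epsilon> (Ham p f) \<Omega>}"

definition scaled_eigenvalue ::
    "real \<Rightarrow> real \<Rightarrow> ('a::euclidean_space \<Rightarrow> real) \<Rightarrow> 'a set \<Rightarrow> real \<Rightarrow> real" where
  "scaled_eigenvalue \<epsilon> p f \<Omega> l = eigenvalue \<epsilon> (Ham p f) ((\<lambda>x. (1 + l) *\<^sub>R x) ` \<Omega>)"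

end

(*
  Put q = p/(p-1).  Replacing u(y) by (1+l)^(q-2) u((1+l)x) turns the problem on (1+l)Omega into
  |Dw|^p - eps Lap w <= (1+l)^q (f((1+l)x) + c) on Omega, so that c(l) = (1+l)^(-q) E(G_l), where
  G_l(x) = (1+l)^q f((1+l)x) and E(g) is the critical value of |Dw|^p - g(x) - eps Lap w on Omega.
  E is convex, monotone and satisfies E(g + const) = E(g) - const.  As L(x,v) = k|v|^q + f(x), a
  measure mu with x-marginal m is a Mather measure iff -m is a subgradient of E at f and the kinetic
  part of L has integral -E(f) - (integral of f dm), a number which is nonnegative since E(0) <= 0.
  The one-sided derivatives of E along G_l are thus the extreme values of the subgradients in the
  direction q f + x.Df (Hahn-Banach and Riesz), which is the claim.

  E is a minimum because p > 2 yields equicontinuity of subsolutions.  It is convex because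
  |xi|^p is a supremum of affine functions, conjugation by an exponential removes the drift from each
  of the resulting linear inequalities, and sums of viscosity subsolutions of -Lap z <= g are
  subsolutions by comparison with harmonic polynomials on small balls.
*)
theory Submission
  imports Defs
begin

section \<open>Second-order calculus\<close>

text \<open>The exponent q is the one for which |Dw|^p and Lap w scale alike under dilations,
  because p (q - 1) = q. Differentiating the factor (1+l)^(-q) contributes -q c(0). On the side of
  the measures the same term is q <mu, L>: the kinetic part of L is homogeneous of degree q in v, so
  that (-x,v).grad L = q L - (q f + x.Df).

  That the extrema are attained is built into the Hahn-Banach step: the supporting functional is
  chosen to coincide with the directional derivative in the prescribed direction, so that the limit
  and an extremal measure arise together. The left derivative is the right derivative in the
  opposite direction.

  The obstacle is a mismatch of function classes. The critical value refers to functions continuous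
  in the open set, whereas \<open>G0\<close> asks for continuity up to the boundary. Subsolutions
  are therefore dilated by a factor slightly below 1, at the cost of an arbitrarily small constant;
  the condition with kappa ensures that such dilations carry the closure into the open set.\<close>

lemma partial_eqI: "(\<phi> has_derivative D) (at x) \<Longrightarrow> partial i \<phi> x = D i"
  unfolding partial_def using frechet_derivative_at by metis

lemma Ck_on_subset: "Ck_on k \<phi> S \<Longrightarrow> T \<subseteq> S \<Longrightarrow> Ck_on k \<phi> T"
proof (induction k arbitrary: \<phi>)
  case 0 then show ?case by (auto intro: continuous_on_subset)
next
  case (Suc k) then show ?case by auto
qed

lemma has_derivative_grad:
  fixes \<phi> :: "'a::euclidean_space \<Rightarrow> real"
  assumes "\<phi> differentiable (at x)"
  shows "(\<phi> has_derivative (\<lambda>h. grad \<phi> x \<bullet> h)) (at x)"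
proof -
  have d: "(\<phi> has_derivative frechet_derivative \<phi> (at x)) (at x)"
    using assms by (simp add: frechet_derivative_works)
  then interpret linear "frechet_derivative \<phi> (at x)" by (rule has_derivative_linear)
  have "frechet_derivative \<phi> (at x) = (\<lambda>h. grad \<phi> x \<bullet> h)"
  proof
    fix h
    have "frechet_derivative \<phi> (at x) h = frechet_derivative \<phi> (at x) (\<Sum>i\<in>Basis. (h \<bullet> i) *\<^sub>R i)"
      by (simp add: euclidean_representation)
    also have "\<dots> = (\<Sum>i\<in>Basis. (h \<bullet> i) * frechet_derivative \<phi> (at x) i)"
      by (simp add: sum scale)
    also have "\<dots> = grad \<phi> x \<bullet> h"
      by (simp add: grad_def partial_def inner_sum_left inner_commute[of h] mult.commute)
    finally show "frechet_derivative \<phi> (at x) h = grad \<phi> x \<bullet> h" .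
  qed
  with d show ?thesis by simp
qed

lemma grad_eqI:
  fixes \<phi> :: "'a::euclidean_space \<Rightarrow> real"
  assumes "(\<phi> has_derivative (\<lambda>h. a \<bullet> h)) (at x)"
  shows "grad \<phi> x = a"
  unfolding grad_def partial_eqI[OF assms]
  by (simp add: euclidean_representation)

text \<open>Carries the gradient field and the Hessian map as explicit data, so that products,
  compositions and affine substitutions become computations with \<open>g\<close> and
  \<open>H\<close>. Continuity is recorded for the matrix entries only, which is what
  \<open>Ck_on 2\<close> asks for.\<close>

definition C2w :: "('a::euclidean_space \<Rightarrow> real) \<Rightarrow> ('a \<Rightarrow> 'a) \<Rightarrow> ('a \<Rightarrow> 'a \<Rightarrow> 'a) \<Rightarrow> bool" where
  "C2w \<phi> g H \<longleftrightarrow> (\<forall>x. (\<phi> has_derivative (\<lambda>h. g x \<bullet> h)) (at x)) \<and>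
     (\<forall>x. (g has_derivative H x) (at x)) \<and>
     (\<forall>i\<in>Basis. \<forall>j\<in>Basis. continuous_on UNIV (\<lambda>x. H x i \<bullet> j))"

lemma C2wD:
  assumes "C2w \<phi> g H"
  shows "(\<phi> has_derivative (\<lambda>h. g x \<bullet> h)) (at x)" "(g has_derivative H x) (at x)"
    "i \<in> Basis \<Longrightarrow> j \<in> Basis \<Longrightarrow> continuous_on S (\<lambda>x. H x i \<bullet> j)"
    "continuous_on S \<phi>" "continuous_on S g"
proof -
  show a: "(\<phi> has_derivative (\<lambda>h. g x \<bullet> h)) (at x)" "(g has_derivative H x) (at x)" for x
    using assms by (auto simp: C2w_def)
  show "i \<in> Basis \<Longrightarrow> j \<in> Basis \<Longrightarrow> continuous_on S (\<lambda>x. H x i \<bullet> j)"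
    using assms unfolding C2w_def by (meson continuous_on_subset subset_UNIV)
  show "continuous_on S \<phi>" "continuous_on S g"
    by (meson a has_derivative_continuous continuous_at_imp_continuous_on)+
qed

lemma C2w_linear: "C2w \<phi> g H \<Longrightarrow> linear (H x)"
  using C2wD(2) has_derivative_linear by blast

lemma C2w_grad: "C2w \<phi> g H \<Longrightarrow> grad \<phi> x = g x"
  using C2wD(1) grad_eqI by blast

lemma C2w_partial: "C2w \<phi> g H \<Longrightarrow> partial i \<phi> = (\<lambda>x. g x \<bullet> i)"
  using C2wD(1) partial_eqI by (metis ext)

lemma C2w_partial2: "C2w \<phi> g H \<Longrightarrow> partial j (partial i \<phi>) x = H x j \<bullet> i"
  unfolding C2w_partial
  by (rule partial_eqI) (rule has_derivative_inner_left[OF C2wD(2)])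

lemma C2w_laplacian: "C2w \<phi> g H \<Longrightarrow> laplacian \<phi> x = (\<Sum>i\<in>Basis. H x i \<bullet> i)"
  by (simp add: laplacian_def C2w_partial2)

lemma C2w_Ck: 
  assumes "C2w \<phi> g H" shows "Ck_on 2 \<phi> S"
proof -
  have "\<phi> differentiable (at x)" for x
    using C2wD(1)[OF assms] differentiable_def by blast
  moreover have "partial i \<phi> differentiable (at x)" for x i
    unfolding C2w_partial[OF assms] 
    using has_derivative_inner_left[OF C2wD(2)[OF assms]] differentiable_def by blast
  moreover have "continuous_on S (partial j (partial i \<phi>))" if "i \<in> Basis" "j \<in> Basis" for i j
    using C2wD(3)[OF assms that(2,1), of S] by (subst continuous_on_cong[OF refl C2w_partial2[OF assms]])
  ultimately show ?thesis
    by (simp add: numeral_2_eq_2)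
qed

lemma Ck_C2w:
  fixes \<phi> :: "'a::euclidean_space \<Rightarrow> real"
  assumes "Ck_on 2 \<phi> UNIV"
  obtains g H where "C2w \<phi> g H"
proof -
  from assms have d: "\<And>x. \<phi> differentiable (at x)"
    and d2: "\<And>i x. i \<in> Basis \<Longrightarrow> partial i \<phi> differentiable (at x)"
    and c: "\<And>i j. i \<in> Basis \<Longrightarrow> j \<in> Basis \<Longrightarrow> continuous_on UNIV (partial j (partial i \<phi>))"
    by (simp_all add: numeral_2_eq_2)
  define H where "H x h = (\<Sum>i\<in>Basis. (grad (partial i \<phi>) x \<bullet> h) *\<^sub>R i)" for x h
  have H: "(grad \<phi> has_derivative H x) (at x)" for x
    unfolding grad_def[abs_def] H_def[abs_def]
    by (auto intro!: derivative_intros has_derivative_grad d2 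
             simp flip: grad_def[of "partial _ \<phi>"])
  have g: "(\<phi> has_derivative (\<lambda>h. grad \<phi> x \<bullet> h)) (at x)" for x
    by (rule has_derivative_grad[OF d])
  have "H x i \<bullet> j = partial i (partial j \<phi>) x" if "i \<in> Basis" "j \<in> Basis" for x i j
  proof -
    have *: "partial j \<phi> = (\<lambda>x. grad \<phi> x \<bullet> j)"
      using partial_eqI[OF g] by blast
    show ?thesis unfolding * 
      by (rule partial_eqI[symmetric]) (rule has_derivative_inner_left[OF H])
  qed
  then have "C2w \<phi> (grad \<phi>) H"
    unfolding C2w_def using g H c by auto
  then show thesis by (rule that)
qed

lemma C2w_laplacian_cont: "C2w \<phi> g H \<Longrightarrow> continuous_on S (laplacian \<phi>)"
  by (subst continuous_on_cong[OF refl C2w_laplacian], assumption)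
     (intro continuous_on_sum C2wD(3))

lemma C2w_const: "C2w (\<lambda>x. c) (\<lambda>x. 0) (\<lambda>x h. 0)"
  by (auto simp: C2w_def)

lemma C2w_inner: "C2w (\<lambda>x. a \<bullet> x) (\<lambda>x. a) (\<lambda>x h. 0)"
  by (auto simp: C2w_def intro!: derivative_eq_intros)

lemma C2w_add: 
  assumes "C2w \<phi> g H" "C2w \<psi> k J"
  shows "C2w (\<lambda>x. \<phi> x + \<psi> x) (\<lambda>x. g x + k x) (\<lambda>x h. H x h + J x h)"
  unfolding C2w_def
  by (auto intro!: derivative_eq_intros continuous_intros C2wD[OF assms(1)] C2wD[OF assms(2)]
      simp: inner_add_left)

lemma C2w_mult:
  assumes "C2w \<phi> g H" "C2w \<psi> k J"
  shows "C2w (\<lambda>x. \<phi> x * \<psi> x) (\<lambda>x. \<phi> x *\<^sub>R k x + \<psi> x *\<^sub>R g x)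
    (\<lambda>x h. (g x \<bullet> h) *\<^sub>R k x + \<phi> x *\<^sub>R J x h + (k x \<bullet> h) *\<^sub>R g x + \<psi> x *\<^sub>R H x h)"
  unfolding C2w_def
  by (intro conjI allI ballI)
    (auto intro!: derivative_eq_intros continuous_intros C2wD[OF assms(1)] C2wD[OF assms(2)]
      simp: inner_add_left algebra_simps fun_eq_iff)

lemma C2w_cmult:
  assumes "C2w \<phi> g H"
  shows "C2w (\<lambda>x. c * \<phi> x) (\<lambda>x. c *\<^sub>R g x) (\<lambda>x h. c *\<^sub>R H x h)"
  unfolding C2w_def
  by (intro conjI allI ballI)
    (auto intro!: derivative_eq_intros continuous_intros C2wD[OF assms(1)]
      simp: fun_eq_iff)

lemma C2w_compose:
  assumes "C2w \<phi> g H" and F: "\<And>t. (F has_real_derivative F' t) (at t)"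
    and F': "\<And>t. (F' has_real_derivative F'' t) (at t)" and c: "continuous_on UNIV F''"
  shows "C2w (\<lambda>x. F (\<phi> x)) (\<lambda>x. F' (\<phi> x) *\<^sub>R g x)
    (\<lambda>x h. (F'' (\<phi> x) * (g x \<bullet> h)) *\<^sub>R g x + F' (\<phi> x) *\<^sub>R H x h)"
proof -
  have dF: "((\<lambda>x. F (\<phi> x)) has_derivative (\<lambda>h. F' (\<phi> x) * (g x \<bullet> h))) (at x)" for x
    using has_derivative_compose[OF C2wD(1)[OF assms(1)], of F] F
    by (simp add: has_field_derivative_def)
  have dF2: "((\<lambda>x. F (\<phi> x)) has_derivative (\<lambda>h. (F' (\<phi> x) *\<^sub>R g x) \<bullet> h)) (at x)" for x
    using dF by simp
  have dF': "((\<lambda>x. F' (\<phi> x)) has_derivative (\<lambda>h. F'' (\<phi> x) * (g x \<bullet> h))) (at x)" for x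
    using has_derivative_compose[OF C2wD(1)[OF assms(1)], of F'] F'
    by (simp add: has_field_derivative_def)
  have cF'': "continuous_on UNIV (\<lambda>x. F'' (\<phi> x))"
    by (rule continuous_on_compose2[OF c C2wD(4)[OF assms(1)]]) simp
  have cF': "continuous_on UNIV (\<lambda>x. F' (\<phi> x))"
    by (intro continuous_at_imp_continuous_on ballI has_derivative_continuous[OF dF'])
  show ?thesis
    unfolding C2w_def
    by (intro conjI allI ballI)
      (auto intro!: derivative_eq_intros continuous_intros C2wD[OF assms(1)] dF2 dF' cF'' cF'
        simp: fun_eq_iff inner_add_left algebra_simps)
qed

lemma C2w_affine:
  assumes "C2w \<phi> g H"
  shows "C2w (\<lambda>x. \<phi> (s *\<^sub>R x + a)) (\<lambda>x. s *\<^sub>R g (s *\<^sub>R x + a)) (\<lambda>x h. s\<^sup>2 *\<^sub>R H (s *\<^sub>R x + a) h)"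
proof -
  have A: "((\<lambda>x. s *\<^sub>R x + a) has_derivative (\<lambda>h. s *\<^sub>R h)) (at x)" for x
    by (auto intro!: derivative_eq_intros)
  have 1: "((\<lambda>x. \<phi> (s *\<^sub>R x + a)) has_derivative (\<lambda>h. (s *\<^sub>R g (s *\<^sub>R x + a)) \<bullet> h)) (at x)" for x
    using has_derivative_compose[OF A C2wD(1)[OF assms]] by (simp add: mult.commute)
  have 2: "((\<lambda>x. s *\<^sub>R g (s *\<^sub>R x + a)) has_derivative (\<lambda>h. s\<^sup>2 *\<^sub>R H (s *\<^sub>R x + a) h)) (at x)" for x
    using has_derivative_scaleR_right[OF has_derivative_compose[OF A C2wD(2)[OF assms]], of s]
      linear_scale[OF C2w_linear[OF assms]]
    by (simp add: power2_eq_square)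
  have 3: "continuous_on UNIV (\<lambda>x. (s\<^sup>2 *\<^sub>R H (s *\<^sub>R x + a) i) \<bullet> j)" if "i \<in> Basis" "j \<in> Basis" for i j
  proof -
    have "continuous_on UNIV (\<lambda>x. H (s *\<^sub>R x + a) i \<bullet> j)"
      by (rule continuous_on_compose2[OF C2wD(3)[OF assms that, of UNIV]])
        (auto intro!: continuous_intros)
    then show ?thesis by (auto intro!: continuous_intros)
  qed
  show ?thesis unfolding C2w_def using 1 2 3 by blast
qed

lemma C2w_sq: "C2w (\<lambda>x. (norm (x - a))\<^sup>2) (\<lambda>x. 2 *\<^sub>R (x - a)) (\<lambda>x h. 2 *\<^sub>R h)"
  unfolding C2w_def dot_square_norm[symmetric]
  by (auto intro!: derivative_eq_intros simp: inner_commute)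

lemma grad_laplacian_add:
  assumes "Ck_on 2 \<phi> UNIV" "Ck_on 2 \<psi> UNIV"
  shows "Ck_on 2 (\<lambda>x. \<phi> x + \<psi> x) UNIV" "grad (\<lambda>x. \<phi> x + \<psi> x) x = grad \<phi> x + grad \<psi> x"
    "laplacian (\<lambda>x. \<phi> x + \<psi> x) x = laplacian \<phi> x + laplacian \<psi> x"
proof -
  obtain g H where 1: "C2w \<phi> g H" using Ck_C2w assms by metis
  obtain k J where 2: "C2w \<psi> k J" using Ck_C2w assms by metis
  note 3 = C2w_add[OF 1 2]
  show "Ck_on 2 (\<lambda>x. \<phi> x + \<psi> x) UNIV" "grad (\<lambda>x. \<phi> x + \<psi> x) x = grad \<phi> x + grad \<psi> x"
    "laplacian (\<lambda>x. \<phi> x + \<psi> x) x = laplacian \<phi> x + laplacian \<psi> x"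
    using C2w_Ck[OF 3] C2w_grad[OF 1] C2w_grad[OF 2] C2w_grad[OF 3]
      C2w_laplacian[OF 1] C2w_laplacian[OF 2] C2w_laplacian[OF 3]
    by (auto simp: inner_add_left sum.distrib)
qed

lemma grad_laplacian_cmult:
  assumes "Ck_on 2 \<phi> UNIV"
  shows "Ck_on 2 (\<lambda>x. c * \<phi> x) UNIV" "grad (\<lambda>x. c * \<phi> x) x = c *\<^sub>R grad \<phi> x"
    "laplacian (\<lambda>x. c * \<phi> x) x = c * laplacian \<phi> x"
proof -
  obtain g H where 1: "C2w \<phi> g H" using Ck_C2w assms by metis
  note 3 = C2w_cmult[OF 1, of c]
  show "Ck_on 2 (\<lambda>x. c * \<phi> x) UNIV" "grad (\<lambda>x. c * \<phi> x) x = c *\<^sub>R grad \<phi> x"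
    "laplacian (\<lambda>x. c * \<phi> x) x = c * laplacian \<phi> x"
    using C2w_Ck[OF 3] C2w_grad[OF 1] C2w_grad[OF 3]
      C2w_laplacian[OF 1] C2w_laplacian[OF 3]
    by (auto simp: sum_distrib_left)
qed

lemma grad_laplacian_affine:
  assumes "Ck_on 2 \<phi> UNIV"
  shows "Ck_on 2 (\<lambda>x. \<phi> (s *\<^sub>R x + a)) UNIV" 
    "grad (\<lambda>x. \<phi> (s *\<^sub>R x + a)) x = s *\<^sub>R grad \<phi> (s *\<^sub>R x + a)"
    "laplacian (\<lambda>x. \<phi> (s *\<^sub>R x + a)) x = s\<^sup>2 * laplacian \<phi> (s *\<^sub>R x + a)"
proof -
  obtain g H where 1: "C2w \<phi> g H" using Ck_C2w assms by metis
  note 3 = C2w_affine[OF 1, of s a]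
  show "Ck_on 2 (\<lambda>x. \<phi> (s *\<^sub>R x + a)) UNIV" 
    "grad (\<lambda>x. \<phi> (s *\<^sub>R x + a)) x = s *\<^sub>R grad \<phi> (s *\<^sub>R x + a)"
    "laplacian (\<lambda>x. \<phi> (s *\<^sub>R x + a)) x = s\<^sup>2 * laplacian \<phi> (s *\<^sub>R x + a)"
    using C2w_Ck[OF 3] C2w_grad[OF 1] C2w_grad[OF 3]
      C2w_laplacian[OF 1] C2w_laplacian[OF 3]
    by (auto simp: sum_distrib_left)
qed

lemma grad_laplacian_const:
  fixes x :: "'a::euclidean_space"
  shows "Ck_on 2 (\<lambda>x::'a. c) UNIV" "grad (\<lambda>x::'a. c) x = 0" "laplacian (\<lambda>x::'a. c) x = 0"
proof -
  note 3 = C2w_const[of c, where 'a='a]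
  show "Ck_on 2 (\<lambda>x::'a. c) UNIV" "grad (\<lambda>x::'a. c) x = 0" "laplacian (\<lambda>x::'a. c) x = 0"
    using C2w_Ck[OF 3] C2w_grad[OF 3] C2w_laplacian[OF 3] by auto
qed

lemma grad_laplacian_sq:
  fixes x a :: "'a::euclidean_space"
  shows "Ck_on 2 (\<lambda>x. (norm (x - a))\<^sup>2) UNIV" "grad (\<lambda>x. (norm (x - a))\<^sup>2) x = 2 *\<^sub>R (x - a)"
    "laplacian (\<lambda>x. (norm (x - a))\<^sup>2) x = 2 * DIM('a)"
  using C2w_Ck[OF C2w_sq] C2w_grad[OF C2w_sq] C2w_laplacian[OF C2w_sq, of a x] by auto

lemma laplacian_cont:
  fixes \<phi> :: "'a::euclidean_space \<Rightarrow> real"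
  assumes "Ck_on 2 \<phi> UNIV"
  shows "continuous_on S (laplacian \<phi>)" "continuous_on S (grad \<phi>)" "continuous_on S \<phi>"
proof -
  obtain g H where 1: "C2w \<phi> g H" using Ck_C2w assms by metis
  show "continuous_on S (laplacian \<phi>)" using C2w_laplacian_cont[OF 1] .
  have "grad \<phi> = g" using C2w_grad[OF 1] by blast
  then show "continuous_on S (grad \<phi>)" "continuous_on S \<phi>" using C2wD[OF 1] by auto
qed

section \<open>Viscosity inequalities and local tests\<close>

lemma grad_laplacian_mult:
  assumes "Ck_on 2 \<phi> UNIV" "Ck_on 2 \<psi> UNIV"
  shows "Ck_on 2 (\<lambda>x. \<phi> x * \<psi> x) UNIV" 
    "grad (\<lambda>x. \<phi> x * \<psi> x) x = \<phi> x *\<^sub>R grad \<psi> x + \<psi> x *\<^sub>R grad \<phi> x"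
    "laplacian (\<lambda>x. \<phi> x * \<psi> x) x
      = \<phi> x * laplacian \<psi> x + \<psi> x * laplacian \<phi> x + 2 * (grad \<phi> x \<bullet> grad \<psi> x)"
proof -
  obtain g H where 1: "C2w \<phi> g H" using Ck_C2w assms by metis
  obtain k J where 2: "C2w \<psi> k J" using Ck_C2w assms by metis
  note 3 = C2w_mult[OF 1 2]
  have *: "(\<Sum>i\<in>Basis. (g x \<bullet> i) * (k x \<bullet> i)) = g x \<bullet> k x" "(\<Sum>i\<in>Basis. (k x \<bullet> i) * (g x \<bullet> i)) = g x \<bullet> k x"
    by (simp_all add: euclidean_inner[of "g x" "k x"] mult.commute)
  then have **: "(\<Sum>i\<in>Basis. 2 * ((g x \<bullet> i) * (k x \<bullet> i))) = 2 * (g x \<bullet> k x)"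
    by (simp flip: sum_distrib_left)
  show "Ck_on 2 (\<lambda>x. \<phi> x * \<psi> x) UNIV" 
    "grad (\<lambda>x. \<phi> x * \<psi> x) x = \<phi> x *\<^sub>R grad \<psi> x + \<psi> x *\<^sub>R grad \<phi> x"
    "laplacian (\<lambda>x. \<phi> x * \<psi> x) x
      = \<phi> x * laplacian \<psi> x + \<psi> x * laplacian \<phi> x + 2 * (grad \<phi> x \<bullet> grad \<psi> x)"
    using C2w_Ck[OF 3] C2w_grad[OF 1] C2w_grad[OF 2] C2w_grad[OF 3]
      C2w_laplacian[OF 1] C2w_laplacian[OF 2] C2w_laplacian[OF 3] * **
    by (auto simp: inner_add_left sum.distrib sum_distrib_left)
qed

lemma grad_laplacian_inner:
  fixes a x :: "'a::euclidean_space"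
  shows "Ck_on 2 (\<lambda>x. a \<bullet> x) UNIV" "grad (\<lambda>x. a \<bullet> x) x = a" "laplacian (\<lambda>x. a \<bullet> x) x = 0"
  using C2w_Ck[OF C2w_inner[of a]] C2w_grad[OF C2w_inner[of a]] C2w_laplacian[OF C2w_inner[of a]] by auto

lemma grad_laplacian_compose:
  assumes "Ck_on 2 \<phi> UNIV" and F: "\<And>t. (F has_real_derivative F' t) (at t)"
    and F': "\<And>t. (F' has_real_derivative F'' t) (at t)" and c: "continuous_on UNIV F''"
  shows "Ck_on 2 (\<lambda>x. F (\<phi> x)) UNIV" "grad (\<lambda>x. F (\<phi> x)) x = F' (\<phi> x) *\<^sub>R grad \<phi> x"
    "laplacian (\<lambda>x. F (\<phi> x)) x = F'' (\<phi> x) * (norm (grad \<phi> x))\<^sup>2 + F' (\<phi> x) * laplacian \<phi> x"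
proof -
  obtain g H where 1: "C2w \<phi> g H" using Ck_C2w assms by metis
  note 3 = C2w_compose[OF 1 F F' c]
  have *: "(\<Sum>i\<in>Basis. F'' (\<phi> x) * (g x \<bullet> i) * (g x \<bullet> i)) = F'' (\<phi> x) * (norm (g x))\<^sup>2"
    unfolding dot_square_norm[symmetric] euclidean_inner[of "g x" "g x"]
    by (simp add: sum_distrib_left mult.assoc)
  show "Ck_on 2 (\<lambda>x. F (\<phi> x)) UNIV" "grad (\<lambda>x. F (\<phi> x)) x = F' (\<phi> x) *\<^sub>R grad \<phi> x"
    "laplacian (\<lambda>x. F (\<phi> x)) x = F'' (\<phi> x) * (norm (grad \<phi> x))\<^sup>2 + F' (\<phi> x) * laplacian \<phi> x"
    using C2w_Ck[OF 3] C2w_grad[OF 1] C2w_grad[OF 3]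
      C2w_laplacian[OF 1] C2w_laplacian[OF 3] *
    by (auto simp: inner_add_left sum.distrib sum_distrib_left)
qed

lemma grad_laplacian_sum:
  fixes \<phi> :: "'i \<Rightarrow> 'a::euclidean_space \<Rightarrow> real"
  assumes "finite I" "\<And>i. i \<in> I \<Longrightarrow> Ck_on 2 (\<phi> i) UNIV"
  shows "Ck_on 2 (\<lambda>x. \<Sum>i\<in>I. \<phi> i x) UNIV \<and> grad (\<lambda>x. \<Sum>i\<in>I. \<phi> i x) x = (\<Sum>i\<in>I. grad (\<phi> i) x)
    \<and> laplacian (\<lambda>x. \<Sum>i\<in>I. \<phi> i x) x = (\<Sum>i\<in>I. laplacian (\<phi> i) x)"
  using assms
proof (induction I rule: finite_induct)
  case empty then show ?case using grad_laplacian_const[where c=0 and 'a='a] by simp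
next
  case (insert j I)
  then have "Ck_on 2 (\<phi> j) UNIV" "Ck_on 2 (\<lambda>x. \<Sum>i\<in>I. \<phi> i x) UNIV" by auto
  from grad_laplacian_add[OF this] insert show ?case by simp
qed

text \<open>Taylor expansion to second order with an enlarged quadratic part: the extra multiple of
  |y - x|^2 dominates the remainder near \<open>x\<close>, at the price of \<open>\<delta>\<close>
  in the Laplacian. It exchanges a test function that is C^2 on \<open>S\<close> for one that is C^2
  everywhere.\<close>

lemma Ck2_local_upper:
  fixes \<phi> :: "'a::euclidean_space \<Rightarrow> real"
  assumes S: "open S" "x \<in> S" and \<phi>: "Ck_on 2 \<phi> S" and \<delta>: "\<delta> > 0"
  obtains Q where "Ck_on 2 Q UNIV" "Q x = \<phi> x" "grad Q x = grad \<phi> x"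
    "laplacian Q x = laplacian \<phi> x + \<delta>" "\<forall>\<^sub>F y in nhds x. \<phi> y \<le> Q y"
proof -
  define n where "n = real DIM('a)"
  have n: "n \<ge> 1" unfolding n_def by simp
  have d1: "\<And>x. x \<in> S \<Longrightarrow> \<phi> differentiable (at x)"
    and d2: "\<And>i x. i \<in> Basis \<Longrightarrow> x \<in> S \<Longrightarrow> partial i \<phi> differentiable (at x)"
    and c: "\<And>i j. i \<in> Basis \<Longrightarrow> j \<in> Basis \<Longrightarrow> continuous_on S (partial j (partial i \<phi>))"
    using \<phi> by (simp_all add: numeral_2_eq_2)
  define A where "A i j = partial j (partial i \<phi>)" for i j
  define f where "f i y = i \<bullet> (y - x)" for i y
  have f: "Ck_on 2 (f i) UNIV" "grad (f i) y = i" "laplacian (f i) y = 0" for i y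
  proof -
    have *: "f i = (\<lambda>y. i \<bullet> y + - (i \<bullet> x))" by (auto simp: f_def inner_diff_right)
    show "Ck_on 2 (f i) UNIV" "grad (f i) y = i" "laplacian (f i) y = 0"
      unfolding * using grad_laplacian_inner[of i] grad_laplacian_const(2,3)[of "- (i \<bullet> x)" y]
        grad_laplacian_add(1)[OF grad_laplacian_inner(1)[of i] grad_laplacian_const(1)[of "- (i \<bullet> x)"]]
        grad_laplacian_add(2,3)[OF grad_laplacian_inner(1)[of i] grad_laplacian_const(1)[of "- (i \<bullet> x)"], of y]
      by simp_all
  qed
  \<comment> \<open>The quadratic Taylor term. The matrix of second derivatives enters as it stands:
    only its trace and its values on pairs (h, h) matter.\<close>
  define B where "B y = (\<Sum>(i,j)\<in>Basis\<times>Basis. (A i j x / 2) * (f i y * f j y))" for y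
  have fB: "finite (Basis \<times> Basis :: ('a \<times> 'a) set)" by simp
  have f0: "f i x = 0" for i by (simp add: f_def)
  have t': "Ck_on 2 (\<lambda>y. c * (f i y * f j y)) UNIV" "grad (\<lambda>y. c * (f i y * f j y)) x = 0"
    "laplacian (\<lambda>y. c * (f i y * f j y)) x = c * (2 * (i \<bullet> j))" for c i j
    using grad_laplacian_cmult(1)[OF grad_laplacian_mult(1)[OF f(1) f(1)]]
      grad_laplacian_cmult(2,3)[OF grad_laplacian_mult(1)[OF f(1) f(1)], of c i j x]
      grad_laplacian_mult(2,3)[OF f(1) f(1), of i j x] by (simp_all add: f f0)
  have t: "Ck_on 2 (case ij of (i,j) \<Rightarrow> \<lambda>y. (A i j x / 2) * (f i y * f j y)) UNIV"
     "grad (case ij of (i,j) \<Rightarrow> \<lambda>y. (A i j x / 2) * (f i y * f j y)) x = 0"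
     "laplacian (case ij of (i,j) \<Rightarrow> \<lambda>y. (A i j x / 2) * (f i y * f j y)) x = (case ij of (i,j) \<Rightarrow> A i j x * (i \<bullet> j))" for ij
    using t'[of "A (fst ij) (snd ij) x / 2" "fst ij" "snd ij"] by (auto split: prod.split)
  have B_eq: "B = (\<lambda>y. \<Sum>ij\<in>Basis\<times>Basis. (case ij of (i,j) \<Rightarrow> \<lambda>y. (A i j x / 2) * (f i y * f j y)) y)"
    by (auto simp: B_def fun_eq_iff intro!: sum.cong)
  have B: "Ck_on 2 B UNIV" "grad B x = 0" "laplacian B x = laplacian \<phi> x" "B x = 0"
  proof -
    note g = grad_laplacian_sum[OF fB, of "\<lambda>ij. (case ij of (i,j) \<Rightarrow> \<lambda>y. (A i j x / 2) * (f i y * f j y))" x, folded B_eq, OF t(1)]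
    show "Ck_on 2 B UNIV" "grad B x = 0" using g t by auto
    have "laplacian B x = (\<Sum>i\<in>Basis. \<Sum>j\<in>Basis. A i j x * (i \<bullet> j))"
      using g unfolding t(3) by (simp add: sum.cartesian_product)
    also have "\<dots> = (\<Sum>i\<in>Basis. \<Sum>j\<in>Basis. if i = j then A i j x else 0)"
      by (intro sum.cong refl) (simp add: inner_Basis)
    also have "\<dots> = laplacian \<phi> x" by (simp add: laplacian_def A_def)
    finally show "laplacian B x = laplacian \<phi> x" .
    show "B x = 0" by (simp add: B_def f_def)
  qed
  define q where "q y = (norm (y - x))\<^sup>2" for y
  have q: "Ck_on 2 q UNIV" "grad q x = 0" "laplacian q x = 2 * n" "q x = 0"
    unfolding q_def n_def using grad_laplacian_sq[of x] by auto
  define d where "d = \<delta> / (2 * n)"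
  have d: "d * (2 * n) = \<delta>" using n by (simp add: d_def)
  define Q where "Q y = ((\<phi> x + f (grad \<phi> x) y) + B y) + d * q y" for y
  note C = grad_laplacian_const(1)[of "\<phi> x", where 'a='a]
  note C1 = grad_laplacian_add(1)[OF C f(1)]
  note C2 = grad_laplacian_add(1)[OF C1 B(1)]
  note C3 = grad_laplacian_cmult(1)[OF q(1)]
  have Q1: "Ck_on 2 Q UNIV"
    unfolding Q_def using grad_laplacian_add(1)[OF C2 C3] .
  have Q2: "grad Q x = grad \<phi> x"
    unfolding Q_def using grad_laplacian_add(2)[OF C2 C3] grad_laplacian_add(2)[OF C1 B(1)]
      grad_laplacian_add(2)[OF C f(1)] grad_laplacian_cmult(2)[OF q(1)] grad_laplacian_const(2) B q f by simp
  have Q3: "laplacian Q x = laplacian \<phi> x + \<delta>"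
    unfolding Q_def using grad_laplacian_add(3)[OF C2 C3] grad_laplacian_add(3)[OF C1 B(1)]
      grad_laplacian_add(3)[OF C f(1)] grad_laplacian_cmult(3)[OF q(1)] grad_laplacian_const(3) B q f d by simp
  have Q4: "Q x = \<phi> x" by (simp add: Q_def B q f_def)
  \<comment> \<open>If each of the n^2 second derivatives varies by at most \<open>e\<close>, the
    quadratic term changes by at most n^2 (e/2) |h|^2 = d |h|^2, which is exactly the slack left by
    \<open>d * q y\<close>.\<close>
  define e where "e = \<delta> / (n * (n * n))"
  have e: "e > 0" using \<delta> n by (simp add: e_def)
  have "\<forall>\<^sub>F z in nhds x. z \<in> S \<and> (\<forall>i\<in>Basis. \<forall>j\<in>Basis. \<bar>A i j z - A i j x\<bar> < e)"
  proof (intro eventually_conj eventually_ball_finite ballI)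
    show "\<forall>\<^sub>F z in nhds x. z \<in> S" using S by (simp add: eventually_nhds_in_open)
    fix i j :: 'a assume ij: "i \<in> Basis" "j \<in> Basis"
    have "continuous (at x) (A i j)" 
      using c[OF ij] S unfolding A_def by (simp add: continuous_on_eq_continuous_at)
    then have "filterlim (A i j) (nhds (A i j x)) (nhds x)"
      by (simp add: continuous_at tendsto_at_iff_tendsto_nhds)
    from tendstoD[OF this e] show "\<forall>\<^sub>F z in nhds x. \<bar>A i j z - A i j x\<bar> < e"
      by (simp add: dist_real_def)
  qed auto
  then obtain r where r: "r > 0" and rS: "\<And>z. z \<in> ball x r \<Longrightarrow> z \<in> S" 
    and rA: "\<And>z i j. z \<in> ball x r \<Longrightarrow> i \<in> Basis \<Longrightarrow> j \<in> Basis \<Longrightarrow> \<bar>A i j z - A i j x\<bar> < e"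
    unfolding eventually_nhds_metric by (auto simp: dist_commute)
  have up: "\<phi> y \<le> Q y" if y: "y \<in> ball x r" for y
  proof -
    define h where "h = y - x"
    have seg: "x + t *\<^sub>R h \<in> ball x r" if "0 \<le> t" "t \<le> 1" for t
    proof -
      have "norm (t *\<^sub>R h) \<le> norm h" using that by (simp add: mult_left_le_one_le)
      also have "\<dots> < r" using y by (simp add: h_def dist_norm norm_minus_commute)
      finally show ?thesis by (simp add: dist_norm)
    qed
    define diff where "diff m t = (if m = 0 then \<phi> (x + t *\<^sub>R h) else if m = 1 
       then (\<Sum>i\<in>Basis. partial i \<phi> (x + t *\<^sub>R h) * (h \<bullet> i))
       else (\<Sum>i\<in>Basis. (\<Sum>j\<in>Basis. A i j (x + t *\<^sub>R h) * (h \<bullet> j)) * (h \<bullet> i)))" for m :: nat and t :: real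
    have L: "((\<lambda>t. x + t *\<^sub>R h) has_derivative (\<lambda>s. s *\<^sub>R h)) (at t)" for t
      by (auto intro!: derivative_eq_intros)
    have gs: "(\<Sum>j\<in>Basis. partial j \<psi> z * (h \<bullet> j)) = grad \<psi> z \<bullet> h" for \<psi> z
      by (simp add: grad_def inner_sum_left inner_commute[of h])
    have gr: "((\<lambda>t. \<psi> (x + t *\<^sub>R h)) has_real_derivative (\<Sum>j\<in>Basis. partial j \<psi> (x + t *\<^sub>R h) * (h \<bullet> j))) (at t)"
      if "\<psi> differentiable (at (x + t *\<^sub>R h))" for \<psi> t
      using has_derivative_compose[OF L has_derivative_grad[OF that]]
      unfolding gs by (simp add: has_field_derivative_def mult_commute_abs)
    have D: "\<forall>m t. m < 2 \<and> 0 \<le> t \<and> t \<le> 1 \<longrightarrow> (diff m has_real_derivative diff (Suc m) t) (at t)"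
    proof (intro allI impI)
      fix m :: nat and t :: real assume a: "m < 2 \<and> 0 \<le> t \<and> t \<le> 1"
      then have xS: "x + t *\<^sub>R h \<in> S" using seg rS by blast
      consider "m = 0" | "m = 1" using a by linarith
      then show "(diff m has_real_derivative diff (Suc m) t) (at t)"
      proof cases
        case 1 then show ?thesis using gr[OF d1[OF xS]] by (simp add: diff_def[abs_def])
      next
        case 2 
        have "((\<lambda>t. \<Sum>i\<in>Basis. partial i \<phi> (x + t *\<^sub>R h) * (h \<bullet> i)) has_real_derivative 
           (\<Sum>i\<in>Basis. (\<Sum>j\<in>Basis. A i j (x + t *\<^sub>R h) * (h \<bullet> j)) * (h \<bullet> i))) (at t)"
          unfolding A_def by (intro DERIV_sum DERIV_cmult_right gr d2 xS)
        then show ?thesis using 2 by (simp add: diff_def[abs_def])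
      qed
    qed
    obtain t where t: "0 < t" "t < 1" and eq: "diff 0 1 = (\<Sum>m<2. diff m 0 / fact m * 1 ^ m) + diff 2 t / fact 2 * 1 ^ 2"
      using Maclaurin[of 1 2 diff "diff 0", OF _ _ refl D] by auto
    have *: "\<phi> y = \<phi> x + grad \<phi> x \<bullet> h + diff 2 t / 2"
      using eq by (simp add: diff_def numeral_2_eq_2 gs) (simp add: h_def)
    have "diff 2 t / 2 - B y = (\<Sum>i\<in>Basis. \<Sum>j\<in>Basis. (A i j (x + t *\<^sub>R h) - A i j x) / 2 * (h \<bullet> i) * (h \<bullet> j))"
      by (simp add: diff_def B_def f_def h_def[symmetric] sum.cartesian_product[symmetric] sum_subtractf[symmetric] sum_divide_distrib sum_distrib_right inner_commute)
         (simp add: algebra_simps diff_divide_distrib)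
    also have "\<dots> \<le> (\<Sum>i\<in>(Basis::'a set). \<Sum>j\<in>(Basis::'a set). e / 2 * (norm h)\<^sup>2)"
    proof (intro sum_mono)
      fix i j :: 'a assume ij: "i \<in> Basis" "j \<in> Basis"
      have "\<bar>(A i j (x + t *\<^sub>R h) - A i j x) / 2 * (h \<bullet> i) * (h \<bullet> j)\<bar> \<le> e / 2 * norm h * norm h"
        unfolding abs_mult using rA[OF seg ij, of t] t ij e
        by (intro mult_mono) (auto intro: Basis_le_norm)
      then show "(A i j (x + t *\<^sub>R h) - A i j x) / 2 * (h \<bullet> i) * (h \<bullet> j) \<le> e / 2 * (norm h)\<^sup>2"
        by (simp add: power2_eq_square)
    qed
    also have "\<dots> = n * n * (e / 2) * (norm h)\<^sup>2" by (simp add: n_def)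
    also have "\<dots> = d * q y" using n by (simp add: d_def e_def q_def h_def field_simps)
    finally have "diff 2 t / 2 \<le> B y + d * q y" by simp
    then show ?thesis using * by (simp add: Q_def f_def h_def)
  qed
  have "\<forall>\<^sub>F y in nhds x. \<phi> y \<le> Q y"
    unfolding eventually_nhds_metric using r up by (auto simp: dist_commute)
  with Q1 Q2 Q3 Q4 show thesis using that by blast
qed

text \<open>Viscosity subsolutions of \<open>N(Dw) - \<epsilon> \<Delta>w \<le> g\<close> in \<open>S\<close>, with test functions that are \<open>C\<^sup>2\<close> on the
  whole space: in contrast to \<open>visc_subsol\<close>, this is visibly monotone in \<open>S\<close>.\<close>

definition vsub ::
    "real \<Rightarrow> ('a::euclidean_space \<Rightarrow> real) \<Rightarrow> ('a \<Rightarrow> real) \<Rightarrow> 'a set \<Rightarrow> ('a \<Rightarrow> real) \<Rightarrow> bool" where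
  "vsub \<epsilon> N g S w \<longleftrightarrow>
     (\<forall>x\<in>S. \<forall>\<phi>. Ck_on 2 \<phi> UNIV \<longrightarrow> (\<forall>\<^sub>F y in nhds x. w y - \<phi> y \<le> w x - \<phi> x) \<longrightarrow>
        N (grad \<phi> x) - \<epsilon> * laplacian \<phi> x \<le> g x)"

lemma vsubD:
  "vsub \<epsilon> N g S w \<Longrightarrow> x \<in> S \<Longrightarrow> Ck_on 2 \<phi> UNIV \<Longrightarrow> \<forall>\<^sub>F y in nhds x. w y - \<phi> y \<le> w x - \<phi> x
    \<Longrightarrow> N (grad \<phi> x) - \<epsilon> * laplacian \<phi> x \<le> g x"
  unfolding vsub_def by blast

lemma vsub_mono: "vsub \<epsilon> N g S w \<Longrightarrow> T \<subseteq> S \<Longrightarrow> (\<And>x. x \<in> T \<Longrightarrow> g x \<le> g' x) \<Longrightarrow> vsub \<epsilon> N g' T w"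
  unfolding vsub_def by (meson order_trans subsetD)

text \<open>For the converse, a test function on \<open>S\<close> is replaced by the larger one from
  \<open>Ck2_local_upper\<close>. Touching from above preserves the local maximum, and the excess
  \<open>e / \<epsilon>\<close> in the Laplacian costs only \<open>e\<close>, which tends to
  0.\<close>

lemma visc_subsol_iff_vsub:
  assumes S: "open S" and \<epsilon>: "\<epsilon> > 0" and G: "\<And>x \<xi>. x \<in> S \<Longrightarrow> G x \<xi> = N \<xi> - g x"
  shows "visc_subsol \<epsilon> G S c w \<longleftrightarrow> vsub \<epsilon> N (\<lambda>x. g x + c) S w"
proof
  assume v: "visc_subsol \<epsilon> G S c w"
  show "vsub \<epsilon> N (\<lambda>x. g x + c) S w"
    unfolding vsub_def
  proof (intro ballI allI impI)
    fix x \<phi> assume x: "x \<in> S" and \<phi>: "Ck_on 2 \<phi> UNIV" and m: "\<forall>\<^sub>F y in nhds x. w y - \<phi> y \<le> w x - \<phi> x"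
    have "G x (grad \<phi> x) - \<epsilon> * laplacian \<phi> x \<le> c"
      using v x m Ck_on_subset[OF \<phi> subset_UNIV] unfolding visc_subsol_def by blast
    then show "N (grad \<phi> x) - \<epsilon> * laplacian \<phi> x \<le> g x + c" using G[OF x] by simp
  qed
next
  assume v: "vsub \<epsilon> N (\<lambda>x. g x + c) S w"
  show "visc_subsol \<epsilon> G S c w"
    unfolding visc_subsol_def
  proof (intro ballI allI impI)
    fix x \<phi> assume x: "x \<in> S" and \<phi>: "Ck_on 2 \<phi> S" and m: "\<forall>\<^sub>F y in nhds x. w y - \<phi> y \<le> w x - \<phi> x"
    have "N (grad \<phi> x) - \<epsilon> * laplacian \<phi> x - (g x + c) \<le> e" if e: "e > 0" for e
    proof -
      obtain Q where Q: "Ck_on 2 Q UNIV" "Q x = \<phi> x" "grad Q x = grad \<phi> x"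
        "laplacian Q x = laplacian \<phi> x + e / \<epsilon>" "\<forall>\<^sub>F y in nhds x. \<phi> y \<le> Q y"
        using Ck2_local_upper[OF S x \<phi>, of "e / \<epsilon>"] e \<epsilon> by auto
      have "\<forall>\<^sub>F y in nhds x. w y - Q y \<le> w x - Q x"
        using m Q(5) by eventually_elim (simp add: Q)
      from vsubD[OF v x Q(1) this] show ?thesis using Q \<epsilon> by (simp add: algebra_simps)
    qed
    then have "N (grad \<phi> x) - \<epsilon> * laplacian \<phi> x - (g x + c) \<le> 0"
      by (rule field_le_epsilon) simp
    then show "G x (grad \<phi> x) - \<epsilon> * laplacian \<phi> x \<le> c" using G[OF x] by simp
  qed
qed

text \<open>The common source of contact points: once the value at some point of the ball beats the
  whole sphere, the maximum over the closed ball is a local maximum in the open one, where a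
  viscosity inequality can be tested.\<close>

lemma interior_max:
  fixes v :: "'a::euclidean_space \<Rightarrow> real"
  assumes "continuous_on (cball x r) v" and p: "p \<in> cball x r" and sp: "\<And>y. y \<in> sphere x r \<Longrightarrow> v y < v p"
  obtains y where "y \<in> ball x r" "\<And>z. z \<in> cball x r \<Longrightarrow> v z \<le> v y" "\<forall>\<^sub>F z in nhds y. v z \<le> v y"
proof -
  obtain y where y: "y \<in> cball x r" "\<And>z. z \<in> cball x r \<Longrightarrow> v z \<le> v y"
    using continuous_attains_sup[OF compact_cball _ assms(1)] p by (metis empty_iff)
  have "y \<notin> sphere x r" using p sp y(2) by fastforce
  then have b: "y \<in> ball x r" using y(1) by (auto simp: less_le)
  have "\<forall>\<^sub>F z in nhds y. z \<in> ball x r" using b by (intro eventually_nhds_in_open) auto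
  then have "\<forall>\<^sub>F z in nhds y. v z \<le> v y" by eventually_elim (use y(2) in auto)
  with b y(2) show thesis by (rule that)
qed

lemma laplacian_nonpos_local_max:
  fixes D :: "'a::euclidean_space \<Rightarrow> real"
  assumes "Ck_on 2 D UNIV" "\<forall>\<^sub>F z in nhds y. D z \<le> D y"
  shows "laplacian D y \<le> 0"
proof -
  obtain g H where C: "C2w D g H" using Ck_C2w assms by metis
  have "H y i \<bullet> i \<le> 0" for i
  proof (rule ccontr)
    assume neg: "\<not> H y i \<bullet> i \<le> 0"
    have L: "((\<lambda>t. y + t *\<^sub>R i) has_derivative (\<lambda>s. s *\<^sub>R i)) (at t)" for t
      by (auto intro!: derivative_eq_intros)
    have d1: "((\<lambda>t. D (y + t *\<^sub>R i)) has_real_derivative g (y + t *\<^sub>R i) \<bullet> i) (at t)" for t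
      using has_derivative_compose[OF L C2wD(1)[OF C]]
      by (simp add: has_field_derivative_def mult_commute_abs)
    have d2: "((\<lambda>t. g (y + t *\<^sub>R i) \<bullet> i) has_real_derivative H y i \<bullet> i) (at 0)"
      using has_derivative_inner_left[OF has_derivative_compose[OF L[of 0] C2wD(2)[OF C]], of i]
      by (simp add: has_field_derivative_def mult_commute_abs linear_scale[OF C2w_linear[OF C]])
    obtain r where r: "r > 0" "\<And>z. dist z y < r \<Longrightarrow> D z \<le> D y"
      using assms(2) unfolding eventually_nhds_metric by blast
    define d where "d = r / (norm i + 1)"
    have d: "d > 0" unfolding d_def using r by (simp add: add_nonneg_pos)
    have le: "D (y + t *\<^sub>R i) \<le> D y" if "\<bar>t\<bar> < d" for t
    proof (rule r(2))
      have "norm (t *\<^sub>R i) \<le> \<bar>t\<bar> * (norm i + 1)" by (simp add: mult_left_mono)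
      also have "\<dots> < d * (norm i + 1)" using that by (intro mult_strict_right_mono) (auto simp: add_nonneg_pos)
      also have "\<dots> = r" unfolding d_def by (simp add: add_nonneg_pos less_imp_neq[symmetric]) 
      finally show "dist (y + t *\<^sub>R i) y < r" by (simp add: dist_norm)
    qed
    have g0: "g y \<bullet> i = 0"
      using DERIV_local_max[OF d1[of 0] d] le by auto
    \<comment> \<open>The slope along the line vanishes at the maximum and has positive derivative
      there, so it is positive just to the right; the mean value theorem then contradicts
      maximality.\<close>
    obtain e where e: "e > 0" "\<And>h. 0 < h \<Longrightarrow> h < e \<Longrightarrow> 0 < g (y + h *\<^sub>R i) \<bullet> i"
      using DERIV_pos_inc_right[OF d2] neg g0 by auto
    define s where "s = min d e / 2"
    have s: "0 < s" "s < d" "s < e" using d e by (auto simp: s_def)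
    obtain t where t: "0 < t" "t < s" "D (y + s *\<^sub>R i) - D (y + 0 *\<^sub>R i) = (s - 0) * (g (y + t *\<^sub>R i) \<bullet> i)"
      using MVT2[OF s(1), of "\<lambda>t. D (y + t *\<^sub>R i)" "\<lambda>t. g (y + t *\<^sub>R i) \<bullet> i"] d1 by auto
    have "0 < s * (g (y + t *\<^sub>R i) \<bullet> i)" using s t e(2)[of t] by simp
    with t have "D (y + s *\<^sub>R i) > D y" by simp
    with le[of s] s show False by simp
  qed
  then show ?thesis unfolding C2w_laplacian[OF C] by (simp add: sum_nonpos)
qed

text \<open>It suffices to verify the inequality, up to an error, at points near \<open>x\<close> for the test function
  perturbed to have a strict maximum.\<close>

lemma vsub_approxI:
  fixes \<phi> :: "'a::euclidean_space \<Rightarrow> real"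
  assumes \<phi>: "Ck_on 2 \<phi> UNIV" and N: "continuous_on UNIV N" and S: "open S" "x \<in> S" and g: "continuous_on S g"
    and ap: "\<And>\<delta> r. \<delta> > 0 \<Longrightarrow> r > 0 \<Longrightarrow> \<exists>y\<in>ball x r.
        N (grad \<phi> y + (2 * \<delta>) *\<^sub>R (y - x)) - \<epsilon> * (laplacian \<phi> y + 2 * \<delta> * DIM('a)) \<le> g y + \<delta>"
  shows "N (grad \<phi> x) - \<epsilon> * laplacian \<phi> x \<le> g x"
proof -
  define \<delta> where "\<delta> k = inverse (real (Suc k))" for k
  have \<delta>: "\<delta> k > 0" for k by (simp add: \<delta>_def)
  have \<delta>0: "\<delta> \<longlonglongrightarrow> 0" unfolding \<delta>_def by (rule LIMSEQ_inverse_real_of_nat)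
  obtain y where y: "\<And>k. y k \<in> ball x (\<delta> k)" and 
     le: "\<And>k. N (grad \<phi> (y k) + (2 * \<delta> k) *\<^sub>R (y k - x)) - \<epsilon> * (laplacian \<phi> (y k) + 2 * \<delta> k * DIM('a)) \<le> g (y k) + \<delta> k"
  proof -
    have "\<exists>y\<in>ball x (\<delta> k). N (grad \<phi> y + (2 * \<delta> k) *\<^sub>R (y - x)) - \<epsilon> * (laplacian \<phi> y + 2 * \<delta> k * DIM('a)) \<le> g y + \<delta> k" for k
      by (rule ap[OF \<delta> \<delta>])
    then show thesis using that by metis
  qed
  have yx: "y \<longlonglongrightarrow> x"
  proof (rule metric_LIMSEQ_I)
    fix e :: real assume "e > 0"
    then obtain k0 where "\<And>k. k \<ge> k0 \<Longrightarrow> \<delta> k < e" using \<delta>0 \<delta>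
      by (metis (no_types, opaque_lifting) LIMSEQ_D abs_of_pos diff_zero real_norm_def)
    then show "\<exists>no. \<forall>n\<ge>no. dist (y n) x < e" using y
      by (metis dist_commute mem_ball order.strict_trans)
  qed
  have c: "(\<lambda>k. F (y k)) \<longlonglongrightarrow> F x" if "continuous_on S F" for F :: "'a \<Rightarrow> 'b::topological_space"
    using that S yx by (metis continuous_on_eq_continuous_at isCont_tendsto_compose)
  have "(\<lambda>k. grad \<phi> (y k) + (2 * \<delta> k) *\<^sub>R (y k - x)) \<longlonglongrightarrow> grad \<phi> x + (2 * 0) *\<^sub>R (x - x)"
    by (intro tendsto_intros \<delta>0 yx c laplacian_cont \<phi>)
  then have "(\<lambda>k. N (grad \<phi> (y k) + (2 * \<delta> k) *\<^sub>R (y k - x))) \<longlonglongrightarrow> N (grad \<phi> x)"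
    using N by (auto simp: continuous_on_eq_continuous_at intro: isCont_tendsto_compose)
  then have "(\<lambda>k. N (grad \<phi> (y k) + (2 * \<delta> k) *\<^sub>R (y k - x)) - \<epsilon> * (laplacian \<phi> (y k) + 2 * \<delta> k * DIM('a))) 
     \<longlonglongrightarrow> N (grad \<phi> x) - \<epsilon> * (laplacian \<phi> x + 2 * 0 * real DIM('a))"
    by (intro tendsto_intros \<delta>0 c laplacian_cont \<phi>)
  moreover have "(\<lambda>k. g (y k) + \<delta> k) \<longlonglongrightarrow> g x + 0" by (intro tendsto_intros \<delta>0 c g)
  ultimately have "N (grad \<phi> x) - \<epsilon> * (laplacian \<phi> x + 2 * 0 * real DIM('a)) \<le> g x + 0"
    using le by (intro LIMSEQ_le) auto
  then show ?thesis by simp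
qed

lemma perturbed_test:
  fixes x :: "'a::euclidean_space"
  assumes "Ck_on 2 \<phi> UNIV"
  shows "Ck_on 2 (\<lambda>y. \<phi> y + \<delta> * (norm (y - x))\<^sup>2) UNIV"
    "grad (\<lambda>y. \<phi> y + \<delta> * (norm (y - x))\<^sup>2) y = grad \<phi> y + (2 * \<delta>) *\<^sub>R (y - x)"
    "laplacian (\<lambda>y. \<phi> y + \<delta> * (norm (y - x))\<^sup>2) y = laplacian \<phi> y + 2 * \<delta> * DIM('a)"
  using assms grad_laplacian_sq[of x] by (auto simp: grad_laplacian_add grad_laplacian_cmult)

section \<open>Harmonic extension of polynomials from spheres\<close>

text \<open>Homogeneous polynomials of degree \<open>m\<close>, generated by arbitrary linear forms
  instead of coordinate monomials. Homogeneity yields Euler's identity, and the degree is the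
  induction parameter of the harmonic extension. The zero function has every degree.\<close>

inductive hpoly :: "nat \<Rightarrow> ('a::euclidean_space \<Rightarrow> real) \<Rightarrow> bool" where
  const: "hpoly 0 (\<lambda>x. c)"
| mult: "hpoly m P \<Longrightarrow> hpoly (Suc m) (\<lambda>x. (b \<bullet> x) * P x)"
| add: "hpoly m P \<Longrightarrow> hpoly m Q \<Longrightarrow> hpoly m (\<lambda>x. P x + Q x)"

lemma hpoly_zero: "hpoly m (\<lambda>x. 0)"
proof (induction m)
  case 0 show ?case by (rule hpoly.const)
next
  case (Suc m) from hpoly.mult[OF this] show ?case by simp
qed

lemma hpoly_cmult: "hpoly m P \<Longrightarrow> hpoly m (\<lambda>x. c * P x)"
proof (induction rule: hpoly.induct)
  case (const c') show ?case by (rule hpoly.const)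
next
  case (mult m P b) 
  from hpoly.mult[OF mult.IH, of b] show ?case by (simp add: mult.left_commute)
next
  case (add m P Q)
  from hpoly.add[OF add.IH] show ?case by (simp add: distrib_left)
qed

lemma hpoly_sum: "finite I \<Longrightarrow> (\<And>i. i \<in> I \<Longrightarrow> hpoly m (P i)) \<Longrightarrow> hpoly m (\<lambda>x. \<Sum>i\<in>I. P i x)"
  by (induction I rule: finite_induct) (auto intro: hpoly_zero hpoly.add)

lemma hpoly_times: "hpoly m P \<Longrightarrow> hpoly k Q \<Longrightarrow> hpoly (m + k) (\<lambda>x. P x * Q x)"
proof (induction rule: hpoly.induct)
  case (const c') then show ?case by (simp add: hpoly_cmult)
next
  case (mult m P b) 
  from hpoly.mult[OF mult.IH[OF mult.prems], of b] show ?case by (simp add: mult.assoc)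
next
  case (add m P R)
  from hpoly.add[OF add.IH[OF add.prems]] show ?case by (simp add: distrib_right)
qed

lemma hpoly_normsq: "hpoly m (Q :: 'a::euclidean_space \<Rightarrow> real) \<Longrightarrow> hpoly (m + 2) (\<lambda>x. (norm x)\<^sup>2 * Q x)"
proof -
  assume Q: "hpoly m Q"
  have "hpoly (m + 2) (\<lambda>x. \<Sum>b\<in>Basis. (b \<bullet> x) * ((b \<bullet> x) * Q x))"
    using hpoly.mult[OF hpoly.mult[OF Q]] by (intro hpoly_sum) auto
  also have "(\<lambda>x. \<Sum>b\<in>Basis. (b \<bullet> x) * ((b \<bullet> x) * Q x)) = (\<lambda>x. (norm x)\<^sup>2 * Q x)"
  proof
    fix x :: 'a
    have "(norm x)\<^sup>2 = (\<Sum>b\<in>Basis. (b \<bullet> x) * (b \<bullet> x))"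
      unfolding dot_square_norm[symmetric] euclidean_inner[of x x]
      by (intro sum.cong refl) (simp add: inner_commute)
    then show "(\<Sum>b\<in>Basis. (b \<bullet> x) * ((b \<bullet> x) * Q x)) = (norm x)\<^sup>2 * Q x"
      by (simp add: sum_distrib_right mult.assoc)
  qed
  finally show ?thesis .
qed

text \<open>The second conjunct is Euler's identity. Degree 0 is treated apart because
  \<open>m - 1\<close> is truncated there: \<open>hpoly 0\<close> would allow nonzero constants as
  derivatives of a constant.\<close>

lemma hpoly_deriv:
  assumes "hpoly m P"
  shows "\<exists>D. (\<forall>x. (P has_derivative D x) (at x)) \<and> (\<forall>x. D x x = m * P x) \<and>
    (\<forall>i. if m = 0 then \<forall>x. D x i = 0 else hpoly (m - 1) (\<lambda>x. D x i))"
  using assms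
proof (induction rule: hpoly.induct)
  case (const c) show ?case by (rule exI[of _ "\<lambda>x h. 0"]) auto
next
  case (mult m P b)
  then obtain D where D: "\<And>x. (P has_derivative D x) (at x)" "\<And>x. D x x = m * P x"
    "\<And>i. if m = 0 then \<forall>x. D x i = 0 else hpoly (m - 1) (\<lambda>x. D x i)" by metis
  have "((\<lambda>x. (b \<bullet> x) * P x) has_derivative (\<lambda>h. (b \<bullet> x) * D x h + (b \<bullet> h) * P x)) (at x)" for x
    by (auto intro!: derivative_eq_intros D(1))
  moreover have "(b \<bullet> x) * D x x + (b \<bullet> x) * P x = Suc m * ((b \<bullet> x) * P x)" for x
    by (simp add: D(2) algebra_simps)
  moreover have "hpoly m (\<lambda>x. (b \<bullet> x) * D x i + (b \<bullet> i) * P x)" for i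
  proof (rule hpoly.add[OF _ hpoly_cmult[OF mult.hyps]])
    show "hpoly m (\<lambda>x. (b \<bullet> x) * D x i)"
    proof (cases m)
      case 0 then show ?thesis using D(3)[of i] by (simp add: hpoly_zero)
    next
      case (Suc k) then show ?thesis using D(3)[of i] hpoly.mult[of k "\<lambda>x. D x i" b] by simp
    qed
  qed
  ultimately show ?case by (intro exI[of _ "\<lambda>x h. (b \<bullet> x) * D x h + (b \<bullet> h) * P x"]) simp
next
  case (add m P Q)
  then obtain D E where D: "\<And>x. (P has_derivative D x) (at x)" "\<And>x. D x x = m * P x"
    "\<And>i. if m = 0 then \<forall>x. D x i = 0 else hpoly (m - 1) (\<lambda>x. D x i)"
    and E: "\<And>x. (Q has_derivative E x) (at x)" "\<And>x. E x x = m * Q x"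
    "\<And>i. if m = 0 then \<forall>x. E x i = 0 else hpoly (m - 1) (\<lambda>x. E x i)" by metis
  have "if m = 0 then \<forall>x. D x i + E x i = 0 else hpoly (m - 1) (\<lambda>x. D x i + E x i)" for i
    using D(3)[of i] E(3)[of i] hpoly.add by auto
  moreover have "((\<lambda>x. P x + Q x) has_derivative (\<lambda>h. D x h + E x h)) (at x)" for x
    by (intro derivative_intros D E)
  ultimately show ?case using D(2) E(2)
    by (intro exI[of _ "\<lambda>x h. D x h + E x h"]) (auto simp: distrib_left)
qed

lemma hpoly_partial:
  assumes "hpoly m P"
  shows "P differentiable (at x)" "hpoly (m - 1) (partial i P)" "m = 0 \<Longrightarrow> partial i P = (\<lambda>x. 0)"
    "grad P x \<bullet> x = m * P x"
proof -
  obtain D where D: "\<And>x. (P has_derivative D x) (at x)" "\<And>x. D x x = m * P x"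
    "\<And>i. if m = 0 then \<forall>x. D x i = 0 else hpoly (m - 1) (\<lambda>x. D x i)" using hpoly_deriv[OF assms] by metis
  show d: "P differentiable (at x)" using D(1) differentiable_def by blast
  have p: "partial i P = (\<lambda>x. D x i)" using partial_eqI[OF D(1)] by blast
  then show z: "m = 0 \<Longrightarrow> partial i P = (\<lambda>x. 0)" using D(3)[of i] by auto
  show "hpoly (m - 1) (partial i P)" 
    using z p D(3)[of i] by (cases "m = 0") (auto simp: hpoly_zero)
  have "(\<lambda>h. grad P x \<bullet> h) = D x" 
    by (rule has_derivative_unique[OF has_derivative_grad[OF d] D(1)])
  then show "grad P x \<bullet> x = m * P x" using D(2)[of x] by metis
qed

lemma hpoly_Ck: assumes "hpoly m P" shows "Ck_on k P S"
  using assms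
proof (induction k arbitrary: m P)
  case 0 then show ?case
    using hpoly_partial(1) by (auto intro!: continuous_at_imp_continuous_on differentiable_imp_continuous_within)
next
  case (Suc k)
  from hpoly_partial(1)[OF Suc.prems] Suc.IH[OF hpoly_partial(2)[OF Suc.prems]] show ?case by simp
qed

lemma hpoly_laplacian:
  fixes P :: "'a::euclidean_space \<Rightarrow> real"
  assumes "hpoly m P"
  shows "hpoly (m - 2) (laplacian P)" "m < 2 \<Longrightarrow> laplacian P x = 0"
proof -
  have *: "laplacian P = (\<lambda>x. \<Sum>i\<in>Basis. partial i (partial i P) x)"
    by (simp add: laplacian_def fun_eq_iff)
  show "hpoly (m - 2) (laplacian P)" unfolding *
    using hpoly_partial(2)[OF hpoly_partial(2)[OF assms]] by (intro hpoly_sum) (auto simp: numeral_2_eq_2)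
  assume m: "m < 2"
  have "partial i (partial i P) = (\<lambda>x. 0)" for i
    using hpoly_partial(3)[OF hpoly_partial(2)[OF assms]] m by auto
  then show "laplacian P x = 0" unfolding * by simp
qed

text \<open>The cross term of the product rule is 4 x.DQ, which Euler's identity turns into 4 m Q;
  the remaining 2 n Q comes from the Laplacian of |x|^2.\<close>

lemma hpoly_laplacian_normsq:
  fixes Q :: "'a::euclidean_space \<Rightarrow> real"
  assumes "hpoly m Q"
  shows "laplacian (\<lambda>x. (norm x)\<^sup>2 * Q x) x = (norm x)\<^sup>2 * laplacian Q x + (2 * DIM('a) + 4 * m) * Q x"
  using grad_laplacian_mult(3)[OF grad_laplacian_sq(1)[of 0] hpoly_Ck[OF assms], of x]
    grad_laplacian_sq(2,3)[of "0::'a" x] hpoly_partial(4)[OF assms, of x]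
  by (simp add: algebra_simps inner_commute)

text \<open>A correction of degree \<open>k - 2\<close> turns the leading approximation \<open>R / a\<close> into a solution: the
  remaining error is an equation of the same form for the correction, with a larger constant.\<close>

lemma hpoly_solve:
  fixes R :: "'a::euclidean_space \<Rightarrow> real"
  assumes "a > 0" "hpoly k R"
  shows "\<exists>Q. hpoly k Q \<and> (\<forall>x. a * Q x + (norm x)\<^sup>2 * laplacian Q x = R x)"
  using assms
proof (induction k arbitrary: a R rule: less_induct)
  case (less k)
  show ?case
  proof (cases "k < 2")
    case True
    have "hpoly k (\<lambda>x. (1 / a) * R x)" using less.prems by (intro hpoly_cmult)
    with hpoly_laplacian(2)[OF this True] show ?thesis using less.prems
      by (intro exI[of _ "\<lambda>x. (1 / a) * R x"]) auto
  next
    case False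
    \<comment> \<open>The increment \<open>b - a\<close> is the factor that the Laplacian of |x|^2 T
      produces for \<open>T\<close> of degree k - 2. With this choice the Laplacian of
      \<open>Q\<close> below is \<open>T\<close> itself, so that |x|^2 Lap Q cancels the correction
      contained in a Q.\<close>
    define b where "b = a + (2 * DIM('a) + 4 * real (k - 2))"
    have "b > 0" using less.prems unfolding b_def by (simp add: add_pos_nonneg)
    moreover have "k - 2 < k" using False by simp
    ultimately obtain T where T: "hpoly (k - 2) T" "\<And>x. b * T x + (norm x)\<^sup>2 * laplacian T x = laplacian R x"
      using less.IH[of "k - 2" b "laplacian R"] hpoly_laplacian(1)[OF less.prems(2)] by blast
    have NT: "hpoly k (\<lambda>x. (norm x)\<^sup>2 * T x)" proof -
      have "k - 2 + 2 = k" using False by simp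
      with hpoly_normsq[OF T(1)] show ?thesis by metis
    qed
    define Q where "Q x = (1 / a) * R x + (-1 / a) * ((norm x)\<^sup>2 * T x)" for x
    have Q: "hpoly k Q" unfolding Q_def using less.prems NT by (intro hpoly.add hpoly_cmult)
    have 1: "Ck_on 2 (\<lambda>x. (1 / a) * R x) UNIV" "Ck_on 2 (\<lambda>x. (-1 / a) * ((norm x)\<^sup>2 * T x)) UNIV"
      by (intro hpoly_Ck[of k] hpoly_cmult less.prems NT)+
    have "laplacian Q x = (1 / a) * laplacian R x + (-1 / a) * ((norm x)\<^sup>2 * laplacian T x + (2 * DIM('a) + 4 * real (k - 2)) * T x)" for x
      unfolding Q_def grad_laplacian_add(3)[OF 1] grad_laplacian_cmult(3)[OF hpoly_Ck[OF less.prems(2)]]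
        grad_laplacian_cmult(3)[OF hpoly_Ck[OF NT]] hpoly_laplacian_normsq[OF T(1)] by simp
    then have "laplacian Q x = (1 / a) * (b * T x - (b - a) * T x)" for x
      unfolding T(2)[symmetric] b_def by (simp add: algebra_simps diff_divide_distrib add_divide_distrib)
    then have "laplacian Q x = T x" for x using less.prems(1) by (simp add: algebra_simps)
    then have "a * Q x + (norm x)\<^sup>2 * laplacian Q x = R x" for x
      using less.prems(1) by (simp add: Q_def algebra_simps)
    with Q show ?thesis by blast
  qed
qed

text \<open>Solving Lap (|x|^2 Q) = Lap P makes P - |x|^2 Q harmonic. On the unit sphere the
  subtracted term is just \<open>Q\<close>, of degree m - 2, and its harmonic extension, available
  by induction, is added back.\<close>

lemma hpoly_harmonic_extension:
  fixes P :: "'a::euclidean_space \<Rightarrow> real"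
  assumes "hpoly m P"
  shows "\<exists>h. Ck_on 2 h UNIV \<and> (\<forall>x. laplacian h x = 0) \<and> (\<forall>x. norm x = 1 \<longrightarrow> h x = P x)"
  using assms
proof (induction m arbitrary: P rule: less_induct)
  case (less m)
  show ?case
  proof (cases "m < 2")
    case True
    then show ?thesis using hpoly_laplacian(2)[OF less.prems True] hpoly_Ck[OF less.prems] by blast
  next
    case False
    have "real (2 * DIM('a) + 4 * (m - 2)) > 0" by (simp add: add_pos_nonneg)
    from hpoly_solve[OF this hpoly_laplacian(1)[OF less.prems]]
    obtain Q where Q: "hpoly (m - 2) Q" 
      "\<And>x. real (2 * DIM('a) + 4 * (m - 2)) * Q x + (norm x)\<^sup>2 * laplacian Q x = laplacian P x" by blast
    have NQ: "hpoly m (\<lambda>x. (norm x)\<^sup>2 * Q x)" proof -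
      have "m - 2 + 2 = m" using False by simp
      with hpoly_normsq[OF Q(1)] show ?thesis by metis
    qed
    obtain h where h: "Ck_on 2 h UNIV" "\<And>x. laplacian h x = 0" "\<And>x. norm x = 1 \<Longrightarrow> h x = Q x"
      using less.IH[OF _ Q(1)] False by auto
    note 1 = hpoly_Ck[OF less.prems, of 2 UNIV] and 2 = grad_laplacian_cmult[OF hpoly_Ck[OF NQ], of "-1"]
    note 3 = grad_laplacian_add[OF 1 2(1)]
    note 4 = grad_laplacian_add[OF 3(1) h(1)]
    have "laplacian (\<lambda>x. P x + (- 1) * ((norm x)\<^sup>2 * Q x) + h x) x = 0" for x
      unfolding 4(3) 3(3) 2(3) h(2) hpoly_laplacian_normsq[OF Q(1)] using Q(2)[of x] by simp
    moreover have "P x + (- 1) * ((norm x)\<^sup>2 * Q x) + h x = P x" if "norm x = 1" for x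
      using that h(3) by simp
    ultimately show ?thesis using 4(1) by blast
  qed
qed

text \<open>Sums of homogeneous polynomials of varying degrees: the harmonic extension is built
  degree by degree and passes to all polynomials by additivity.\<close>

inductive polynomial_sum :: "('a::euclidean_space \<Rightarrow> real) \<Rightarrow> bool" where
  hpoly: "hpoly m P \<Longrightarrow> polynomial_sum P"
| add: "polynomial_sum P \<Longrightarrow> polynomial_sum Q \<Longrightarrow> polynomial_sum (\<lambda>x. P x + Q x)"

lemma polynomial_sum_mult:
  assumes "polynomial_sum P" "polynomial_sum Q" shows "polynomial_sum (\<lambda>x. P x * Q x)"
  using assms(1)
proof induction
  case (hpoly m P)
  from assms(2) show ?case
  proof induction
    case (hpoly k Q) then show ?case using hpoly_times \<open>hpoly m P\<close> polynomial_sum.hpoly by blast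
  next
    case (add A B) then show ?case using polynomial_sum.add[OF add.IH] by (simp add: distrib_left)
  qed
next
  case (add A B) then show ?case using polynomial_sum.add[OF add.IH] by (simp add: distrib_right)
qed

lemma polynomial_sum_if_real_polynomial_function:
  fixes P :: "'a::euclidean_space \<Rightarrow> real"
  assumes "real_polynomial_function P" shows "polynomial_sum P"
  using assms
proof induction
  case (linear f)
  have d: "(f has_derivative f) (at 0)" using linear by (rule bounded_linear_imp_has_derivative)
  then have "f differentiable (at 0)" using differentiable_def by blast
  from has_derivative_unique[OF has_derivative_grad[OF this] d]
  obtain a where "f = (\<lambda>x. a \<bullet> x)" by metis
  then show ?case using polynomial_sum.hpoly[OF hpoly.mult[OF hpoly.const[of 1]]] by simp
next
  case (const c) show ?case by (rule polynomial_sum.hpoly[OF hpoly.const])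
next
  case (add f g) then show ?case by (auto intro: polynomial_sum.add)
next
  case (mult f g) then show ?case by (auto intro: polynomial_sum_mult)
qed

lemma polynomial_harmonic_extension:
  assumes "polynomial_sum P"
  shows "\<exists>h. Ck_on 2 h UNIV \<and> (\<forall>x. laplacian h x = 0) \<and> (\<forall>x. norm x = 1 \<longrightarrow> h x = P x)"
  using assms
proof induction
  case (hpoly m P) then show ?case by (rule hpoly_harmonic_extension)
next
  case (add A B)
  then obtain h k where h: "Ck_on 2 h UNIV" "\<And>x. laplacian h x = 0" "\<And>x. norm x = 1 \<Longrightarrow> h x = A x"
    and k: "Ck_on 2 k UNIV" "\<And>x. laplacian k x = 0" "\<And>x. norm x = 1 \<Longrightarrow> k x = B x" by blast
  show ?case 
    using grad_laplacian_add[OF h(1) k(1)] h k by (intro exI[of _ "\<lambda>x. h x + k x"]) auto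
qed

text \<open>The Dirichlet problem on a ball up to an error: Stone-Weierstrass approximates the
  boundary values by a polynomial, which extends harmonically. The target of the approximation is
  \<open>z\<close> raised by \<open>e / 2\<close>, so that the error is one-sided and
  \<open>h\<close> stays above \<open>z\<close>.\<close>

lemma harmonic_approximation:
  fixes z :: "'a::euclidean_space \<Rightarrow> real"
  assumes r: "r > 0" and z: "continuous_on (sphere x0 r) z" and e: "e > 0"
  obtains h where "Ck_on 2 h UNIV" "\<And>x. laplacian h x = 0" 
    "\<And>y. y \<in> sphere x0 r \<Longrightarrow> z y \<le> h y \<and> h y \<le> z y + e"
proof -
  have "continuous_on (sphere 0 1) (\<lambda>y. z (x0 + r *\<^sub>R y) + e / 2)"
    by (intro continuous_intros continuous_on_compose2[OF z]) (use r in \<open>auto simp: dist_norm\<close>)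
  then obtain P where P: "real_polynomial_function P" "\<And>y. y \<in> sphere 0 1 \<Longrightarrow> \<bar>z (x0 + r *\<^sub>R y) + e / 2 - P y\<bar> < e / 2"
    using Stone_Weierstrass_real_polynomial_function[of "sphere 0 1" "\<lambda>y. z (x0 + r *\<^sub>R y) + e / 2" "e / 2"] e
    by (metis compact_sphere half_gt_zero)
  obtain k where k: "Ck_on 2 k UNIV" "\<And>x. laplacian k x = 0" "\<And>x. norm x = 1 \<Longrightarrow> k x = P x"
    using polynomial_harmonic_extension[OF polynomial_sum_if_real_polynomial_function[OF P(1)]] by blast
  define h where "h y = k ((1 / r) *\<^sub>R y + (- (1 / r) *\<^sub>R x0))" for y
  note a = grad_laplacian_affine[OF k(1), of "1 / r" "- (1 / r) *\<^sub>R x0", folded h_def]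
  have "laplacian h x = 0" for x using a(3) k(2) by simp
  moreover have "z y \<le> h y \<and> h y \<le> z y + e" if "y \<in> sphere x0 r" for y
  proof -
    define u where "u = (1 / r) *\<^sub>R (y - x0)"
    have u: "norm u = 1" "x0 + r *\<^sub>R u = y" using that r by (auto simp: u_def dist_norm norm_minus_commute)
    have "h y = P u" using k(3)[OF u(1)] by (simp add: h_def u_def scaleR_diff_right)
    moreover have "\<bar>z y + e / 2 - P u\<bar> < e / 2" using P(2)[of u] u by simp
    ultimately show ?thesis unfolding abs_less_iff by linarith
  qed
  ultimately show thesis using a(1) that by blast
qed

section \<open>Linearisation, convexity and stability\<close>

lemma vsub_add_C2:
  fixes w q :: "'a::euclidean_space \<Rightarrow> real"
  assumes w: "vsub \<epsilon> (\<lambda>\<xi>. 0) g S w" and q: "Ck_on 2 q UNIV"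
  shows "vsub \<epsilon> (\<lambda>\<xi>. 0) (\<lambda>x. g x - \<epsilon> * laplacian q x) S (\<lambda>x. w x + q x)"
  unfolding vsub_def
proof (intro ballI allI impI)
  fix x \<phi> assume x: "x \<in> S" and \<phi>: "Ck_on 2 \<phi> UNIV" 
    and m: "\<forall>\<^sub>F y in nhds x. w y + q y - \<phi> y \<le> w x + q x - \<phi> x"
  note a = grad_laplacian_cmult[OF q, of "-1"]
  note b = grad_laplacian_add[OF \<phi> a(1)]
  have "\<forall>\<^sub>F y in nhds x. w y - (\<phi> y + - 1 * q y) \<le> w x - (\<phi> x + - 1 * q x)"
    using m by eventually_elim simp
  from vsubD[OF w x b(1) this] show "0 - \<epsilon> * laplacian \<phi> x \<le> g x - \<epsilon> * laplacian q x"
    unfolding b(3) a(3) by (simp add: algebra_simps)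
qed

lemma eventually_nhds_cball_le:
  fixes x :: "'a::euclidean_space"
  assumes "open S" "x \<in> S" "r > 0" "\<forall>\<^sub>F y in nhds x. P y"
  obtains r1 where "0 < r1" "r1 \<le> r" "cball x r1 \<subseteq> S" "\<And>y. y \<in> cball x r1 \<Longrightarrow> P y"
proof -
  have "\<forall>\<^sub>F y in nhds x. P y \<and> y \<in> S"
    using assms(4) eventually_nhds_in_open[OF assms(1,2)] by (rule eventually_conj)
  then obtain d where d: "d > 0" "\<And>y. dist y x < d \<Longrightarrow> P y \<and> y \<in> S"
    unfolding eventually_nhds_metric by blast
  show thesis
    by (rule that[of "min r (d / 2)"]) (use d assms in \<open>auto simp: dist_commute\<close>)
qed

lemma vsub_le_harmonic:
  fixes z :: "'a::euclidean_space \<Rightarrow> real"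
  assumes z: "continuous_on (cball x0 r) z" "vsub 1 (\<lambda>\<xi>. 0) (\<lambda>x. 0) (ball x0 r) z"
    and h: "Ck_on 2 h UNIV" "\<And>x. laplacian h x = 0" and le: "\<And>y. y \<in> sphere x0 r \<Longrightarrow> z y \<le> h y"
    and y: "y \<in> ball x0 r"
  shows "z y \<le> h y"
proof (rule ccontr)
  assume n: "\<not> z y \<le> h y"
  have r: "r > 0" using y zero_le_dist[of x0 y] unfolding mem_ball by linarith
  \<comment> \<open>The perturbation - \<open>\<delta>\<close> |y - x0|^2 gives the harmonic test
    function a negative Laplacian. On the sphere it amounts to \<open>\<delta> * r\<^sup>2\<close>,
    half of the assumed gap, so that the contact point remains inside.\<close>
  define \<delta> where "\<delta> = (z y - h y) / (2 * r\<^sup>2)"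
  have \<delta>: "\<delta> > 0" "\<delta> * r\<^sup>2 < z y - h y" using n r by (auto simp: \<delta>_def)
  note p = perturbed_test[OF h(1), of "- \<delta>" x0]
  define v where "v = (\<lambda>y. z y - (h y + (- \<delta>) * (norm (y - x0))\<^sup>2))"
  have cv: "continuous_on (cball x0 r) v" unfolding v_def
    by (intro continuous_intros z laplacian_cont[OF h(1)])
  have sp: "v u < v y" if "u \<in> sphere x0 r" for u
  proof -
    have "norm (u - x0) = r" using that by (simp add: dist_norm norm_minus_commute)
    then have "v u \<le> \<delta> * r\<^sup>2" using le[OF that] by (simp add: v_def)
    also have "\<dots> < z y - h y" by (rule \<delta>)
    also have "\<dots> \<le> v y" using \<delta> by (simp add: v_def)
    finally show ?thesis .
  qed
  obtain u where u: "u \<in> ball x0 r" "\<forall>\<^sub>F s in nhds u. v s \<le> v u"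
    using interior_max[OF cv _ sp] y by auto
  from vsubD[OF z(2) u(1) p(1) u(2)[unfolded v_def]] show False
    unfolding p(3) h(2) using \<delta>(1) by (simp add: mult_le_0_iff)
qed

text \<open>The key to convexity: viscosity subsolutions of \<open>- \<Delta>z \<le> g\<close> form a cone, since on small balls
  they lie below harmonic functions that almost agree with them on the sphere.\<close>

lemma vsub_laplace_add:
  fixes z1 z2 :: "'a::euclidean_space \<Rightarrow> real"
  assumes S: "open S" and z: "continuous_on S z1" "continuous_on S z2" 
    and g: "continuous_on S g1" "continuous_on S g2"
    and v1: "vsub 1 (\<lambda>\<xi>. 0) g1 S z1" and v2: "vsub 1 (\<lambda>\<xi>. 0) g2 S z2"
  shows "vsub 1 (\<lambda>\<xi>. 0) (\<lambda>x. g1 x + g2 x) S (\<lambda>x. z1 x + z2 x)"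
  unfolding vsub_def
proof (intro ballI allI impI)
  fix x \<phi> assume x: "x \<in> S" and \<phi>: "Ck_on 2 \<phi> UNIV" 
    and m: "\<forall>\<^sub>F y in nhds x. z1 y + z2 y - \<phi> y \<le> z1 x + z2 x - \<phi> x"
  define n where "n = real DIM('a)"
  have n: "n > 0" unfolding n_def by simp
  have near: "\<forall>\<^sub>F y in nhds x. \<bar>g y - g x\<bar> < e" if "continuous_on S g" "e > 0" for g :: "'a \<Rightarrow> real" and e
  proof -
    have "continuous (at x) g" using that S x by (simp add: continuous_on_eq_continuous_at)
    then have "filterlim g (nhds (g x)) (nhds x)" by (simp add: continuous_at tendsto_at_iff_tendsto_nhds)
    from tendstoD[OF this that(2)] show ?thesis by (simp add: dist_real_def)
  qed
  show "(\<lambda>\<xi>. 0) (grad \<phi> x) - 1 * laplacian \<phi> x \<le> g1 x + g2 x"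
  proof (rule vsub_approxI[OF \<phi> continuous_on_const S x])
    show "continuous_on S (\<lambda>x. g1 x + g2 x)" by (intro continuous_intros g)
    fix \<delta> r :: real assume \<delta>: "\<delta> > 0" and r: "r > 0"
    have "\<forall>\<^sub>F y in nhds x. z1 y + z2 y - \<phi> y \<le> z1 x + z2 x - \<phi> x \<and> \<bar>g1 y - g1 x\<bar> < \<delta> / 4 \<and> \<bar>g2 y - g2 x\<bar> < \<delta> / 4"
      using m near[OF g(1), of "\<delta> / 4"] near[OF g(2), of "\<delta> / 4"] \<delta> by (auto intro: eventually_conj)
    from eventually_nhds_cball_le[OF S x r this] obtain r1 where r1: "0 < r1" "r1 \<le> r" "cball x r1 \<subseteq> S" 
      and P: "\<And>y. y \<in> cball x r1 \<Longrightarrow> z1 y + z2 y - \<phi> y \<le> z1 x + z2 x - \<phi> x \<and> \<bar>g1 y - g1 x\<bar> < \<delta> / 4 \<and> \<bar>g2 y - g2 x\<bar> < \<delta> / 4"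
      by blast
    have bS: "ball x r1 \<subseteq> S" using r1(3) ball_subset_cball by blast
    \<comment> \<open>On the sphere the strictness term \<open>\<delta> * sq y\<close> equals 4e,
      while the two harmonic approximations lose \<open>e\<close> each; a margin of 2e
      remains.\<close>
    define e where "e = \<delta> * r1\<^sup>2 / 4"
    have e: "e > 0" using \<delta> r1 by (simp add: e_def)
    define sq where "sq y = (norm (y - x))\<^sup>2" for y
    have sq: "Ck_on 2 sq UNIV" "\<And>y. laplacian sq y = 2 * n"
      unfolding sq_def n_def using grad_laplacian_sq[of x] by auto
    have main: "\<exists>h. Ck_on 2 h UNIV \<and> (\<forall>y. laplacian h y = 0) \<and>
        (\<forall>y\<in>sphere x r1. h y \<le> z y + ((g x + \<delta> / 4) / (2 * n)) * sq y + e) \<and> z x \<le> h x"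
      if z: "continuous_on S z" and v: "vsub 1 (\<lambda>\<xi>. 0) g S z" and P: "\<And>y. y \<in> cball x r1 \<Longrightarrow> \<bar>g y - g x\<bar> < \<delta> / 4" for g z
    proof -
      \<comment> \<open>Chosen so that \<open>k * sq\<close> has Laplacian
        \<open>g x + \<delta> / 4\<close>, an upper bound of \<open>g\<close> on the ball: adding it
        to \<open>z\<close> makes the right-hand side nonpositive, as comparison with harmonic
        functions requires.\<close>
      define k where "k = (g x + \<delta> / 4) / (2 * n)"
      define z' where "z' y = z y + k * sq y" for y
      note q = grad_laplacian_cmult[OF sq(1), of k]
      have "vsub 1 (\<lambda>\<xi>. 0) (\<lambda>y. g y - 1 * laplacian (\<lambda>y. k * sq y) y) S z'"
        unfolding z'_def by (rule vsub_add_C2[OF v q(1)])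
      then have v': "vsub 1 (\<lambda>\<xi>. 0) (\<lambda>x. 0) (ball x r1) z'"
      proof (rule vsub_mono[OF _ bS])
        fix y assume y: "y \<in> ball x r1"
        have "k * (2 * n) = g x + \<delta> / 4" using n by (simp add: k_def)
        then show "g y - 1 * laplacian (\<lambda>y. k * sq y) y \<le> 0"
          using P[of y] y unfolding q(3) sq(2) abs_less_iff mem_ball mem_cball by linarith
      qed
      have c': "continuous_on (cball x r1) z'"
        unfolding z'_def sq_def by (intro continuous_intros continuous_on_subset[OF z] r1)
      then have "continuous_on (sphere x r1) z'" by (rule continuous_on_subset) auto
      from harmonic_approximation[OF r1(1) this e]
      obtain h where h: "Ck_on 2 h UNIV" "\<And>x. laplacian h x = 0" "\<And>y. y \<in> sphere x r1 \<Longrightarrow> z' y \<le> h y \<and> h y \<le> z' y + e"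
        by blast
      have "z' x \<le> h x" by (rule vsub_le_harmonic[OF c' v' h(1,2)]) (use h(3) r1 in auto)
      then have "z x \<le> h x" by (simp add: z'_def sq_def)
      then show ?thesis using h unfolding z'_def k_def by blast
    qed
    obtain h1 where h1: "Ck_on 2 h1 UNIV" "\<And>y. laplacian h1 y = 0" 
        "\<And>y. y\<in>sphere x r1 \<Longrightarrow> h1 y \<le> z1 y + ((g1 x + \<delta> / 4) / (2 * n)) * sq y + e" "z1 x \<le> h1 x"
      using main[OF z(1) v1] P by blast
    obtain h2 where h2: "Ck_on 2 h2 UNIV" "\<And>y. laplacian h2 y = 0" 
        "\<And>y. y\<in>sphere x r1 \<Longrightarrow> h2 y \<le> z2 y + ((g2 x + \<delta> / 4) / (2 * n)) * sq y + e" "z2 x \<le> h2 x"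
      using main[OF z(2) v2] P by blast
    define k1 where "k1 = (g1 x + \<delta> / 4) / (2 * n)"
    define k2 where "k2 = (g2 x + \<delta> / 4) / (2 * n)"
    define k where "k = k1 + k2"
    have k: "k * (2 * n) = g1 x + g2 x + \<delta> / 2" using n by (simp add: k_def k1_def k2_def add_divide_distrib[symmetric])
    \<comment> \<open>The subsolutions are replaced by their harmonic majorants. The function that
      attains an interior maximum is now C^2, so the classical second derivative test applies in
      place of a viscosity inequality for the sum.\<close>
    define \<psi> where "\<psi> y = (h1 y + h2 y) + (- 1) * (\<phi> y + (\<delta> + k) * sq y)" for y
    note a1 = grad_laplacian_add[OF h1(1) h2(1)] and a2 = grad_laplacian_cmult[OF sq(1), of "\<delta> + k"]
    note a3 = grad_laplacian_add[OF \<phi> a2(1)]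
    note a4 = grad_laplacian_cmult[OF a3(1), of "-1"]
    note a5 = grad_laplacian_add[OF a1(1) a4(1), folded \<psi>_def]
    have lap: "laplacian \<psi> y = - (laplacian \<phi> y + (\<delta> + k) * (2 * n))" for y
      unfolding a5(3) a4(3) a3(3) a2(3) a1(3) sq(2) h1 h2 by simp
    have "\<psi> y < \<psi> x" if y: "y \<in> sphere x r1" for y
    proof -
      have sqy: "sq y = r1\<^sup>2" using y by (simp add: sq_def dist_norm norm_minus_commute)
      have e4: "\<delta> * r1\<^sup>2 = 4 * e" by (simp add: e_def)
      have "\<psi> y \<le> z1 y + z2 y + k * sq y + 2 * e - \<phi> y - (\<delta> + k) * sq y"
        unfolding \<psi>_def k_def using h1(3)[OF y, folded k1_def] h2(3)[OF y, folded k2_def] by (simp add: algebra_simps)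
      also have "\<dots> = z1 y + z2 y - \<phi> y - 2 * e" using e4 sqy by (simp add: algebra_simps)
      also have "\<dots> < z1 y + z2 y - \<phi> y" using e by simp
      also have "\<dots> \<le> z1 x + z2 x - \<phi> x" using P[of y] y by auto
      also have "\<dots> \<le> \<psi> x" using h1(4) h2(4) by (simp add: \<psi>_def sq_def)
      finally show ?thesis .
    qed
    moreover have "x \<in> cball x r1" using r1(1) by simp
    ultimately obtain y where y: "y \<in> ball x r1" "\<forall>\<^sub>F s in nhds y. \<psi> s \<le> \<psi> y"
      using interior_max[OF laplacian_cont(3)[OF a5(1)]] by metis
    have "laplacian \<psi> y \<le> 0" by (rule laplacian_nonpos_local_max[OF a5(1) y(2)])
    moreover have "\<bar>g1 y - g1 x\<bar> < \<delta> / 4 \<and> \<bar>g2 y - g2 x\<bar> < \<delta> / 4" using P[of y] y by auto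
    ultimately have "0 - 1 * (laplacian \<phi> y + 2 * \<delta> * n) \<le> g1 y + g2 y + \<delta>"
      using k unfolding lap abs_less_iff by (simp add: algebra_simps)
    moreover have "y \<in> ball x r" using y r1 by auto
    ultimately show "\<exists>y\<in>ball x r. 0 - 1 * (laplacian \<phi> y + 2 * \<delta> * DIM('a)) \<le> g1 y + g2 y + \<delta>"
      unfolding n_def by blast
  qed
qed

text \<open>Fixes the contact value by adding a constant to the test function. Multiplicative
  changes of the unknown require this, since they do not commute with adding constants.\<close>

lemma vsub_normalize_touching:
  assumes "\<And>\<phi> x. x \<in> S \<Longrightarrow> Ck_on 2 \<phi> UNIV \<Longrightarrow> \<phi> x = w x \<Longrightarrow> \<forall>\<^sub>F y in nhds x. w y \<le> \<phi> y \<Longrightarrow>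
     N (grad \<phi> x) - \<epsilon> * laplacian \<phi> x \<le> g x"
  shows "vsub \<epsilon> N g S w"
  unfolding vsub_def
proof (intro ballI allI impI)
  fix x \<phi> assume x: "x \<in> S" and \<phi>: "Ck_on 2 \<phi> UNIV" and m: "\<forall>\<^sub>F y in nhds x. w y - \<phi> y \<le> w x - \<phi> x"
  note a = grad_laplacian_add[OF \<phi> grad_laplacian_const(1)[of "w x - \<phi> x"]]
  have "\<forall>\<^sub>F y in nhds x. w y \<le> \<phi> y + (w x - \<phi> x)" using m by eventually_elim simp
  from assms[OF x a(1) _ this] show "N (grad \<phi> x) - \<epsilon> * laplacian \<phi> x \<le> g x"
    unfolding a(2,3) grad_laplacian_const by simp
qed

text \<open>A test function \<open>\<phi>\<close> for the new unknown corresponds to exp(-c.x)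
  \<open>\<phi>\<close> for \<open>u\<close>. By the product rule the Laplacian of the latter
  contains -2 c.D\<open>\<phi>\<close>, which shifts the drift from \<open>b\<close> to
  \<open>b + c\<close>, and terms in \<open>\<phi>\<close> itself, which at the contact point are
  multiples of \<open>u\<close> and move to the right-hand side. Taking \<open>c = - b\<close>
  removes a drift; starting from \<open>b = 0\<close> creates one.\<close>

lemma vsub_exp_conjugate:
  fixes u :: "'a::euclidean_space \<Rightarrow> real"
  assumes u: "vsub \<epsilon> (\<lambda>\<xi>. 2 * \<epsilon> * (b \<bullet> \<xi>)) g S u"
  shows "vsub \<epsilon> (\<lambda>\<xi>. 2 * \<epsilon> * ((b + c) \<bullet> \<xi>))
    (\<lambda>x. exp (c \<bullet> x) * (g x + \<epsilon> * (2 * (b \<bullet> c) + c \<bullet> c) * u x)) S (\<lambda>x. exp (c \<bullet> x) * u x)"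
proof (rule vsub_normalize_touching)
  fix \<phi> x assume x: "x \<in> S" and \<phi>: "Ck_on 2 \<phi> UNIV" and eq: "\<phi> x = exp (c \<bullet> x) * u x"
    and m: "\<forall>\<^sub>F y in nhds x. exp (c \<bullet> y) * u y \<le> \<phi> y"
  define a where "a = - c"
  define E where "E y = exp (a \<bullet> y)" for y
  have E: "Ck_on 2 E UNIV" "grad E x = - E x *\<^sub>R c" "laplacian E x = E x * (c \<bullet> c)"
  proof -
    have *: "grad (\<lambda>y. a \<bullet> y) x = a" "laplacian (\<lambda>y. a \<bullet> y) x = 0"
      by (rule grad_laplacian_inner)+
    have c: "continuous_on UNIV (exp :: real \<Rightarrow> real)" by (intro continuous_intros)
    note F = grad_laplacian_compose[OF grad_laplacian_inner(1)[of a] DERIV_exp DERIV_exp c, folded E_def]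
    show "Ck_on 2 E UNIV" "grad E x = - E x *\<^sub>R c" "laplacian E x = E x * (c \<bullet> c)"
      using F(1) F(2,3)[of x] unfolding * by (simp_all add: a_def dot_square_norm)
  qed
  note a = grad_laplacian_mult[OF E(1) \<phi>]
  have Epos: "E x > 0" by (simp add: E_def)
  have inv: "E y * exp (c \<bullet> y) = 1" for y by (simp add: E_def a_def exp_add[symmetric])
  have ux: "E x * \<phi> x = u x" unfolding eq using inv[of x] by (metis mult.assoc mult_1)
  have "\<forall>\<^sub>F y in nhds x. u y - E y * \<phi> y \<le> u x - E x * \<phi> x"
    using m
  proof eventually_elim
    case (elim y)
    then have "E y * (exp (c \<bullet> y) * u y) \<le> E y * \<phi> y" by (intro mult_left_mono) (auto simp: E_def)
    also have "E y * (exp (c \<bullet> y) * u y) = u y" using inv[of y] by (metis mult.assoc mult_1)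
    finally show ?case using ux by simp
  qed
  from vsubD[OF u x a(1) this] 
  have "E x * (2 * \<epsilon> * (b \<bullet> grad \<phi> x) - 2 * \<epsilon> * (b \<bullet> c) * \<phi> x - \<epsilon> * laplacian \<phi> x + 2 * \<epsilon> * (c \<bullet> grad \<phi> x) - \<epsilon> * (c \<bullet> c) * \<phi> x) \<le> g x"
    unfolding a(2,3) E(2,3) by (simp add: algebra_simps inner_add_right)
  then have "exp (c \<bullet> x) * (E x * (2 * \<epsilon> * (b \<bullet> grad \<phi> x) - 2 * \<epsilon> * (b \<bullet> c) * \<phi> x - \<epsilon> * laplacian \<phi> x + 2 * \<epsilon> * (c \<bullet> grad \<phi> x) - \<epsilon> * (c \<bullet> c) * \<phi> x)) \<le> exp (c \<bullet> x) * g x"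
    by (rule mult_left_mono) simp
  then have "2 * \<epsilon> * (b \<bullet> grad \<phi> x) - 2 * \<epsilon> * (b \<bullet> c) * \<phi> x - \<epsilon> * laplacian \<phi> x + 2 * \<epsilon> * (c \<bullet> grad \<phi> x) - \<epsilon> * (c \<bullet> c) * \<phi> x \<le> exp (c \<bullet> x) * g x"
    unfolding mult.assoc[symmetric, of "exp (c \<bullet> x)" "E x"] using inv[of x] by (simp add: mult.commute)
  then show "2 * \<epsilon> * ((b + c) \<bullet> grad \<phi> x) - \<epsilon> * laplacian \<phi> x \<le> exp (c \<bullet> x) * (g x + \<epsilon> * (2 * (b \<bullet> c) + c \<bullet> c) * u x)"
    by (simp add: algebra_simps inner_add_left eq)
qed

lemma vsub_zero_rescale:
  assumes "\<epsilon> > 0"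
  shows "vsub \<epsilon> (\<lambda>\<xi>. 0) g S w \<longleftrightarrow> vsub 1 (\<lambda>\<xi>. 0) (\<lambda>x. g x / \<epsilon>) S w"
  unfolding vsub_def using assms by (simp add: field_simps)

text \<open>Conjugation by exp(-b.x) with b = v / (2 eps) reduces the claim to
  \<open>vsub_laplace_add\<close>, and conjugating back restores the drift. The zeroth-order terms
  are linear in the unknown, so those produced on the way there cancel those produced on the way
  back.\<close>

lemma vsub_linear_add:
  fixes u1 u2 :: "'a::euclidean_space \<Rightarrow> real"
  assumes S: "open S" and \<epsilon>: "\<epsilon> > 0" and u: "continuous_on S u1" "continuous_on S u2" 
    and g: "continuous_on S g1" "continuous_on S g2"
    and v1: "vsub \<epsilon> (\<lambda>\<xi>. v \<bullet> \<xi>) g1 S u1" and v2: "vsub \<epsilon> (\<lambda>\<xi>. v \<bullet> \<xi>) g2 S u2"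
  shows "vsub \<epsilon> (\<lambda>\<xi>. v \<bullet> \<xi>) (\<lambda>x. g1 x + g2 x) S (\<lambda>x. u1 x + u2 x)"
proof -
  define b where "b = (1 / (2 * \<epsilon>)) *\<^sub>R v"
  have b: "(\<lambda>\<xi>. v \<bullet> \<xi>) = (\<lambda>\<xi>. 2 * \<epsilon> * (b \<bullet> \<xi>))" using \<epsilon> by (simp add: b_def)
  define e where "e x = exp (- b \<bullet> x)" for x
  have e: "continuous_on S e" unfolding e_def by (intro continuous_intros)
  have 1: "vsub 1 (\<lambda>\<xi>. 0) (\<lambda>x. e x * (g x - \<epsilon> * (b \<bullet> b) * u x) / \<epsilon>) S (\<lambda>x. e x * u x)" 
    if "vsub \<epsilon> (\<lambda>\<xi>. v \<bullet> \<xi>) g S u" for g u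
    using vsub_exp_conjugate[OF that[unfolded b], of "- b"] 
    unfolding vsub_zero_rescale[OF \<epsilon>, symmetric] e_def by (simp add: algebra_simps)
  have 2: "continuous_on S (\<lambda>x. e x * (g x - \<epsilon> * (b \<bullet> b) * u x) / \<epsilon>)" "continuous_on S (\<lambda>x. e x * u x)" 
    if "continuous_on S g" "continuous_on S u" for g u
    using \<epsilon> by (auto intro!: continuous_intros that e)
  define w where "w x = e x * u1 x + e x * u2 x" for x
  define G where "G x = e x * (g1 x - \<epsilon> * (b \<bullet> b) * u1 x) / \<epsilon> + e x * (g2 x - \<epsilon> * (b \<bullet> b) * u2 x) / \<epsilon>" for x
  have "vsub 1 (\<lambda>\<xi>. 0) G S w" unfolding G_def w_def
    by (rule vsub_laplace_add[OF S 2(2)[OF g(1) u(1)] 2(2)[OF g(2) u(2)] 2(1)[OF g(1) u(1)] 2(1)[OF g(2) u(2)] 1[OF v1] 1[OF v2]])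
  moreover have "G = (\<lambda>x. (\<epsilon> * G x) / \<epsilon>)" using \<epsilon> by simp
  ultimately have 3: "vsub \<epsilon> (\<lambda>\<xi>. 0) (\<lambda>x. \<epsilon> * G x) S w" unfolding vsub_zero_rescale[OF \<epsilon>] by simp
  have inv: "exp (b \<bullet> x) * e x = 1" for x by (simp add: e_def exp_add[symmetric])
  have w': "exp (b \<bullet> x) * w x = u1 x + u2 x" for x
  proof -
    have "exp (b \<bullet> x) * w x = (exp (b \<bullet> x) * e x) * (u1 x + u2 x)" by (simp add: w_def algebra_simps)
    then show ?thesis by (simp add: inv)
  qed
  have "exp (b \<bullet> x) * (\<epsilon> * G x + \<epsilon> * (b \<bullet> b) * w x) = g1 x + g2 x" for x
  proof -
    have "\<epsilon> * G x = e x * (g1 x + g2 x) - \<epsilon> * (b \<bullet> b) * w x" using \<epsilon> by (simp add: G_def w_def field_simps)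
    then have "exp (b \<bullet> x) * (\<epsilon> * G x + \<epsilon> * (b \<bullet> b) * w x) = (exp (b \<bullet> x) * e x) * (g1 x + g2 x)" by (simp add: algebra_simps)
    then show ?thesis by (simp add: inv)
  qed
  with vsub_exp_conjugate[of \<epsilon> 0 "\<lambda>x. \<epsilon> * G x" S w b] 3 w' show ?thesis
    by (simp add: b)
qed

lemma vsub_cmult:
  fixes u :: "'a::euclidean_space \<Rightarrow> real"
  assumes u: "vsub \<epsilon> (\<lambda>\<xi>. v \<bullet> \<xi>) g S u" and t: "t > 0"
  shows "vsub \<epsilon> (\<lambda>\<xi>. v \<bullet> \<xi>) (\<lambda>x. t * g x) S (\<lambda>x. t * u x)"
  unfolding vsub_def
proof (intro ballI allI impI)
  fix x \<phi> assume x: "x \<in> S" and \<phi>: "Ck_on 2 \<phi> UNIV" and m: "\<forall>\<^sub>F y in nhds x. t * u y - \<phi> y \<le> t * u x - \<phi> x"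
  note a = grad_laplacian_cmult[OF \<phi>, of "1 / t"]
  have "\<forall>\<^sub>F y in nhds x. u y - (1 / t) * \<phi> y \<le> u x - (1 / t) * \<phi> x"
    using m
  proof eventually_elim
    case (elim y)
    from divide_right_mono[OF this, of t] show ?case using t by (simp add: diff_divide_distrib)
  qed
  from vsubD[OF u x a(1) this] show "v \<bullet> grad \<phi> x - \<epsilon> * laplacian \<phi> x \<le> t * g x"
    unfolding a(2,3) using t by (simp add: field_simps)
qed

text \<open>A convex Hamiltonian is a supremum of affine functions, so that its viscosity inequality is a
  family of linear ones.\<close>

lemma vsub_convex:
  fixes u1 u2 :: "'a::euclidean_space \<Rightarrow> real"
  assumes S: "open S" and \<epsilon>: "\<epsilon> > 0" and u: "continuous_on S u1" "continuous_on S u2" 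
    and g: "continuous_on S g1" "continuous_on S g2"
    and v1: "vsub \<epsilon> N g1 S u1" and v2: "vsub \<epsilon> N g2 S u2"
    and N: "\<And>\<eta>. \<exists>v. \<forall>\<xi>. N \<eta> + v \<bullet> (\<xi> - \<eta>) \<le> N \<xi>" and t: "0 < t" "t < 1"
  shows "vsub \<epsilon> N (\<lambda>x. t * g1 x + (1 - t) * g2 x) S (\<lambda>x. t * u1 x + (1 - t) * u2 x)"
  unfolding vsub_def
proof (intro ballI allI impI)
  fix x \<phi> assume x: "x \<in> S" and \<phi>: "Ck_on 2 \<phi> UNIV" 
    and m: "\<forall>\<^sub>F y in nhds x. t * u1 y + (1 - t) * u2 y - \<phi> y \<le> t * u1 x + (1 - t) * u2 x - \<phi> x"
  define \<eta> where "\<eta> = grad \<phi> x"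
  obtain v where v: "\<And>\<xi>. N \<eta> + v \<bullet> (\<xi> - \<eta>) \<le> N \<xi>" using N by blast
  \<comment> \<open>The tangent to \<open>N\<close> at the gradient of the given test function. This
    one linear inequality is implied by both nonlinear ones and agrees with the desired conclusion
    at \<open>\<eta>\<close>.\<close>
  define l where "l = v \<bullet> \<eta> - N \<eta>"
  have lin: "vsub \<epsilon> (\<lambda>\<xi>. v \<bullet> \<xi>) (\<lambda>x. g x + l) S u" if "vsub \<epsilon> N g S u" for g u
    unfolding vsub_def
  proof (intro ballI allI impI)
    fix x \<phi> assume x: "x \<in> S" and \<phi>: "Ck_on 2 \<phi> UNIV" and m: "\<forall>\<^sub>F y in nhds x. u y - \<phi> y \<le> u x - \<phi> x"
    from vsubD[OF that x \<phi> m] v[of "grad \<phi> x"] show "v \<bullet> grad \<phi> x - \<epsilon> * laplacian \<phi> x \<le> g x + l"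
      by (simp add: l_def inner_diff_right)
  qed
  have t': "1 - t > 0" using t by simp
  have "vsub \<epsilon> (\<lambda>\<xi>. v \<bullet> \<xi>) (\<lambda>x. t * (g1 x + l) + (1 - t) * (g2 x + l)) S (\<lambda>x. t * u1 x + (1 - t) * u2 x)"
    by (intro vsub_linear_add S \<epsilon> vsub_cmult lin v1 v2 t t' continuous_intros u g)
  from vsubD[OF this x \<phi> m] show "N (grad \<phi> x) - \<epsilon> * laplacian \<phi> x \<le> t * g1 x + (1 - t) * g2 x"
    by (simp add: l_def \<eta>_def algebra_simps)
qed

section \<open>Stability under upper limits\<close>

lemma continuous_on_absI:
  fixes f :: "'a::metric_space \<Rightarrow> real"
  assumes "\<And>x e. x \<in> S \<Longrightarrow> e > 0 \<Longrightarrow> \<exists>d>0. \<forall>y\<in>ball x d. \<bar>f y - f x\<bar> \<le> e"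
  shows "continuous_on S f"
  unfolding continuous_on_iff
proof (intro ballI allI impI)
  fix x e assume x: "x \<in> S" and e: "e > (0::real)"
  obtain d where d: "d > 0" "\<And>y. y \<in> ball x d \<Longrightarrow> \<bar>f y - f x\<bar> \<le> e / 2" using assms[OF x, of "e / 2"] e by auto
  have "dist (f y) (f x) < e" if "dist y x < d" for y
    using d(2)[of y] that e by (simp add: dist_real_def dist_commute)
  with d(1) show "\<exists>d>0. \<forall>x'\<in>S. dist x' x < d \<longrightarrow> dist (f x') (f x) < e" by blast
qed

lemma bounded_limsup:
  fixes a :: "nat \<Rightarrow> real"
  assumes "\<And>k. \<bar>a k\<bar> \<le> B"
  shows "\<exists>l. (\<forall>e>0. \<forall>\<^sub>F k in sequentially. a k < l + e) \<and> (\<forall>e>0. \<exists>\<^sub>F k in sequentially. l - e < a k)"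
proof -
  define A where "A = {b. \<forall>\<^sub>F k in sequentially. a k < b}"
  have ne: "B + 1 \<in> A" 
  proof -
    have "a k < B + 1" for k using assms[of k] by linarith
    then show ?thesis by (simp add: A_def)
  qed
  have lb: "-B \<le> b" if "b \<in> A" for b
  proof -
    from that obtain k where "a k < b" unfolding A_def eventually_sequentially by blast
    then show ?thesis using assms[of k] by (simp add: abs_le_iff)
  qed
  then have bdd: "bdd_below A" by (auto simp: bdd_below_def)
  show ?thesis
  proof (rule exI[of _ "Inf A"], intro conjI allI impI)
    fix e :: real assume e: "e > 0"
    obtain b where b: "b \<in> A" "b < Inf A + e" using cInf_lessD[of A "Inf A + e"] ne e by auto
    then show "\<forall>\<^sub>F k in sequentially. a k < Inf A + e" unfolding A_def by (auto elim: eventually_mono)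
    show "\<exists>\<^sub>F k in sequentially. Inf A - e < a k"
    proof (rule ccontr)
      assume "\<not> (\<exists>\<^sub>F k in sequentially. Inf A - e < a k)"
      then have "\<forall>\<^sub>F k in sequentially. a k \<le> Inf A - e" by (simp add: not_frequently not_less)
      then have "\<forall>\<^sub>F k in sequentially. a k < Inf A - e / 2" by eventually_elim (use e in simp)
      then have "Inf A - e / 2 \<in> A" by (simp add: A_def)
      from cInf_lower[OF this bdd] e show False by simp
    qed
  qed
qed

text \<open>Upper bounds for \<open>u k\<close> hold for all late \<open>k\<close>, and
  equicontinuity with compactness makes them uniform on a sphere. The lower bound at the centre
  holds for infinitely many \<open>k\<close>. A single index satisfying both has a contact point
  inside the sphere, where its own inequality is tested.\<close>

lemma vsub_limsup:
  fixes u :: "nat \<Rightarrow> 'a::euclidean_space \<Rightarrow> real"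
  assumes S: "open S" and g: "continuous_on S g" and N: "continuous_on UNIV N"
    and u: "\<And>k. vsub \<epsilon> N (\<lambda>x. g x + c k) S (u k)"
    and c: "\<And>e. e > 0 \<Longrightarrow> \<forall>\<^sub>F k in sequentially. c k \<le> c0 + e"
    and eq: "\<And>x e. x \<in> S \<Longrightarrow> e > 0 \<Longrightarrow> \<exists>d>0. ball x d \<subseteq> S \<and> (\<forall>k. \<forall>y\<in>ball x d. \<bar>u k y - u k x\<bar> \<le> e)"
    and U1: "\<And>x e. x \<in> S \<Longrightarrow> e > 0 \<Longrightarrow> \<forall>\<^sub>F k in sequentially. u k x < U x + e"
    and U2: "\<And>x e. x \<in> S \<Longrightarrow> e > 0 \<Longrightarrow> \<exists>\<^sub>F k in sequentially. U x - e < u k x"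
  shows "continuous_on S U" "vsub \<epsilon> N (\<lambda>x. g x + c0) S U"
proof -
  have Ueq: "\<bar>U y - U x\<bar> \<le> 3 * e" if x: "x \<in> S" "y \<in> S" and e: "e > 0" and k: "\<And>k. \<bar>u k y - u k x\<bar> \<le> e" for x y e
  proof -
    have *: "U a \<le> U b + 3 * e" if ab: "a \<in> S" "b \<in> S" "\<And>k. \<bar>u k a - u k b\<bar> \<le> e" for a b
    proof -
      obtain k where "U a - e < u k a" "u k b < U b + e"
        using frequently_eventually_frequently[OF U2[OF ab(1) e] U1[OF ab(2) e]] frequently_ex by blast
      with ab(3)[of k] show ?thesis unfolding abs_le_iff by linarith
    qed
    have "U y \<le> U x + 3 * e" using *[OF x(2,1)] k .
    moreover have "U x \<le> U y + 3 * e" by (rule *[OF x]) (use k in \<open>simp add: abs_minus_commute\<close>)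
    ultimately show ?thesis unfolding abs_le_iff by linarith
  qed
  have Uc: "\<exists>d>0. ball x d \<subseteq> S \<and> (\<forall>k. \<forall>y\<in>ball x d. \<bar>u k y - u k x\<bar> \<le> e \<and> \<bar>U y - U x\<bar> \<le> e)" if x: "x \<in> S" and e: "e > 0" for x e
  proof -
    obtain d where d: "d > 0" "ball x d \<subseteq> S" "\<And>k y. y \<in> ball x d \<Longrightarrow> \<bar>u k y - u k x\<bar> \<le> e / 3"
      using eq[OF x, of "e / 3"] e by auto
    have "\<bar>U y - U x\<bar> \<le> e" if "y \<in> ball x d" for y
      using Ueq[OF x, of y "e / 3"] d that e by auto
    moreover have "\<bar>u k y - u k x\<bar> \<le> e" if "y \<in> ball x d" for y k
      using d(3)[OF that, of k] e by linarith
    ultimately show ?thesis using d by blast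
  qed
  show cU: "continuous_on S U"
  proof (rule continuous_on_absI)
    fix x e assume "x \<in> S" "e > (0::real)"
    from Uc[OF this] show "\<exists>d>0. \<forall>y\<in>ball x d. \<bar>U y - U x\<bar> \<le> e" by metis
  qed
  have cu: "continuous_on S (u k)" for k
  proof (rule continuous_on_absI)
    fix x e assume "x \<in> S" "e > (0::real)"
    from Uc[OF this] show "\<exists>d>0. \<forall>y\<in>ball x d. \<bar>u k y - u k x\<bar> \<le> e" by metis
  qed
  show "vsub \<epsilon> N (\<lambda>x. g x + c0) S U"
    unfolding vsub_def
  proof (intro ballI allI impI)
    fix x \<phi> assume x: "x \<in> S" and \<phi>: "Ck_on 2 \<phi> UNIV" and m: "\<forall>\<^sub>F y in nhds x. U y - \<phi> y \<le> U x - \<phi> x"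
    show "N (grad \<phi> x) - \<epsilon> * laplacian \<phi> x \<le> g x + c0"
    proof (rule vsub_approxI[OF \<phi> N S x])
      show "continuous_on S (\<lambda>x. g x + c0)" by (intro continuous_intros g)
      fix \<delta> r :: real assume \<delta>: "\<delta> > 0" and r: "r > 0"
      from eventually_nhds_cball_le[OF S x r m] obtain r1 where r1: "0 < r1" "r1 \<le> r" "cball x r1 \<subseteq> S" 
        and P: "\<And>y. y \<in> cball x r1 \<Longrightarrow> U y - \<phi> y \<le> U x - \<phi> x" by blast
      \<comment> \<open>The perturbation equals 4e on the sphere; the upper bound there and the
        lower bound at \<open>x\<close> lose \<open>e\<close> each, which keeps the contact point
        inside.\<close>
      define e where "e = \<delta> * r1\<^sup>2 / 4"
      have e: "e > 0" using \<delta> r1 by (simp add: e_def)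
      have sphS: "y \<in> S" if "y \<in> sphere x r1" for y using that r1 by auto
      have "\<forall>\<^sub>F k in sequentially. \<forall>y\<in>sphere x r1. u k y < U y + e"
      proof -
        have "\<exists>d. \<forall>y\<in>sphere x r1. d y > 0 \<and> (\<forall>k. \<forall>z\<in>ball y (d y). \<bar>u k z - u k y\<bar> \<le> e / 3 \<and> \<bar>U z - U y\<bar> \<le> e / 3)"
          using Uc[OF sphS, of _ "e / 3"] e by (intro bchoice) (meson divide_pos_pos zero_less_numeral)
        then obtain d where d: "\<And>y. y \<in> sphere x r1 \<Longrightarrow> d y > 0"
          "\<And>y k z. y \<in> sphere x r1 \<Longrightarrow> z \<in> ball y (d y) \<Longrightarrow> \<bar>u k z - u k y\<bar> \<le> e / 3 \<and> \<bar>U z - U y\<bar> \<le> e / 3" by blast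
        have "sphere x r1 \<subseteq> (\<Union>y\<in>sphere x r1. ball y (d y))" using d(1) by force
        then obtain F where F: "F \<subseteq> sphere x r1" "finite F" "sphere x r1 \<subseteq> (\<Union>y\<in>F. ball y (d y))"
          using compactE_image[OF compact_sphere, of "sphere x r1" "\<lambda>y. ball y (d y)"] by (metis open_ball)
        have "\<forall>\<^sub>F k in sequentially. \<forall>y\<in>F. u k y < U y + e / 3"
          using F sphS e by (intro eventually_ball_finite ballI U1) auto
        then show ?thesis
        proof eventually_elim
          case (elim k)
          show ?case
          proof
            fix z assume "z \<in> sphere x r1"
            then obtain y where y: "y \<in> F" "z \<in> ball y (d y)" using F(3) by blast
            then have "\<bar>u k z - u k y\<bar> \<le> e / 3 \<and> \<bar>U z - U y\<bar> \<le> e / 3" using d(2) F(1) by blast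
            moreover have "u k y < U y + e / 3" using elim y by blast
            ultimately show "u k z < U z + e" unfolding abs_le_iff by linarith
          qed
        qed
      qed
      from frequently_eventually_frequently[OF U2[OF x e] eventually_conj[OF this c[OF \<delta>]]]
      obtain k where k: "U x - e < u k x" "\<And>y. y \<in> sphere x r1 \<Longrightarrow> u k y < U y + e" "c k \<le> c0 + \<delta>"
        using frequently_ex by fastforce
      note p = perturbed_test[OF \<phi>, of \<delta> x]
      define v where "v = (\<lambda>y. u k y - (\<phi> y + \<delta> * (norm (y - x))\<^sup>2))"
      have cv: "continuous_on (cball x r1) v" unfolding v_def
        by (intro continuous_intros laplacian_cont[OF \<phi>] continuous_on_subset[OF cu r1(3)])
      have sp: "v y < v x" if y: "y \<in> sphere x r1" for y
      proof -
        have sqy: "(norm (y - x))\<^sup>2 = r1\<^sup>2" using y by (simp add: dist_norm norm_minus_commute)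
        have e4: "\<delta> * r1\<^sup>2 = 4 * e" by (simp add: e_def)
        have "U y - \<phi> y \<le> U x - \<phi> x" using P[of y] y by auto
        then show ?thesis unfolding v_def sqy using k(1) k(2)[OF y] e e4 by simp
      qed
      obtain y where y: "y \<in> ball x r1" "\<forall>\<^sub>F s in nhds y. v s \<le> v y"
      proof -
        have "x \<in> cball x r1" using r1(1) by simp
        from interior_max[OF cv this sp] that show thesis by metis
      qed
      have "y \<in> S" using y(1) r1(3) by auto
      from vsubD[OF u this p(1) y(2)[unfolded v_def]]
      have "N (grad \<phi> y + (2 * \<delta>) *\<^sub>R (y - x)) - \<epsilon> * (laplacian \<phi> y + 2 * \<delta> * DIM('a)) \<le> g y + c0 + \<delta>"
        unfolding p(2,3) using k(3) by simp
      moreover have "y \<in> ball x r" using y r1 by auto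
      ultimately show "\<exists>y\<in>ball x r. N (grad \<phi> y + (2 * \<delta>) *\<^sub>R (y - x)) - \<epsilon> * (laplacian \<phi> y + 2 * \<delta> * DIM('a)) \<le> g y + c0 + \<delta>"
        by blast
    qed
  qed
qed

section \<open>Oscillation estimate and scaling\<close>

text \<open>Cauchy-Schwarz reduces the inequality to norms, where it is Young's inequality with the
  exponents p and p / (p - 1).\<close>

lemma norm_powr_tangent:
  fixes \<xi> \<eta> :: "'a::real_inner"
  assumes p: "p > 1"
  shows "norm \<eta> powr p + ((p * norm \<eta> powr (p - 2)) *\<^sub>R \<eta>) \<bullet> (\<xi> - \<eta>) \<le> norm \<xi> powr p"
proof (cases "\<eta> = 0")
  case False
  then have pos: "norm \<eta> > 0" by simp
  have "norm \<xi> * norm \<eta> powr (p - 1) \<le> norm \<xi> powr p / p + (norm \<eta> powr (p - 1)) powr (p / (p - 1)) / (p / (p - 1))"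
    by (rule Youngs_inequality) (use p in \<open>auto simp: field_simps\<close>)
  also have "(norm \<eta> powr (p - 1)) powr (p / (p - 1)) = norm \<eta> powr p" using p by (simp add: powr_powr)
  finally have "p * (norm \<xi> * norm \<eta> powr (p - 1)) \<le> norm \<xi> powr p + (p - 1) * norm \<eta> powr p"
    using p by (simp add: field_simps)
  moreover have "norm \<eta> powr (p - 2) * norm \<eta> = norm \<eta> powr (p - 1)"
    using pos powr_add[of "norm \<eta>" "p - 2" 1] by simp
  moreover have "norm \<eta> powr (p - 2) * (\<eta> \<bullet> \<eta>) = norm \<eta> powr p"
    using pos powr_add[of "norm \<eta>" "p - 2" 2] by (simp add: dot_square_norm powr_numeral)
  moreover have "p * (norm \<eta> powr (p - 2) * (\<eta> \<bullet> \<xi>)) \<le> p * (norm \<eta> powr (p - 2) * (norm \<eta> * norm \<xi>))"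
    using p by (intro mult_left_mono norm_cauchy_schwarz) auto
  moreover have "norm \<eta> powr (p - 2) * (norm \<eta> * norm \<xi>) = norm \<xi> * (norm \<eta> powr (p - 2) * norm \<eta>)"
    by (simp only: ac_simps)
  ultimately have "p * (norm \<eta> powr (p - 2) * (\<eta> \<bullet> \<xi>)) \<le> norm \<xi> powr p + (p - 1) * norm \<eta> powr p"
    and "norm \<eta> powr (p - 2) * (\<eta> \<bullet> \<eta>) = norm \<eta> powr p"
    by simp_all
  then show ?thesis
    by (simp add: inner_diff_right algebra_simps)
qed simp

lemma continuous_on_norm_powr:
  assumes "p > 0" shows "continuous_on S (\<lambda>\<xi>::'a::real_normed_vector. norm \<xi> powr p)"
  using assms by (intro continuous_on_powr' continuous_intros) auto

text \<open>The tangent inequality of a concave power, from weighted arithmetic and geometric means.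
  The value \<open>s = 0\<close> is included because the squared distance put into the barrier may
  vanish.\<close>

lemma powr_concave_tangent:
  fixes s s0 \<beta> :: real
  assumes "0 < \<beta>" "\<beta> < 1" "s0 > 0" "s \<ge> 0"
  shows "s powr \<beta> \<le> s0 powr \<beta> + \<beta> * s0 powr (\<beta> - 1) * (s - s0)"
proof -
  have a: "s0 powr \<beta> = s0 powr (\<beta> - 1) * s0" 
    using powr_add[of s0 "\<beta> - 1" 1] assms by simp
  show ?thesis
  proof (cases "s = 0")
    case True
    have "\<beta> * (s0 powr (\<beta> - 1) * s0) \<le> 1 * (s0 powr (\<beta> - 1) * s0)" using assms by (intro mult_right_mono) auto
    then show ?thesis using True assms by (simp add: a algebra_simps)
  next
    case False
    then have "s powr \<beta> * s0 powr (1 - \<beta>) \<le> \<beta> * s + (1 - \<beta>) * s0"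
      using Youngs_inequality_0[of \<beta> "1 - \<beta>" s s0] assms by simp
    then have "s powr \<beta> * s0 powr (1 - \<beta>) * s0 powr (\<beta> - 1) \<le> (\<beta> * s + (1 - \<beta>) * s0) * s0 powr (\<beta> - 1)"
      by (rule mult_right_mono) simp
    moreover have "s0 powr (1 - \<beta>) * s0 powr (\<beta> - 1) = 1" using assms by (simp flip: powr_add)
    ultimately have "s powr \<beta> \<le> (\<beta> * s + (1 - \<beta>) * s0) * s0 powr (\<beta> - 1)" by (simp add: mult.assoc)
    then show ?thesis by (simp add: a algebra_simps)
  qed
qed

text \<open>The barrier is M F(|y - x|^2) with F(s) = s^beta + 1 / (R^2 - s), up to a constant. The
  right-hand side is the p-th power of its slope; the left contains a bound for its Laplacian. The
  exponent \<open>\<beta>\<close> balances both at the centre, and \<open>p > 2\<close> makes it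
  positive. Near the boundary the slope is of order a^(-2), with a = R^2 - s, and its square already
  controls the Laplacian. Finally M^p beats M because p > 1.\<close>

lemma barrier_constant:
  fixes p \<epsilon> R C n :: real
  assumes p: "p > 2" and \<epsilon>: "\<epsilon> > 0" and R: "R > 0" and n: "n > 0"
  defines "\<beta> \<equiv> (p - 2) / (2 * (p - 1))"
  shows "\<exists>M>0. \<forall>s. 0 < s \<and> s < R\<^sup>2 \<longrightarrow>
     C + \<epsilon> * (M * ((\<beta> * s powr (\<beta> - 1) + 1 / (R\<^sup>2 - s)\<^sup>2) * (2 * n) + 4 / (R\<^sup>2 - s)^3 * (4 * s)))
      < (M * (2 * sqrt s * (\<beta> * s powr (\<beta> - 1) + 1 / (R\<^sup>2 - s)\<^sup>2))) powr p"
proof -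
  define G where "G s = 2 * sqrt s * (\<beta> * s powr (\<beta> - 1) + 1 / (R\<^sup>2 - s)\<^sup>2)" for s
  define D where "D s = (\<beta> * s powr (\<beta> - 1) + 1 / (R\<^sup>2 - s)\<^sup>2) * (2 * n) + 4 / (R\<^sup>2 - s)^3 * (4 * s)" for s
  have \<beta>: "0 < \<beta>" "\<beta> < 1 / 2" using p by (auto simp: \<beta>_def field_simps)
  define g0 where "g0 = 2 * \<beta> * R\<^sup>2 powr (\<beta> - 1 / 2)"
  have g0: "g0 > 0" using \<beta> R by (simp add: g0_def)
  define K1 where "K1 = 2 * n * \<beta> / (2 * \<beta>) powr p"
  define K2 where "K2 = (8 * n / R^4 + 64 / R^4) / g0 powr p"
  define K3 where "K3 = (2 * n * R^4 + 16 * R^4) / (2 * R\<^sup>2 * g0 powr (p - 2))"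
  have K: "K1 \<ge> 0" "K2 \<ge> 0" "K3 \<ge> 0" using \<beta> n by (auto simp: K1_def K2_def K3_def)
  define K where "K = K1 + K2 + K3"
  have key: "D s \<le> K * G s powr p" "g0 \<le> G s" if s: "0 < s" "s < R\<^sup>2" for s
  proof -
    define a where "a = R\<^sup>2 - s"
    have a: "0 < a" "a < R\<^sup>2" using s by (auto simp: a_def)
    have sq: "sqrt s * s powr (\<beta> - 1) = s powr (\<beta> - 1 / 2)"
      using s powr_add[of s "1/2" "\<beta> - 1"] by (simp add: powr_half_sqrt)
    have G1: "2 * \<beta> * s powr (\<beta> - 1 / 2) \<le> G s" and G2: "2 * sqrt s / a\<^sup>2 \<le> G s"
      using s \<beta> sq[symmetric] by (auto simp: G_def a_def algebra_simps)
    have "R\<^sup>2 powr (\<beta> - 1 / 2) \<le> s powr (\<beta> - 1 / 2)" using s \<beta> by (intro powr_mono2') auto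
    then have "g0 \<le> 2 * \<beta> * s powr (\<beta> - 1 / 2)" using \<beta> by (simp add: g0_def)
    with G1 show gG: "g0 \<le> G s" by simp
    have Gpos: "G s > 0" using gG g0 by simp
    \<comment> \<open>The equation that determines \<open>\<beta>\<close>: the slope s^(beta - 1/2),
      raised to the power p, has the same singularity at 0 as the Laplacian.\<close>
    have e: "(\<beta> - 1 / 2) * p = \<beta> - 1" using p by (simp add: \<beta>_def field_simps)
    have "(2 * \<beta>) powr p * s powr (\<beta> - 1) = (2 * \<beta> * s powr (\<beta> - 1 / 2)) powr p"
      using \<beta> s by (simp add: powr_mult powr_powr e)
    also have "\<dots> \<le> G s powr p" using G1 \<beta> p by (intro powr_mono2) auto
    finally have "K1 * ((2 * \<beta>) powr p * s powr (\<beta> - 1)) \<le> K1 * G s powr p" using K by (intro mult_left_mono)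
    then have T1: "2 * n * \<beta> * s powr (\<beta> - 1) \<le> K1 * G s powr p" using \<beta> by (simp add: K1_def)
    have g0p: "g0 powr p \<le> G s powr p" using gG g0 p by (intro powr_mono2) auto
    \<comment> \<open>For s up to R^2 / 2 both terms are bounded and are compared with the minimal
      slope \<open>g0\<close>. Beyond, two of the p factors of the slope absorb the singularity
      a^(-4), and the other p - 2 are bounded below by \<open>g0\<close>.\<close>
    have T2: "2 * n / a\<^sup>2 + 16 * s / a^3 \<le> (K2 + K3) * G s powr p"
    proof (cases "s \<le> R\<^sup>2 / 2")
      case True
      then have a2: "R\<^sup>2 / 2 \<le> a" by (simp add: a_def)
      have "2 * n / a\<^sup>2 \<le> 2 * n / (R\<^sup>2 / 2)\<^sup>2" using a2 R n a by (intro divide_left_mono power_mono mult_pos_pos) auto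
      also have "\<dots> = 8 * n / R^4" using R by (simp add: field_simps power2_eq_square power4_eq_xxxx)
      finally have i: "2 * n / a\<^sup>2 \<le> 8 * n / R^4" .
      have "16 * s / a^3 \<le> 16 * (R\<^sup>2 / 2) / (R\<^sup>2 / 2)^3" using a2 R n a True s by (intro frac_le power_mono) auto
      also have "\<dots> \<le> 64 / R^4" using R by (simp add: field_simps power2_eq_square power4_eq_xxxx power3_eq_cube)
      finally have "2 * n / a\<^sup>2 + 16 * s / a^3 \<le> 8 * n / R^4 + 64 / R^4" using i by simp
      also have "\<dots> = K2 * g0 powr p" using g0 by (simp add: K2_def)
      also have "\<dots> \<le> K2 * G s powr p" using K g0p by (intro mult_left_mono)
      also have "\<dots> \<le> (K2 + K3) * G s powr p" using K by (intro mult_right_mono) auto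
      finally show ?thesis .
    next
      case False
      have "G s powr p = (G s)\<^sup>2 * G s powr (p - 2)" using Gpos powr_add[of "G s" 2 "p - 2"] by simp
      moreover have "2 * R\<^sup>2 / a^4 \<le> (G s)\<^sup>2"
      proof -
        have "2 * R\<^sup>2 / a^4 \<le> 4 * s / a^4" using False a by (intro divide_right_mono) auto
        also have "\<dots> = (2 * sqrt s / a\<^sup>2)\<^sup>2" using s by (simp add: power_divide power_mult_distrib flip: power_mult)
        also have "\<dots> \<le> (G s)\<^sup>2" using G2 s a by (intro power_mono) auto
        finally show ?thesis .
      qed
      moreover have "g0 powr (p - 2) \<le> G s powr (p - 2)" using gG g0 p by (intro powr_mono2) auto
      ultimately have *: "2 * R\<^sup>2 / a^4 * g0 powr (p - 2) \<le> G s powr p"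
        using mult_mono[of "2 * R\<^sup>2 / a^4" "(G s)\<^sup>2" "g0 powr (p - 2)" "G s powr (p - 2)"] by simp
      have "2 * n / a\<^sup>2 + 16 * s / a^3 = (2 * n * a\<^sup>2 + 16 * s * a) / a^4"
        using a by (simp add: field_simps power2_eq_square power3_eq_cube power4_eq_xxxx)
      also have "\<dots> \<le> (2 * n * R^4 + 16 * R^4) / a^4"
      proof (intro divide_right_mono add_mono)
        have "a\<^sup>2 \<le> (R\<^sup>2)\<^sup>2" using a by (intro power_mono) auto
        then show "2 * n * a\<^sup>2 \<le> 2 * n * R^4" using n by simp
        have "s * a \<le> R\<^sup>2 * R\<^sup>2" using s a by (intro mult_mono) auto
        then show "16 * s * a \<le> 16 * R^4" by (simp add: power2_eq_square power4_eq_xxxx mult.assoc)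
      qed (use a in auto)
      also have "\<dots> = K3 * (2 * R\<^sup>2 / a^4 * g0 powr (p - 2))" using g0 R by (simp add: K3_def)
      also have "\<dots> \<le> K3 * G s powr p" using K * by (intro mult_left_mono)
      also have "\<dots> \<le> (K2 + K3) * G s powr p" using K by (intro mult_right_mono) auto
      finally show ?thesis .
    qed
    have "D s = 2 * n * \<beta> * s powr (\<beta> - 1) + (2 * n / a\<^sup>2 + 16 * s / a^3)"
      by (simp add: D_def a_def algebra_simps)
    with T1 T2 show "D s \<le> K * G s powr p" by (simp add: K_def algebra_simps)
  qed
  \<comment> \<open>The three entries ensure, in this order, that M is at most M^(p-1), that M
    absorbs the Laplacian term, and that M \<open>g0\<close>^p exceeds \<open>C\<close>.\<close>
  define M where "M = max 1 (max (\<epsilon> * K + 1) (\<bar>C\<bar> / g0 powr p + 1))"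
  have M: "M \<ge> 1" "M \<ge> \<epsilon> * K + 1" "M \<ge> \<bar>C\<bar> / g0 powr p + 1" by (auto simp: M_def)
  have "C + \<epsilon> * (M * D s) < (M * G s) powr p" if s: "0 < s \<and> s < R\<^sup>2" for s
  proof -
    note k = key[OF conjunct1[OF s] conjunct2[OF s]]
    have g0p: "g0 powr p \<le> G s powr p" using k g0 p by (intro powr_mono2) auto
    have "M \<le> M powr (p - 1)" using M(1) p powr_mono[of 1 "p - 1" M] by simp
    then have M1: "\<epsilon> * K + 1 \<le> M powr (p - 1)" using M(2) by simp
    have "M * g0 powr p \<ge> (\<bar>C\<bar> / g0 powr p + 1) * g0 powr p" using M(3) by (intro mult_right_mono) auto
    then have C: "M * g0 powr p > C" using g0 by (simp add: distrib_right) (smt (verit) powr_gt_zero)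
    have "C + \<epsilon> * (M * D s) < M * g0 powr p + \<epsilon> * (M * (K * G s powr p))"
      using C k(1) \<epsilon> M(1) by (intro add_less_le_mono mult_left_mono) auto
    also have "\<dots> \<le> M * G s powr p + \<epsilon> * (M * (K * G s powr p))" using g0p M(1) by simp
    also have "\<dots> = (\<epsilon> * K + 1) * (M * G s powr p)" by (simp add: algebra_simps)
    also have "\<dots> \<le> M powr (p - 1) * (M * G s powr p)" using M1 M(1) by (intro mult_right_mono) auto
    also have "\<dots> = (M powr (p - 1) * M powr 1) * G s powr p" using M(1) by simp
    also have "M powr (p - 1) * M powr 1 = M powr p" using powr_add[of M "p - 1" 1] by simp
    also have "M powr p * G s powr p = (M * G s) powr p" using M(1) k(2) g0 by (simp add: powr_mult)
    finally show ?thesis .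
  qed
  then show ?thesis unfolding D_def G_def using M(1) by (intro exI[of _ M]) auto
qed

text \<open>A barrier with infinite slope at the center of the ball and infinite values on its boundary is a
  strict supersolution because \<open>p > 2\<close>; it bounds the oscillation of every subsolution.\<close>

lemma vsub_oscillation:
  fixes S :: "'a::euclidean_space set"
  assumes p: "p > 2" and \<epsilon>: "\<epsilon> > 0" and R: "R > 0"
  defines "\<beta> \<equiv> (p - 2) / (2 * (p - 1))"
  shows "\<exists>M>0. \<forall>u x S (g :: 'a \<Rightarrow> real). cball x R \<subseteq> S \<longrightarrow> continuous_on S u \<longrightarrow> (\<forall>y\<in>S. g y \<le> C) \<longrightarrow>
    vsub \<epsilon> (\<lambda>\<xi>. norm \<xi> powr p) g S u \<longrightarrow>
    (\<forall>y\<in>ball x R. u y - u x \<le> M * ((norm (y - x))\<^sup>2 powr \<beta> + 1 / (R\<^sup>2 - (norm (y - x))\<^sup>2) - 1 / R\<^sup>2))"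
proof -
  define n where "n = real DIM('a)"
  have n: "n > 0" by (simp add: n_def)
  obtain M where M: "M > 0" and Mb: "\<And>s. 0 < s \<Longrightarrow> s < R\<^sup>2 \<Longrightarrow>
     C + \<epsilon> * (M * ((\<beta> * s powr (\<beta> - 1) + 1 / (R\<^sup>2 - s)\<^sup>2) * (2 * n) + 4 / (R\<^sup>2 - s)^3 * (4 * s)))
      < (M * (2 * sqrt s * (\<beta> * s powr (\<beta> - 1) + 1 / (R\<^sup>2 - s)\<^sup>2))) powr p"
    using barrier_constant[OF p \<epsilon> R n, of C] unfolding \<beta>_def by blast
  have \<beta>: "0 < \<beta>" "\<beta> < 1" using p by (auto simp: \<beta>_def field_simps)
  define F where "F s = s powr \<beta> + 1 / (R\<^sup>2 - s) - 1 / R\<^sup>2" for s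
  have R2: "R\<^sup>2 > 0" using R by simp
  have F0: "F 0 = 0" using \<beta> by (simp add: F_def)
  have Fcont: "continuous_on {0..<R\<^sup>2} F" 
    unfolding F_def using \<beta> by (intro continuous_intros continuous_on_powr') auto
  \<comment> \<open>The barrier is not C^2 on the whole space, so at a contact point it is replaced
    by a quadratic polynomial in s lying above it nearby. The concave power lies below its tangent,
    and the reciprocal has remainder h^2 / (a^2 (a - h)), at most 2 h^2 / a^3 for h up to
    a/2.\<close>
  have touch: "F (s0 + h) - F s0 \<le> (\<beta> * s0 powr (\<beta> - 1) + 1 / a\<^sup>2) * h + 2 / a^3 * h\<^sup>2"
    if s0: "0 < s0" "s0 < R\<^sup>2" and a: "a = R\<^sup>2 - s0" and h: "\<bar>h\<bar> \<le> a / 2" "0 \<le> s0 + h" for s0 a h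
  proof -
    have a0: "a > 0" using s0 a by simp
    have h2: "h \<le> a / 2" using h by simp
    have "1 / (a - h) - 1 / a - h / a\<^sup>2 = h\<^sup>2 / (a\<^sup>2 * (a - h))"
      using a0 h2 by (simp add: field_simps power2_eq_square)
    also have "\<dots> \<le> h\<^sup>2 / (a\<^sup>2 * (a / 2))" using a0 h2 by (intro divide_left_mono mult_left_mono mult_pos_pos) auto
    also have "\<dots> = 2 / a^3 * h\<^sup>2" by (simp add: power2_eq_square power3_eq_cube)
    finally have "1 / (a - h) - 1 / a \<le> h / a\<^sup>2 + 2 / a^3 * h\<^sup>2" by simp
    moreover have "(s0 + h) powr \<beta> \<le> s0 powr \<beta> + \<beta> * s0 powr (\<beta> - 1) * h"
      using powr_concave_tangent[OF \<beta> s0(1) h(2)] by simp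
    ultimately show ?thesis by (simp add: F_def a algebra_simps)
  qed
  show ?thesis
  proof (rule exI[of _ M], intro conjI M allI impI ballI, rule ccontr)
    fix u :: "'a \<Rightarrow> real" and x S g y1
    assume cb: "cball x R \<subseteq> S" and cu: "continuous_on S u" and gC: "\<forall>y\<in>S. g y \<le> C" 
      and sub: "vsub \<epsilon> (\<lambda>\<xi>. norm \<xi> powr p) g S u" and y1: "y1 \<in> ball x R"
      and "\<not> u y1 - u x \<le> M * ((norm (y1 - x))\<^sup>2 powr \<beta> + 1 / (R\<^sup>2 - (norm (y1 - x))\<^sup>2) - 1 / R\<^sup>2)"
    then have neg: "u y1 - M * F ((norm (y1 - x))\<^sup>2) > u x" by (simp add: F_def)
    define v where "v = (\<lambda>y. u y - M * F ((norm (y - x))\<^sup>2))"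
    have "compact (u ` cball x R)" 
      by (intro compact_continuous_image compact_cball continuous_on_subset[OF cu cb])
    then obtain B where B: "\<And>y. y \<in> cball x R \<Longrightarrow> u y \<le> B"
      by (meson bounded_imp_bdd_above compact_imp_bounded bdd_above.unfold image_eqI)
    \<comment> \<open>On the sphere of squared radius \<open>s1\<close> the reciprocal term is at
      least \<open>W\<close>. There the barrier is at least |B - v y1| + 1, which pushes
      \<open>v\<close> below \<open>v y1\<close>.\<close>
    define W where "W = (\<bar>B - v y1\<bar> + 1) / M + 1 / R\<^sup>2"
    have W: "W > 0" using M R by (simp add: W_def add_nonneg_pos)
    define s1 where "s1 = max ((norm (y1 - x))\<^sup>2) (R\<^sup>2 - 1 / W)"
    have ny1: "norm (y1 - x) < R" using y1 by (simp add: dist_norm norm_minus_commute)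
    then have s1: "s1 \<ge> 0" "s1 < R\<^sup>2" "(norm (y1 - x))\<^sup>2 \<le> s1" "R\<^sup>2 - 1 / W \<le> s1"
      using W by (auto simp: s1_def le_max_iff_disj intro!: power_strict_mono)
    define R1 where "R1 = sqrt s1"
    have R1: "R1 \<ge> 0" "R1\<^sup>2 = s1" using s1 by (auto simp: R1_def)
    have R1R: "R1 < R" using R1 s1 R by (metis less_imp_le power_less_imp_less_base)
    have y1c: "y1 \<in> cball x R1" 
      using s1(3) R1 by (simp add: dist_norm norm_minus_commute R1_def real_le_rsqrt)
    have nsq: "(norm (y - x))\<^sup>2 \<in> {0..<R\<^sup>2}" if "y \<in> cball x R1" for y
      using that R1R by (auto simp: dist_norm norm_minus_commute intro!: power_strict_mono)
    have cv: "continuous_on (cball x R1) v" unfolding v_def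
    proof (intro continuous_intros continuous_on_compose2[OF Fcont])
      show "continuous_on (cball x R1) u" by (rule continuous_on_subset[OF cu]) (use cb R1R in auto)
    qed (use nsq in auto)
    have sp: "v y < v y1" if y: "y \<in> sphere x R1" for y
    proof -
      have sq: "(norm (y - x))\<^sup>2 = s1" using y R1 by (simp add: dist_norm norm_minus_commute)
      have "1 / (R\<^sup>2 - s1) \<ge> 1 / (1 / W)" using s1 W by (intro divide_left_mono) auto
      then have "F s1 \<ge> W - 1 / R\<^sup>2" by (simp add: F_def) (smt (verit) powr_ge_zero)
      then have "M * F s1 \<ge> M * (W - 1 / R\<^sup>2)" using M by (intro mult_left_mono) auto
      also have "M * (W - 1 / R\<^sup>2) = \<bar>B - v y1\<bar> + 1" using M by (simp add: W_def)
      finally have "M * F s1 \<ge> \<bar>B - v y1\<bar> + 1" .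
      moreover have "u y \<le> B" using B y R1R by auto
      ultimately show ?thesis unfolding v_def sq by (simp add: v_def[symmetric])
    qed
    obtain y0 where y0: "y0 \<in> ball x R1" "\<And>z. z \<in> cball x R1 \<Longrightarrow> v z \<le> v y0" "\<forall>\<^sub>F z in nhds y0. v z \<le> v y0"
      using interior_max[OF cv y1c sp] by metis
    \<comment> \<open>Since F vanishes at 0, the centre, where the slope of the barrier is infinite,
      cannot be the contact point.\<close>
    have "v x < v y1" using neg by (simp add: v_def F0)
    also have "\<dots> \<le> v y0" using y0(2) y1c by blast
    finally have "y0 \<noteq> x" by auto
    define s0 where "s0 = (norm (y0 - x))\<^sup>2"
    have s0: "0 < s0" "s0 < R\<^sup>2" using \<open>y0 \<noteq> x\<close> nsq[of y0] y0(1) by (auto simp: s0_def)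
    define a where "a = R\<^sup>2 - s0"
    have a: "a > 0" using s0 by (simp add: a_def)
    define A where "A = \<beta> * s0 powr (\<beta> - 1) + 1 / a\<^sup>2"
    have A: "A > 0" using \<beta> s0 a by (simp add: A_def add_nonneg_pos)
    define k where "k = 2 / a^3"
    define P where "P t = M * (A * (t - s0) + k * (t - s0)\<^sup>2)" for t
    define P' where "P' t = M * (A + 2 * k * (t - s0))" for t
    define P'' where "P'' = (\<lambda>t::real. M * (2 * k))"
    have dP: "(P has_real_derivative P' t) (at t)" "(P' has_real_derivative P'' t) (at t)" for t
      unfolding P_def[abs_def] P'_def[abs_def] P''_def by (auto intro!: derivative_eq_intros simp: power2_eq_square algebra_simps)
    have cP: "continuous_on UNIV P''" by (simp add: P''_def)
    define \<phi> where "\<phi> y = P ((norm (y - x))\<^sup>2)" for y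
    have cond: "\<forall>\<^sub>F z in nhds y0. \<bar>(norm (z - x))\<^sup>2 - s0\<bar> \<le> a / 2"
    proof -
      have "filterlim (\<lambda>z. (norm (z - x))\<^sup>2) (nhds s0) (nhds y0)"
        unfolding s0_def by (intro tendsto_intros filterlim_ident)
      from tendstoD[OF this, of "a / 2"] a show ?thesis 
        by (auto simp: dist_real_def elim!: eventually_mono)
    qed
    have "\<forall>\<^sub>F z in nhds y0. u z - \<phi> z \<le> u y0 - \<phi> y0"
      using y0(3) cond
    proof eventually_elim
      case (elim z)
      define h where "h = (norm (z - x))\<^sup>2 - s0"
      have "M * (F (s0 + h) - F s0) \<le> M * (A * h + k * h\<^sup>2)"
      proof (rule mult_left_mono)
        show "F (s0 + h) - F s0 \<le> A * h + k * h\<^sup>2"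
          unfolding A_def k_def by (rule touch[OF s0 a_def]) (use elim(2) in \<open>auto simp: h_def\<close>)
      qed (use M in simp)
      then have "M * F ((norm (z - x))\<^sup>2) - M * F s0 \<le> \<phi> z - \<phi> y0"
        by (simp add: \<phi>_def P_def h_def s0_def[symmetric] algebra_simps)
      with elim(1) show ?case by (simp add: v_def s0_def)
    qed
    moreover have y0S: "y0 \<in> S" using y0(1) cb R1R by auto
    note gl = grad_laplacian_compose[OF grad_laplacian_sq(1)[of x] dP cP, folded \<phi>_def]
    ultimately have *: "norm (grad \<phi> y0) powr p - \<epsilon> * laplacian \<phi> y0 \<le> g y0"
      using vsubD[OF sub y0S gl(1)] by blast
    have "grad \<phi> y0 = (2 * (M * A)) *\<^sub>R (y0 - x)"
      unfolding gl(2) grad_laplacian_sq(2) s0_def[symmetric] by (simp add: P'_def)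
    moreover have "norm (y0 - x) = sqrt s0" by (simp add: s0_def)
    ultimately have ng: "norm (grad \<phi> y0) = M * (2 * sqrt s0 * A)" using M A by simp
    have "(norm (2 *\<^sub>R (y0 - x)))\<^sup>2 = 4 * s0" by (simp add: s0_def power_mult_distrib)
    moreover have "4 / a^3 = 2 * k" by (simp add: k_def)
    ultimately have lp: "laplacian \<phi> y0 = M * (A * (2 * n) + 4 / a^3 * (4 * s0))"
      unfolding gl(3) grad_laplacian_sq(2,3) s0_def[symmetric] by (simp add: P'_def P''_def n_def algebra_simps)
    have "C < norm (grad \<phi> y0) powr p - \<epsilon> * laplacian \<phi> y0"
      using Mb[OF s0] unfolding ng lp A_def a_def by simp
    with * gC y0S show False by fastforce
  qed
qed

text \<open>The bound of \<open>vsub_oscillation\<close> depends on \<open>u\<close> and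
  \<open>g\<close> only through \<open>C\<close>, and it can be centred at either of two nearby
  points, which makes it two-sided. Halving the radius keeps the balls around both points inside
  \<open>S\<close>.\<close>

lemma vsub_equicontinuous:
  fixes S :: "'a::euclidean_space set"
  assumes p: "p > 2" and \<epsilon>: "\<epsilon> > 0" and S: "open S" "x \<in> S" and e: "e > 0"
  shows "\<exists>d>0. ball x d \<subseteq> S \<and> (\<forall>u g. continuous_on S u \<longrightarrow> (\<forall>y\<in>S. g y \<le> C) \<longrightarrow>
    vsub \<epsilon> (\<lambda>\<xi>. norm \<xi> powr p) g S u \<longrightarrow> (\<forall>y\<in>ball x d. \<bar>u y - u x\<bar> \<le> e))"
proof -
  obtain R0 where R0: "R0 > 0" "cball x R0 \<subseteq> S" using S open_contains_cball by blast
  define R where "R = R0 / 2"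
  have R: "R > 0" using R0 by (simp add: R_def)
  define \<beta> where "\<beta> = (p - 2) / (2 * (p - 1))"
  have \<beta>: "0 < \<beta>" using p by (simp add: \<beta>_def)
  from vsub_oscillation[OF p \<epsilon> R, of C, folded \<beta>_def]
  obtain M where M: "M > 0" and osc: "\<forall>u x S (g :: 'a \<Rightarrow> real). cball x R \<subseteq> S \<longrightarrow> continuous_on S u \<longrightarrow> (\<forall>y\<in>S. g y \<le> C) \<longrightarrow>
    vsub \<epsilon> (\<lambda>\<xi>. norm \<xi> powr p) g S u \<longrightarrow>
    (\<forall>y\<in>ball x R. u y - u x \<le> M * ((norm (y - x))\<^sup>2 powr \<beta> + 1 / (R\<^sup>2 - (norm (y - x))\<^sup>2) - 1 / R\<^sup>2))"
    by (elim exE conjE)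
  define \<omega> where "\<omega> s = M * (s powr \<beta> + 1 / (R\<^sup>2 - s) - 1 / R\<^sup>2)" for s
  have "continuous_on {0..<R\<^sup>2} \<omega>" 
    unfolding \<omega>_def using \<beta> by (intro continuous_intros continuous_on_powr') auto
  moreover have z: "0 \<in> {0..<R\<^sup>2}" using R by simp
  moreover have "\<omega> 0 = 0" using \<beta> by (simp add: \<omega>_def)
  ultimately obtain d0 where d0: "d0 > 0" "\<And>s. s \<in> {0..<R\<^sup>2} \<Longrightarrow> dist s 0 < d0 \<Longrightarrow> dist (\<omega> s) 0 < e"
    unfolding continuous_on_iff using e by metis
  define d where "d = min R (min 1 d0)"
  have d: "d > 0" "d \<le> R" "d \<le> 1" "d \<le> d0" using R d0 by (auto simp: d_def)
  have \<omega>: "\<omega> ((norm (y - z))\<^sup>2) \<le> e" if "norm (y - z) < d" for y z :: 'a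
  proof -
    have "(norm (y - z))\<^sup>2 < R\<^sup>2" using that d by (intro power_strict_mono) auto
    moreover have "(norm (y - z))\<^sup>2 < d0"
    proof -
      have "norm (y - z) * norm (y - z) \<le> norm (y - z) * 1" using that d by (intro mult_left_mono) auto
      then show ?thesis using that d by (simp add: power2_eq_square)
    qed
    ultimately have "dist (\<omega> ((norm (y - z))\<^sup>2)) 0 < e" by (intro d0(2)) auto
    then show ?thesis by (simp add: dist_real_def)
  qed
  show ?thesis
  proof (rule exI[of _ d], intro conjI d allI impI ballI)
    show "ball x d \<subseteq> S" using R0 d by (auto simp: R_def)
    fix u g y assume u: "continuous_on S u" "\<forall>y\<in>S. g y \<le> C" "vsub \<epsilon> (\<lambda>\<xi>. norm \<xi> powr p) g S u" and y: "y \<in> ball x d"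
    have ny: "norm (y - x) < d" "norm (x - y) < d" using y by (auto simp: dist_norm norm_minus_commute)
    have "cball x R \<subseteq> S" using R0 by (auto simp: R_def)
    from osc[rule_format, OF this u(1) u(2)[rule_format] u(3), of y] have 1: "u y - u x \<le> e" 
      using \<omega>[OF ny(1)] ny d by (simp add: \<omega>_def dist_norm norm_minus_commute)
    have "cball y R \<subseteq> cball x R0" 
    proof
      fix z assume "z \<in> cball y R"
      then have "dist x z \<le> dist x y + dist y z" "dist y z \<le> R" "dist x y < d" using y dist_triangle by auto
      then show "z \<in> cball x R0" using d by (simp add: R_def)
    qed
    with R0 have "cball y R \<subseteq> S" by blast
    from osc[rule_format, OF this u(1) u(2)[rule_format] u(3), of x] have 2: "u x - u y \<le> e" 
      using \<omega>[OF ny(2)] ny d by (simp add: \<omega>_def dist_norm norm_minus_commute)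
    from 1 2 show "\<bar>u y - u x\<bar> \<le> e" by simp
  qed
qed

text \<open>With q = p / (p - 1) one has p (q - 1) = q, so the gradient term and the Laplacian of
  s^(q-2) u(s x) both acquire the factor s^q.\<close>

lemma vsub_scale:
  fixes u :: "'a::euclidean_space \<Rightarrow> real"
  assumes p: "p > 1" and s: "s > 0" and u: "vsub \<epsilon> (\<lambda>\<xi>. norm \<xi> powr p) g S u" 
  defines "q \<equiv> p / (p - 1)"
  shows "vsub \<epsilon> (\<lambda>\<xi>. norm \<xi> powr p) (\<lambda>x. s powr q * g (s *\<^sub>R x)) {x. s *\<^sub>R x \<in> S} (\<lambda>x. s powr (q - 2) * u (s *\<^sub>R x))"
  unfolding vsub_def
proof (intro ballI allI impI)
  fix x \<phi> assume x: "x \<in> {x. s *\<^sub>R x \<in> S}" and \<phi>: "Ck_on 2 \<phi> UNIV"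
    and m: "\<forall>\<^sub>F y in nhds x. s powr (q - 2) * u (s *\<^sub>R y) - \<phi> y \<le> s powr (q - 2) * u (s *\<^sub>R x) - \<phi> x"
  define c where "c = s powr (2 - q)"
  have c: "c > 0" "c * s powr (q - 2) = 1" using s by (auto simp: c_def simp flip: powr_add)
  note a = grad_laplacian_affine[OF \<phi>, of "1 / s" 0]
  note b = grad_laplacian_cmult[OF a(1), of c]
  have ss: "(1 / s) *\<^sub>R (s *\<^sub>R x) = x" using s by simp
  have "filterlim (\<lambda>z. (1 / s) *\<^sub>R z) (nhds ((1 / s) *\<^sub>R (s *\<^sub>R x))) (nhds (s *\<^sub>R x))" 
    by (intro tendsto_intros filterlim_ident)
  then have f: "filterlim (\<lambda>z. (1 / s) *\<^sub>R z) (nhds x) (nhds (s *\<^sub>R x))" unfolding ss .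
  have "\<forall>\<^sub>F z in nhds (s *\<^sub>R x). u z - c * \<phi> ((1 / s) *\<^sub>R z + 0) \<le> u (s *\<^sub>R x) - c * \<phi> ((1 / s) *\<^sub>R (s *\<^sub>R x) + 0)"
    using eventually_compose_filterlim[OF m f]
  proof eventually_elim
    case (elim z)
    have "s *\<^sub>R (1 / s) *\<^sub>R z = z" using s by simp
    with elim have "s powr (q - 2) * u z - \<phi> ((1 / s) *\<^sub>R z) \<le> s powr (q - 2) * u (s *\<^sub>R x) - \<phi> x" by metis
    then have "c * (s powr (q - 2) * u z - \<phi> ((1 / s) *\<^sub>R z)) \<le> c * (s powr (q - 2) * u (s *\<^sub>R x) - \<phi> x)"
      using c by (intro mult_left_mono) auto
    then have "(c * s powr (q - 2)) * u z - c * \<phi> ((1 / s) *\<^sub>R z) \<le> (c * s powr (q - 2)) * u (s *\<^sub>R x) - c * \<phi> x"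
      by (simp add: algebra_simps)
    then show ?case using c(2) ss by simp
  qed
  from vsubD[OF u _ b(1) this] x
  have "norm ((c / s) *\<^sub>R grad \<phi> x) powr p - \<epsilon> * (c / s\<^sup>2 * laplacian \<phi> x) \<le> g (s *\<^sub>R x)"
    unfolding b(2,3) a(2,3) using s by (simp add: power_divide)
  moreover have "norm ((c / s) *\<^sub>R grad \<phi> x) powr p = s powr (- q) * norm (grad \<phi> x) powr p"
  proof -
    have "c / s = s powr (1 - q)" using s powr_diff[of s "2 - q" 1] by (simp add: c_def)
    then have "norm ((c / s) *\<^sub>R grad \<phi> x) powr p = s powr ((1 - q) * p) * norm (grad \<phi> x) powr p"
      using s by (simp add: powr_mult powr_powr)
    moreover have "(1 - q) * p = - q" using p by (simp add: q_def field_simps)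
    ultimately show ?thesis by simp
  qed
  moreover have "c / s\<^sup>2 = s powr (- q)" using s powr_diff[of s "2 - q" 2] by (simp add: c_def powr_numeral)
  ultimately have "s powr (- q) * (norm (grad \<phi> x) powr p - \<epsilon> * laplacian \<phi> x) \<le> g (s *\<^sub>R x)" by (simp add: algebra_simps)
  then have "s powr q * (s powr (- q) * (norm (grad \<phi> x) powr p - \<epsilon> * laplacian \<phi> x)) \<le> s powr q * g (s *\<^sub>R x)"
    by (intro mult_left_mono) auto
  moreover have "s powr q * s powr (- q) = 1" using s by (simp flip: powr_add)
  ultimately show "norm (grad \<phi> x) powr p - \<epsilon> * laplacian \<phi> x \<le> s powr q * g (s *\<^sub>R x)"
    by (simp only: mult.assoc[symmetric] mult_1_left)
qed

section \<open>Hahn--Banach and the Riesz representation theorem\<close>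

definition sublinear :: "('v::real_vector \<Rightarrow> real) \<Rightarrow> bool" where
  "sublinear q \<longleftrightarrow> (\<forall>x y. q (x + y) \<le> q x + q y) \<and> (\<forall>t\<ge>0. \<forall>x. q (t *\<^sub>R x) = t * q x)"

lemma sublinearD:
  assumes "sublinear q"
  shows "q (x + y) \<le> q x + q y" "t \<ge> 0 \<Longrightarrow> q (t *\<^sub>R x) = t * q x" "q 0 = 0" "- q (- x) \<le> q x"
proof -
  show a: "q (x + y) \<le> q x + q y" "t \<ge> 0 \<Longrightarrow> q (t *\<^sub>R x) = t * q x" for x y t
    using assms by (auto simp: sublinear_def)
  show z: "q 0 = 0" using a(2)[of 0 0] by simp
  show "- q (- x) \<le> q x" using a(1)[of x "- x"] z by simp
qed

text \<open>Taking the infimum along the ray in direction \<open>y\<close>, with the linear growth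
  subtracted, keeps sublinearity and forces \<open>r (- y) \<le> - q y\<close>. A functional that
  admits no smaller one therefore satisfies q(-y) = -q(y), hence is linear.\<close>

lemma sublinear_reduction:
  fixes q :: "'v::real_vector \<Rightarrow> real"
  assumes q: "sublinear q"
  shows "\<exists>r. sublinear r \<and> (\<forall>x. r x \<le> q x) \<and> r (- y) \<le> - q y"
proof -
  define r where "r x = (INF t\<in>{0..}. q (x + t *\<^sub>R y) - t * q y)" for x
  note D = sublinearD[OF q]
  have lb: "- q (- x) \<le> q (x + t *\<^sub>R y) - t * q y" if "t \<ge> 0" for x t
  proof -
    have "t * q y = q ((x + t *\<^sub>R y) + (- x))" using D(2)[OF that] by simp
    also have "\<dots> \<le> q (x + t *\<^sub>R y) + q (- x)" by (rule D(1))
    finally show ?thesis by simp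
  qed
  have bdd: "bdd_below ((\<lambda>t. q (x + t *\<^sub>R y) - t * q y) ` {0..})" for x
    using lb by (intro bdd_belowI2) auto
  have le: "r x \<le> q (x + t *\<^sub>R y) - t * q y" if "t \<ge> 0" for x t
    unfolding r_def using that by (intro cINF_lower bdd) auto
  have ge: "c \<le> r x" if "\<And>t. t \<ge> 0 \<Longrightarrow> c \<le> q (x + t *\<^sub>R y) - t * q y" for c x
    unfolding r_def using that by (intro cINF_greatest) auto
  have add: "r (x + z) \<le> r x + r z" for x z
  proof -
    have "r (x + z) - r z \<le> q (x + t *\<^sub>R y) - t * q y" if t: "t \<ge> 0" for t
    proof -
      have "r (x + z) - (q (x + t *\<^sub>R y) - t * q y) \<le> q (z + s *\<^sub>R y) - s * q y" if s: "s \<ge> 0" for s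
      proof -
        have "r (x + z) \<le> q ((x + z) + (t + s) *\<^sub>R y) - (t + s) * q y" using s t by (intro le) auto
        also have "(x + z) + (t + s) *\<^sub>R y = (x + t *\<^sub>R y) + (z + s *\<^sub>R y)" by (simp add: algebra_simps)
        also have "q \<dots> \<le> q (x + t *\<^sub>R y) + q (z + s *\<^sub>R y)" by (rule D(1))
        finally show ?thesis by (simp add: algebra_simps)
      qed
      then have "r (x + z) - (q (x + t *\<^sub>R y) - t * q y) \<le> r z" by (rule ge)
      then show ?thesis by simp
    qed
    then have "r (x + z) - r z \<le> r x" by (rule ge)
    then show ?thesis by simp
  qed
  have hom1: "r (s *\<^sub>R x) \<le> s * r x" if s: "s > 0" for s x
  proof -
    have "r (s *\<^sub>R x) / s \<le> q (x + t *\<^sub>R y) - t * q y" if t: "t \<ge> 0" for t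
    proof -
      have "r (s *\<^sub>R x) \<le> q (s *\<^sub>R x + (s * t) *\<^sub>R y) - (s * t) * q y" using s t by (intro le) auto
      also have "s *\<^sub>R x + (s * t) *\<^sub>R y = s *\<^sub>R (x + t *\<^sub>R y)" by (simp add: algebra_simps)
      also have "q \<dots> = s * q (x + t *\<^sub>R y)" using s by (intro D(2)) auto
      finally show ?thesis using s by (simp add: field_simps)
    qed
    then have "r (s *\<^sub>R x) / s \<le> r x" by (rule ge)
    then show ?thesis using s by (simp add: field_simps)
  qed
  have r0: "r 0 = 0"
  proof (rule antisym)
    show "r 0 \<le> 0" using le[of 0 0] D(3) by simp
    show "0 \<le> r 0"
    proof (rule ge)
      show "0 \<le> q (0 + t *\<^sub>R y) - t * q y" if "t \<ge> 0" for t using lb[OF that, of 0] D(3) by simp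
    qed
  qed
  have hom: "r (s *\<^sub>R x) = s * r x" if "s \<ge> 0" for s x
  proof (cases "s = 0")
    case False
    then have s: "s > 0" using that by simp
    have "r ((1 / s) *\<^sub>R (s *\<^sub>R x)) \<le> (1 / s) * r (s *\<^sub>R x)" using s by (intro hom1) auto
    then have "s * r x \<le> r (s *\<^sub>R x)" using s by (simp add: field_simps)
    with hom1[OF s, of x] show ?thesis by simp
  qed (simp add: r0)
  have "r x \<le> q x" for x using le[of 0 x] by simp
  moreover have "r (- y) \<le> - q y" using le[of 1 "- y"] D(3) by simp
  ultimately show ?thesis using add hom unfolding sublinear_def by blast
qed

text \<open>Zorn's lemma for the reversed pointwise order. The bound q(x) >= -p(-x), common to all
  sublinear q below p, keeps the infimum of a chain finite; comparability within the chain makes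
  that infimum subadditive.\<close>

lemma minimal_sublinear:
  fixes p :: "'v::real_vector \<Rightarrow> real"
  assumes p: "sublinear p"
  obtains m where "sublinear m" "\<And>x. m x \<le> p x" 
    "\<And>r. sublinear r \<Longrightarrow> (\<And>x. r x \<le> m x) \<Longrightarrow> r = m"
proof -
  define A where "A = {q. sublinear q \<and> (\<forall>x. q x \<le> p x)}"
  define P where "P q r \<longleftrightarrow> (\<forall>x. r x \<le> q x)" for q r :: "'v \<Rightarrow> real"
  have po: "partial_order_on A (relation_of P A)"
    unfolding partial_order_on_def preorder_on_def refl_on_def trans_def antisym_def relation_of_def P_def
    by (auto intro: order_trans) (auto intro!: ext antisym)
  have "\<exists>m\<in>A. \<forall>a\<in>A. P m a \<longrightarrow> a = m"
  proof (rule predicate_Zorn[OF po])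
    fix C assume C: "C \<in> Chains (relation_of P A)"
    show "\<exists>u\<in>A. \<forall>a\<in>C. P a u"
    proof (cases "C = {}")
      case True then show ?thesis using p by (auto simp: A_def)
    next
      case False
      have CA: "C \<subseteq> A" using C by (auto simp: Chains_def relation_of_def)
      have lb: "- p (- x) \<le> q x" if "q \<in> C" for q x
      proof -
        have "sublinear q" "q (- x) \<le> p (- x)" using that CA by (auto simp: A_def)
        with sublinearD(4)[of q x] show ?thesis by simp
      qed
      define u where "u x = (INF q\<in>C. q x)" for x
      have bdd: "bdd_below ((\<lambda>q. q x) ` C)" for x using lb by (intro bdd_belowI2) auto
      have le: "u x \<le> q x" if "q \<in> C" for q x unfolding u_def using that by (intro cINF_lower bdd)
      have ge: "c \<le> u x" if "\<And>q. q \<in> C \<Longrightarrow> c \<le> q x" for c x 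
        unfolding u_def using that False by (intro cINF_greatest)
      have "u (x + y) \<le> u x + u y" for x y
      proof -
        have "u (x + y) - u y \<le> q x" if q: "q \<in> C" for q
        proof -
          have "u (x + y) - q x \<le> r y" if r: "r \<in> C" for r
          proof -
            have "P q r \<or> P r q" using C q r by (auto simp: Chains_def relation_of_def)
            then obtain s where s: "s \<in> C" "s x \<le> q x" "s y \<le> r y"
              unfolding P_def using q r by blast
            have "u (x + y) \<le> s (x + y)" by (rule le[OF s(1)])
            also have "\<dots> \<le> s x + s y" using s CA by (intro sublinearD(1)) (auto simp: A_def)
            finally show ?thesis using s by simp
          qed
          then have "u (x + y) - q x \<le> u y" by (rule ge)
          then show ?thesis by simp
        qed
        then have "u (x + y) - u y \<le> u x" by (rule ge)
        then show ?thesis by simp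
      qed
      moreover have "u (t *\<^sub>R x) = t * u x" if t: "t \<ge> 0" for t x
      proof -
        have h: "q (t *\<^sub>R x) = t * q x" if "q \<in> C" for q using that CA t by (auto simp: A_def sublinearD(2))
        show ?thesis
        proof (cases "t = 0")
          case True
          obtain q where "q \<in> C" using False by blast
          then have "(INF q\<in>C. q (t *\<^sub>R x)) = (INF q\<in>C. 0)" using h True by (intro INF_cong) auto
          then show ?thesis using True False by (simp add: u_def)
        next
          case False
          then have t: "t > 0" using t by simp
          have "u (t *\<^sub>R x) / t \<le> u x" 
          proof (rule ge)
            fix q assume q: "q \<in> C"
            show "u (t *\<^sub>R x) / t \<le> q x" using le[OF q, of "t *\<^sub>R x"] h[OF q] t by (simp add: field_simps)
          qed
          moreover have "t * u x \<le> u (t *\<^sub>R x)"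
          proof (rule ge)
            fix q assume q: "q \<in> C"
            show "t * u x \<le> q (t *\<^sub>R x)" using le[OF q, of x] h[OF q] t by simp
          qed
          ultimately show ?thesis using t by (simp add: field_simps)
        qed
      qed
      moreover have "u x \<le> p x" for x
      proof -
        obtain q where "q \<in> C" using False by blast
        then show ?thesis using le[of q x] CA unfolding A_def by (auto intro: order_trans)
      qed
      ultimately have "u \<in> A" unfolding A_def sublinear_def by blast
      moreover have "\<forall>a\<in>C. P a u" unfolding P_def using le by blast
      ultimately show ?thesis by blast
    qed
  qed
  then obtain m where m: "m \<in> A" "\<And>a. a \<in> A \<Longrightarrow> P m a \<Longrightarrow> a = m" by blast
  show thesis
  proof (rule that[of m])
    show "sublinear m" "\<And>x. m x \<le> p x" using m(1) by (auto simp: A_def)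
    fix r assume r: "sublinear r" "\<And>x. r x \<le> m x"
    then have "r \<in> A" using m(1) unfolding A_def by (auto intro: order_trans)
    with m(2) r(2) show "r = m" by (simp add: P_def)
  qed
qed

text \<open>Hahn--Banach, without extending functionals from subspaces: a minimal sublinear functional is
  linear, because it coincides with all its reductions.\<close>

lemma hahn_banach_sublinear:
  fixes p :: "'v::real_vector \<Rightarrow> real"
  assumes p: "sublinear p"
  obtains \<Lambda> where "linear \<Lambda>" "\<And>x. \<Lambda> x \<le> p x" "\<Lambda> y = p y"
proof -
  \<comment> \<open>Reducing once at \<open>y\<close> before minimising secures equality there:
    every linear functional below \<open>p1\<close> is at most \<open>- p y\<close> at
    \<open>- y\<close>, hence at least \<open>p y\<close> at \<open>y\<close>.\<close>
  obtain p1 where p1: "sublinear p1" "\<And>x. p1 x \<le> p x" "p1 (- y) \<le> - p y"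
    using sublinear_reduction[OF p] by blast
  obtain m where m: "sublinear m" "\<And>x. m x \<le> p1 x" and min: "\<And>r. sublinear r \<Longrightarrow> (\<And>x. r x \<le> m x) \<Longrightarrow> r = m"
    using minimal_sublinear[OF p1(1)] by blast
  note D = sublinearD[OF m(1)]
  have neg: "m (- z) = - m z" for z
  proof -
    obtain r where r: "sublinear r" "\<And>x. r x \<le> m x" "r (- z) \<le> - m z"
      using sublinear_reduction[OF m(1)] by blast
    with min[OF r(1,2)] have "m (- z) \<le> - m z" by simp
    moreover have "- m z \<le> m (- z)" using D(4)[of z] by simp
    ultimately show ?thesis by simp
  qed
  have "linear m"
  proof (rule linearI)
    show "m (x + z) = m x + m z" for x z
      using D(1)[of x z] D(1)[of "x + z" "- z"] neg[of z] by simp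
    show "m (t *\<^sub>R x) = t *\<^sub>R m x" for t x
    proof (cases "t \<ge> 0")
      case False
      have "m (t *\<^sub>R x) = - m ((- t) *\<^sub>R x)" using neg[of "(- t) *\<^sub>R x"] by simp
      also have "\<dots> = t * m x" using D(2)[of "- t" x] False by simp
      finally show ?thesis by simp
    qed (simp add: D(2))
  qed
  moreover have le: "m x \<le> p x" for x using m(2)[of x] p1(2)[of x] by simp
  moreover have "m y = p y"
    using m(2)[of "- y"] p1(3) neg[of y] le[of y] by simp
  ultimately show thesis by (rule that)
qed

section \<open>Riesz representation through a Daniell-type outer measure\<close>

locale positive_functional =
  fixes K :: "'a::euclidean_space set" and L :: "('a \<Rightarrow> real) \<Rightarrow> real"
  assumes compact_K: "compact K"
    and add: "continuous_on K f \<Longrightarrow> continuous_on K g \<Longrightarrow> L (\<lambda>x. f x + g x) = L f + L g"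
    and cmult: "continuous_on K f \<Longrightarrow> L (\<lambda>x. c * f x) = c * L f"
    and pos: "continuous_on K f \<Longrightarrow> (\<And>x. x \<in> K \<Longrightarrow> 0 \<le> f x) \<Longrightarrow> 0 \<le> L f"
    and one: "L (\<lambda>x. 1) = 1"
begin

lemma const: "L (\<lambda>x. c) = c"
  using cmult[of "\<lambda>x. 1" c] one by simp

lemma diff: "continuous_on K f \<Longrightarrow> continuous_on K g \<Longrightarrow> L (\<lambda>x. f x - g x) = L f - L g"
  using add[of f "\<lambda>x. (-1) * g x"] cmult[of g "-1"] by (simp add: continuous_intros)

lemma mono: "continuous_on K f \<Longrightarrow> continuous_on K g \<Longrightarrow> (\<And>x. x \<in> K \<Longrightarrow> f x \<le> g x) \<Longrightarrow> L f \<le> L g"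
  using pos[of "\<lambda>x. g x - f x"] diff[of g f] by (simp add: continuous_intros)

text \<open>Positivity makes \<open>L\<close> blind to values off \<open>K\<close>, so that it is a
  functional on C(K) although its arguments are total functions.\<close>

lemma cong: "continuous_on K f \<Longrightarrow> continuous_on K g \<Longrightarrow> (\<And>x. x \<in> K \<Longrightarrow> f x = g x) \<Longrightarrow> L f = L g"
  using mono[of f g] mono[of g f] by (simp add: antisym)

lemma sum: "finite I \<Longrightarrow> (\<And>i. i \<in> I \<Longrightarrow> continuous_on K (f i)) \<Longrightarrow> L (\<lambda>x. \<Sum>i\<in>I. f i x) = (\<Sum>i\<in>I. L (f i))"
proof (induction I rule: finite_induct)
  case empty then show ?case using const[of 0] by simp
next
  case (insert j I) 
  have "L (\<lambda>x. f j x + (\<Sum>i\<in>I. f i x)) = L (f j) + L (\<lambda>x. \<Sum>i\<in>I. f i x)"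
    using insert.prems by (intro add continuous_intros) auto
  with insert show ?case by simp
qed

text \<open>Covers by series of nonnegative continuous functions take the place of covers by open
  sets. Countable subadditivity becomes the rearrangement of a double series, and covers can be
  split by multiplying them with continuous cutoffs.\<close>

definition covers :: "'a set \<Rightarrow> (nat \<Rightarrow> 'a \<Rightarrow> real) set" where
  "covers A = {h. (\<forall>n. continuous_on K (h n) \<and> (\<forall>x\<in>K. 0 \<le> h n x)) \<and> (\<forall>x\<in>A. 1 \<le> (\<Sum>n. ennreal (h n x)))}"

definition outer :: "'a set \<Rightarrow> ennreal" where
  "outer A = (INF h\<in>covers A. \<Sum>n. ennreal (L (h n)))"

lemma coversD:
  assumes "h \<in> covers A"
  shows "continuous_on K (h n)" "x \<in> K \<Longrightarrow> 0 \<le> h n x" "x \<in> A \<Longrightarrow> 1 \<le> (\<Sum>n. ennreal (h n x))" "0 \<le> L (h n)"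
  using assms by (auto simp: covers_def intro!: pos)

lemma outer_le: "h \<in> covers A \<Longrightarrow> outer A \<le> (\<Sum>n. ennreal (L (h n)))"
  unfolding outer_def by (rule INF_lower)

lemma le_outer: "(\<And>h. h \<in> covers A \<Longrightarrow> c \<le> (\<Sum>n. ennreal (L (h n)))) \<Longrightarrow> c \<le> outer A"
  unfolding outer_def by (rule INF_greatest)

lemma outer_le_single:
  assumes f: "continuous_on K f" "\<And>x. x \<in> K \<Longrightarrow> 0 \<le> f x" "\<And>x. x \<in> A \<Longrightarrow> 1 \<le> f x"
  shows "outer A \<le> ennreal (L f)"
proof -
  define h where "h n = (if n = (0::nat) then f else (\<lambda>x. 0))" for n
  have s: "(\<Sum>n. F (h n)) = F f" if "F (\<lambda>x. 0) = 0" for F :: "('a \<Rightarrow> real) \<Rightarrow> ennreal"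
    using suminf_finite[of "{0}" "\<lambda>n. F (h n)"] that by (simp add: h_def)
  have "1 \<le> (\<Sum>n. ennreal (h n x))" if "x \<in> A" for x
    using s[of "\<lambda>g. ennreal (g x)"] f(3)[OF that] by (simp add: ennreal_leI flip: ennreal_1)
  then have "h \<in> covers A" using f by (auto simp: covers_def h_def)
  from outer_le[OF this] s[of "\<lambda>g. ennreal (L g)"] const[of 0] show ?thesis by simp
qed

lemma outer_le_1: "outer A \<le> 1"
  using outer_le_single[of "\<lambda>x. 1" A] one by simp

lemma outer_mono: "A \<subseteq> B \<Longrightarrow> outer A \<le> outer B"
  unfolding outer_def by (rule INF_superset_mono) (auto simp: covers_def)

text \<open>Dini's argument: if no partial sum came within \<open>\<delta>\<close> of dominating
  \<open>f\<close> on all of \<open>K\<close>, a limit point of the exceptional points would violate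
  the pointwise bound, because the partial sums increase.\<close>

lemma functional_le_suminf:
  assumes f: "continuous_on K f" and h: "\<And>n. continuous_on K (h n)" "\<And>n x. x \<in> K \<Longrightarrow> 0 \<le> h n x"
    and le: "\<And>x. x \<in> K \<Longrightarrow> ennreal (f x) \<le> (\<Sum>n. ennreal (h n x))"
  shows "ennreal (L f) \<le> (\<Sum>n. ennreal (L (h n)))"
proof (rule ennreal_le_epsilon)
  fix \<delta> :: real assume \<delta>: "\<delta> > 0"
  have "\<exists>N. \<forall>x\<in>K. f x \<le> (\<Sum>n<N. h n x) + \<delta>"
  proof (rule ccontr)
    assume "\<not> ?thesis"
    then have "\<forall>N. \<exists>x. x \<in> K \<and> (\<Sum>n<N. h n x) + \<delta> < f x" by (auto simp: not_le)
    then obtain x where x: "\<And>N. x N \<in> K" "\<And>N. (\<Sum>n<N. h n (x N)) + \<delta> < f (x N)" by metis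
    obtain l r where l: "l \<in> K" "strict_mono r" "(x \<circ> r) \<longlonglongrightarrow> l"
      using compact_K x(1) unfolding compact_def by metis
    have lim: "(\<lambda>N. g (x (r N))) \<longlonglongrightarrow> g l" if "continuous_on K g" for g :: "'a \<Rightarrow> real"
      using continuous_on_tendsto_compose[OF that l(3) l(1)] x(1) by simp
    have part: "(\<Sum>n<M. h n l) + \<delta> \<le> f l" for M
    proof (rule LIMSEQ_le)
      show "(\<lambda>N. (\<Sum>n<M. h n (x (r N))) + \<delta>) \<longlonglongrightarrow> (\<Sum>n<M. h n l) + \<delta>" 
        by (intro tendsto_intros lim h)
      show "(\<lambda>N. f (x (r N))) \<longlonglongrightarrow> f l" by (rule lim[OF f])
      have "(\<Sum>n<M. h n (x (r N))) + \<delta> \<le> f (x (r N))" if "N \<ge> M" for N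
      proof -
        have "M \<le> r N" using that seq_suble[OF l(2), of N] by simp
        then have "(\<Sum>n<M. h n (x (r N))) \<le> (\<Sum>n<r N. h n (x (r N)))"
          using h(2) x(1) by (intro sum_mono2) auto
        then show ?thesis using x(2)[of "r N"] by simp
      qed
      then show "\<exists>N. \<forall>n\<ge>N. (\<Sum>i<M. h i (x (r n))) + \<delta> \<le> f (x (r n))" by blast
    qed
    have fl: "\<delta> \<le> f l" using part[of 0] by simp
    have "(\<Sum>n. ennreal (h n l)) \<le> ennreal (f l - \<delta>)"
    proof (rule suminf_le_const)
      fix M
      have "(\<Sum>n<M. ennreal (h n l)) = ennreal (\<Sum>n<M. h n l)" using h(2) l(1) by (intro sum_ennreal) auto
      also have "\<dots> \<le> ennreal (f l - \<delta>)" using part[of M] by (intro ennreal_leI) simp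
      finally show "(\<Sum>n<M. ennreal (h n l)) \<le> ennreal (f l - \<delta>)" .
    qed simp
    with le[OF l(1)] have "ennreal (f l) \<le> ennreal (f l - \<delta>)" by (rule order_trans)
    then show False using fl \<delta> by (simp add: ennreal_le_iff)
  qed
  then obtain N where N: "\<And>x. x \<in> K \<Longrightarrow> f x \<le> (\<Sum>n<N. h n x) + \<delta>" by blast
  have "L f \<le> L (\<lambda>x. (\<Sum>n<N. h n x) + \<delta>)" using N by (intro mono f continuous_intros h)
  also have "\<dots> = (\<Sum>n<N. L (h n)) + \<delta>" 
    using add[of "\<lambda>x. \<Sum>n<N. h n x" "\<lambda>x. \<delta>"] sum[of "{..<N}" h] h(1) const[of \<delta>] by (simp add: continuous_intros)
  finally have "ennreal (L f) \<le> ennreal ((\<Sum>n<N. L (h n)) + \<delta>)" by (rule ennreal_leI)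
  also have "\<dots> = ennreal (\<Sum>n<N. L (h n)) + ennreal \<delta>"
    using \<delta> h by (intro ennreal_plus sum_nonneg pos) auto
  also have "ennreal (\<Sum>n<N. L (h n)) = (\<Sum>n<N. ennreal (L (h n)))" 
    using h by (intro sum_ennreal[symmetric] pos) auto
  also have "\<dots> \<le> (\<Sum>n. ennreal (L (h n)))" by (intro sum_le_suminf) auto
  finally show "ennreal (L f) \<le> (\<Sum>n. ennreal (L (h n))) + ennreal \<delta>" by simp
qed

lemma functional_le_outer:
  assumes "continuous_on K f" "\<And>x. x \<in> K \<Longrightarrow> f x \<le> (if x \<in> A then 1 else 0)"
  shows "ennreal (L f) \<le> outer A"
proof (rule le_outer)
  fix h assume h: "h \<in> covers A"
  note D = coversD[OF h]
  show "ennreal (L f) \<le> (\<Sum>n. ennreal (L (h n)))"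
  proof (rule functional_le_suminf[OF assms(1) D(1,2)])
    fix x assume x: "x \<in> K"
    show "ennreal (f x) \<le> (\<Sum>n. ennreal (h n x))"
    proof (cases "x \<in> A")
      case True
      have "ennreal (f x) \<le> 1" using assms(2)[OF x] True by (simp add: ennreal_le_1)
      also have "\<dots> \<le> (\<Sum>n. ennreal (h n x))" using True by (rule D(3))
      finally show ?thesis .
    next
      case False
      then have "ennreal (f x) = 0" using assms(2)[OF x] by (simp add: ennreal_neg)
      then show ?thesis by simp
    qed
  qed
qed

lemma outer_empty: "outer {} = 0"
  using outer_le_single[of "\<lambda>x. 0" "{}"] const[of 0] by simp

lemma outer_countably_subadditive: "outer (\<Union>i. A i) \<le> (\<Sum>i. outer (A i))"
proof (rule ennreal_le_epsilon)
  fix e :: real assume e: "e > 0"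
  have "\<exists>h\<in>covers (A i). (\<Sum>n. ennreal (L (h n))) \<le> outer (A i) + ennreal (e * (1/2)^Suc i)" for i
  proof -
    have "outer (A i) < outer (A i) + ennreal (e * (1/2)^Suc i)"
    proof (cases "outer (A i)")
      case (real r)
      then have "ennreal r < ennreal (r + e * (1/2)^Suc i)" using e by (intro ennreal_lessI) (auto intro: add_nonneg_pos)
      then show ?thesis using real e by (simp add: ennreal_plus)
    next
      case top then show ?thesis using outer_le_1[of "A i"] by (simp add: top_unique)
    qed
    then show ?thesis unfolding outer_def[of "A i"] INF_less_iff by (auto intro: less_imp_le)
  qed
  then obtain h where h: "\<And>i. h i \<in> covers (A i)" 
    and hle: "\<And>i. (\<Sum>n. ennreal (L (h i n))) \<le> outer (A i) + ennreal (e * (1/2)^Suc i)" by metis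
  define k where "k m = (case prod_decode m of (i, n) \<Rightarrow> h i n)" for m
  have s: "(\<Sum>m. F (k m)) = (\<Sum>i. \<Sum>n. F (h i n))" for F :: "('a \<Rightarrow> real) \<Rightarrow> ennreal"
    using suminf_ennreal_2dimen[of "\<lambda>i. \<Sum>n. F (h i n)" "\<lambda>(i, n). F (h i n)"]
    by (simp add: k_def case_prod_beta)
  have "k \<in> covers (\<Union>i. A i)"
    unfolding covers_def
  proof (intro CollectI conjI allI ballI)
    show "continuous_on K (k n)" for n using coversD(1)[OF h] by (simp add: k_def case_prod_beta)
    show "0 \<le> k n x" if "x \<in> K" for n x using coversD(2)[OF h that] by (simp add: k_def case_prod_beta)
    fix x assume "x \<in> (\<Union>i. A i)"
    then obtain i where i: "x \<in> A i" by blast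
    have "1 \<le> (\<Sum>n. ennreal (h i n x))" by (rule coversD(3)[OF h i])
    also have "\<dots> \<le> (\<Sum>i. \<Sum>n. ennreal (h i n x))"
      using sum_le_suminf[of "\<lambda>i. \<Sum>n. ennreal (h i n x)" "{i}"] by simp
    finally show "1 \<le> (\<Sum>n. ennreal (k n x))" unfolding s[of "\<lambda>g. ennreal (g x)"] .
  qed
  then have "outer (\<Union>i. A i) \<le> (\<Sum>i. \<Sum>n. ennreal (L (h i n)))"
    using outer_le s[of "\<lambda>g. ennreal (L g)"] by fastforce
  also have "\<dots> \<le> (\<Sum>i. outer (A i) + ennreal (e * (1/2)^Suc i))" by (intro suminf_le hle) auto
  also have "\<dots> = (\<Sum>i. outer (A i)) + (\<Sum>i. ennreal (e * (1/2)^Suc i))" by (intro suminf_add[symmetric]) auto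
  also have "(\<Sum>i. ennreal (e * (1/2)^Suc i)) = ennreal e"
    using e by (intro suminf_ennreal_eq) (auto intro: sums_mult[OF power_half_series, of e, simplified])
  finally show "outer (\<Union>i. A i) \<le> (\<Sum>i. outer (A i)) + ennreal e" .
qed

lemma outer_measure_space_outer: "outer_measure_space (Pow K) outer"
  unfolding outer_measure_space_def positive_def increasing_def countably_subadditive_def
  using outer_empty outer_mono outer_countably_subadditive by auto

lemma outer_Un: "outer (A \<union> B) \<le> outer A + outer B"
proof -
  define F where "F n = (if n = (0::nat) then A else if n = 1 then B else {})" for n
  have u: "(\<Union>n. F n) = A \<union> B" unfolding F_def by (auto split: if_splits)
  have "(\<Sum>n. outer (F n)) = (\<Sum>n\<in>{0, 1}. outer (F n))" by (rule suminf_finite) (auto simp: F_def outer_empty)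
  then show ?thesis using outer_countably_subadditive[of F] unfolding u by (simp add: F_def)
qed

text \<open>A cover of \<open>T\<close>, multiplied by \<open>d\<close> and by 1 - \<open>d\<close>,
  covers the two parts separately, and additivity of \<open>L\<close> leaves the total cost
  unchanged.\<close>

lemma outer_split_separated:
  fixes d :: "'a \<Rightarrow> real"
  assumes d: "continuous_on K d" "\<And>x. x \<in> K \<Longrightarrow> 0 \<le> d x \<and> d x \<le> 1" and T: "T \<subseteq> K"
  shows "outer {x\<in>T. d x = 1} + outer {x\<in>T. d x = 0} \<le> outer T"
proof (rule le_outer)
  fix h assume h: "h \<in> covers T"
  note D = coversD[OF h]
  have 1: "(\<lambda>n x. h n x * d x) \<in> covers {x\<in>T. d x = 1}" and 2: "(\<lambda>n x. h n x * (1 - d x)) \<in> covers {x\<in>T. d x = 0}"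
    unfolding covers_def using D d T by (auto intro!: continuous_intros)
  have "outer {x\<in>T. d x = 1} + outer {x\<in>T. d x = 0} 
     \<le> (\<Sum>n. ennreal (L (\<lambda>x. h n x * d x))) + (\<Sum>n. ennreal (L (\<lambda>x. h n x * (1 - d x))))"
    by (intro add_mono outer_le 1 2)
  also have "\<dots> = (\<Sum>n. ennreal (L (\<lambda>x. h n x * d x)) + ennreal (L (\<lambda>x. h n x * (1 - d x))))"
    by (intro suminf_add) auto
  also have "\<dots> = (\<Sum>n. ennreal (L (h n)))"
  proof (rule arg_cong[where f = suminf], rule ext)
    fix n
    have "L (h n) = L (\<lambda>x. h n x * d x + h n x * (1 - d x))" by (simp add: algebra_simps)
    also have "\<dots> = L (\<lambda>x. h n x * d x) + L (\<lambda>x. h n x * (1 - d x))" by (intro add continuous_intros D d)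
    finally show "ennreal (L (\<lambda>x. h n x * d x)) + ennreal (L (\<lambda>x. h n x * (1 - d x))) = ennreal (L (h n))"
      using D d by (subst ennreal_plus[symmetric]) (auto intro!: pos continuous_intros)
  qed
  finally show "outer {x\<in>T. d x = 1} + outer {x\<in>T. d x = 0} \<le> (\<Sum>n. ennreal (L (h n)))" .
qed

text \<open>Caratheodory's criterion for an open set. The part of \<open>U\<close> where a cutoff
  equals 1 is separated from the complement by that cutoff; the remaining layer near the boundary
  has small outer measure, because the values of \<open>L\<close> on the increasing cutoffs
  converge.\<close>

lemma open_in_lambda_system:
  assumes U: "open U"
  shows "U \<inter> K \<in> lambda_system K (Pow K) outer"
proof -
  define d where "d x = infdist x (- U)" for x
  have "outer (U \<inter> T) + outer (T - U) \<le> outer T" if T: "T \<subseteq> K" for T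
  proof (cases "U = UNIV")
    \<comment> \<open>The distance to the empty set is 0 by convention, so the whole space is
      treated apart.\<close>
    case True then show ?thesis by (simp add: outer_empty)
  next
    case False
    have d: "d x > 0 \<longleftrightarrow> x \<in> U" "d x \<ge> 0" for x
      using in_closed_iff_infdist_zero[of "- U" x] infdist_nonneg[of x "- U"] U False
      by (auto simp: d_def closed_def less_le)
    have dz: "x \<notin> U \<Longrightarrow> d x = 0" for x using d[of x] by (simp add: less_le)
    define \<psi> where "\<psi> k x = min 1 (real k * d x)" for k :: nat and x
    have \<psi>c: "continuous_on K (\<psi> k)" for k unfolding \<psi>_def d_def by (intro continuous_intros)
    have \<psi>b: "0 \<le> \<psi> k x" "\<psi> k x \<le> 1" for k x using d(2)[of x] by (auto simp: \<psi>_def)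
    have \<psi>m: "\<psi> k x \<le> \<psi> (Suc k) x" for k x using d(2)[of x] by (auto simp: \<psi>_def min_def algebra_simps)
    have "incseq (\<lambda>k. L (\<psi> k))" by (intro incseq_SucI mono \<psi>c \<psi>m)
    moreover have "L (\<psi> k) \<le> 1" for k using mono[OF \<psi>c[of k] continuous_on_const[of K 1]] \<psi>b one by simp
    ultimately obtain l where l: "(\<lambda>k. L (\<psi> k)) \<longlonglongrightarrow> l" using incseq_convergent[of "\<lambda>k. L (\<psi> k)" 1] by blast
    have V: "outer {x\<in>K. x \<in> U \<and> 2 * real k * d x < 1} \<le> ennreal (2 * (l - L (\<psi> k)))" for k
    proof -
      \<comment> \<open>A telescoping series with sum 2 (1 - \<open>\<psi> k x\<close>). In the
        layer \<open>\<psi> k\<close> is below 1/2, so the factor 2 makes the sum at least 1, while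
        the cost telescopes to 2 (l - L(\<open>\<psi> k\<close>)).\<close>
      define h where "h n x = 2 * (\<psi> (Suc (k + n)) x - \<psi> (k + n) x)" for n x
      have "h \<in> covers {x\<in>K. x \<in> U \<and> 2 * real k * d x < 1}"
        unfolding covers_def
      proof (intro CollectI conjI allI ballI)
        show "continuous_on K (h n)" for n unfolding h_def by (intro continuous_intros \<psi>c)
        show "0 \<le> h n x" for n x using \<psi>m[of "k + n" x] by (simp add: h_def)
        fix x assume x: "x \<in> {x\<in>K. x \<in> U \<and> 2 * real k * d x < 1}"
        then have dx: "d x > 0" using d by blast
        have "(\<lambda>n. \<psi> (k + n) x) \<longlonglongrightarrow> 1"
        proof (rule tendsto_eventually)
          obtain N where N: "1 < real N * d x" using dx reals_Archimedean3 by blast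
          have "\<psi> (k + n) x = 1" if "n \<ge> N" for n
          proof -
            have "real N * d x \<le> real (k + n) * d x" using that dx by (intro mult_right_mono) auto
            then show ?thesis using N by (simp add: \<psi>_def)
          qed
          then show "\<forall>\<^sub>F n in sequentially. \<psi> (k + n) x = 1" by (auto simp: eventually_sequentially)
        qed
        from sums_mult[OF telescope_sums[OF this], of 2] have "(\<lambda>n. h n x) sums (2 * (1 - \<psi> k x))"
          by (simp add: h_def)
        then have "(\<Sum>n. ennreal (h n x)) = ennreal (2 * (1 - \<psi> k x))"
          using \<psi>m by (intro suminf_ennreal_eq) (auto simp: h_def)
        moreover have "2 * (1 - \<psi> k x) \<ge> 1" using x by (auto simp: \<psi>_def min_def)
        ultimately show "1 \<le> (\<Sum>n. ennreal (h n x))" by (simp add: ennreal_leI flip: ennreal_1)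
      qed
      then have "outer {x\<in>K. x \<in> U \<and> 2 * real k * d x < 1} \<le> (\<Sum>n. ennreal (L (h n)))" by (rule outer_le)
      also have "L (h n) = 2 * (L (\<psi> (Suc (k + n))) - L (\<psi> (k + n)))" for n
        unfolding h_def using \<psi>c by (simp add: cmult diff continuous_intros)
      then have "(\<Sum>n. ennreal (L (h n))) = ennreal (2 * (l - L (\<psi> k)))"
      proof (intro suminf_ennreal_eq)
        assume *: "\<And>n. L (h n) = 2 * (L (\<psi> (Suc (k + n))) - L (\<psi> (k + n)))"
        show "0 \<le> L (h n)" for n unfolding * using mono[OF \<psi>c \<psi>c \<psi>m] by simp
        have "(\<lambda>n. L (\<psi> (k + n))) \<longlonglongrightarrow> l" using LIMSEQ_ignore_initial_segment[OF l, of k] by (simp add: add.commute)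
        from sums_mult[OF telescope_sums[OF this], of 2] show "(\<lambda>n. L (h n)) sums (2 * (l - L (\<psi> k)))" 
          unfolding * by simp
      qed
      finally show ?thesis .
    qed
    show ?thesis
    proof (rule ennreal_le_epsilon)
      fix e :: real assume e: "e > 0"
      then have "\<forall>\<^sub>F k in sequentially. dist (L (\<psi> k)) l < e / 2" using tendstoD[OF l, of "e / 2"] by simp
      then obtain k where k: "dist (L (\<psi> k)) l < e / 2" unfolding eventually_sequentially by blast
      have "2 * (l - L (\<psi> k)) \<le> e" using k unfolding dist_real_def abs_less_iff by simp
      with V[of k] have Ve: "outer {x\<in>K. x \<in> U \<and> 2 * real k * d x < 1} \<le> ennreal e"
        by (meson ennreal_leI order_trans)
      have "U \<inter> T \<subseteq> {x\<in>T. \<psi> (2 * k) x = 1} \<union> {x\<in>K. x \<in> U \<and> 2 * real k * d x < 1}"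
        using T by (auto simp: \<psi>_def)
      then have "outer (U \<inter> T) \<le> outer {x\<in>T. \<psi> (2 * k) x = 1} + ennreal e"
        using outer_mono outer_Un Ve by (meson add_left_mono order_trans)
      moreover have "outer (T - U) \<le> outer {x\<in>T. \<psi> (2 * k) x = 0}"
        using dz by (intro outer_mono) (auto simp: \<psi>_def)
      ultimately have "outer (U \<inter> T) + outer (T - U) 
          \<le> (outer {x\<in>T. \<psi> (2 * k) x = 1} + ennreal e) + outer {x\<in>T. \<psi> (2 * k) x = 0}"
        by (rule add_mono)
      also have "\<dots> = (outer {x\<in>T. \<psi> (2 * k) x = 1} + outer {x\<in>T. \<psi> (2 * k) x = 0}) + ennreal e" 
        by (simp add: ac_simps)
      also have "\<dots> \<le> outer T + ennreal e"
        by (intro add_right_mono outer_split_separated \<psi>c T) (simp add: \<psi>b)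
      finally show "outer (U \<inter> T) + outer (T - U) \<le> outer T + ennreal e" .
    qed
  qed
  moreover have "outer T \<le> outer (U \<inter> T) + outer (T - U)" for T
    using outer_Un[of "U \<inter> T" "T - U"] by (simp add: Int_commute Int_Diff_Un)
  moreover have "U \<inter> K \<inter> T = U \<inter> T" "(K - U \<inter> K) \<inter> T = T - U" if "T \<subseteq> K" for T using that by auto
  ultimately show ?thesis unfolding lambda_system_def by (auto intro!: antisym)
qed

text \<open>Caratheodory's construction provides the measure. To compare integrals with
  \<open>L\<close>, a function with values in [0,1] is cut horizontally into N slices of height 1/N.
  The integral of a slice and its value under \<open>L\<close> obey the same bounds in terms of the
  measures of consecutive superlevel sets, and these bounds telescope to a total error of at most
  1/N.\<close>

lemma representation:
  obtains m where "prob_space m" "sets m = sets (restrict_space borel K)"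
    "\<And>f. continuous_on K f \<Longrightarrow> integral\<^sup>L m f = L f"
proof -
  define lam where "lam = lambda_system K (Pow K) outer"
  interpret S: sigma_algebra K "Pow K" by (rule sigma_algebra_Pow)
  have ms: "measure_space K lam outer"
    unfolding lam_def by (rule S.caratheodory_lemma[OF outer_measure_space_outer])
  then interpret lam: sigma_algebra K lam by (simp add: measure_space_def)
  have bor: "sets (restrict_space borel K) \<subseteq> lam"
  proof
    fix A assume "A \<in> sets (restrict_space borel K)"
    then obtain B where B: "B \<in> sets borel" "A = K \<inter> B" by (auto simp: sets_restrict_space)
    define M where "M = sigma K lam"
    have sM: "sets M = lam" "space M = K" unfolding M_def using lam.space_closed by (auto simp: lam.sigma_sets_eq)
    have "(\<lambda>x. x) \<in> borel_measurable M"
    proof (rule borel_measurableI)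
      fix U :: "'a set" assume "open U"
      from open_in_lambda_system[OF this] show "(\<lambda>x. x) -` U \<inter> space M \<in> sets M" by (simp add: sM lam_def)
    qed
    from measurable_sets[OF this B(1)] show "A \<in> lam" using B(2) by (simp add: sM Int_commute)
  qed
  define \<A> where "\<A> = sets (restrict_space borel K)"
  have sa: "sigma_algebra K \<A>"
    using sets.sigma_algebra_axioms[of "restrict_space borel K"] by (simp add: \<A>_def space_restrict_space)
  have "measure_space K \<A> outer"
    by (rule measure_down[OF ms sa]) (use bor in \<open>simp add: \<A>_def\<close>)
  define m where "m = measure_of K \<A> outer"
  interpret A: sigma_algebra K \<A> by (rule sa)
  have sm: "sets m = \<A>" "space m = K" unfolding m_def using A.space_closed by (auto simp: A.sigma_sets_eq)
  have em: "emeasure m X = outer X" if "X \<in> \<A>" for X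
    unfolding m_def using emeasure_measure_of_sigma[OF sa _ _ that] \<open>measure_space K \<A> outer\<close>
    by (simp add: measure_space_def)
  have oK: "outer K = 1"
    using outer_le_1[of K] functional_le_outer[of "\<lambda>x. 1" K] one by (auto intro: antisym)
  have prob: "prob_space m"
    by (rule prob_spaceI) (use em[OF A.top] sm oK in simp)
  then interpret prob_space m .
  have meas: "f \<in> borel_measurable m" if "continuous_on K f" for f :: "'a \<Rightarrow> real"
    using borel_measurable_continuous_on_restrict[OF that] measurable_cong_sets[OF sm(1)[unfolded \<A>_def] refl] by blast
  have bnd: "\<exists>B>0. \<forall>x\<in>K. \<bar>f x\<bar> \<le> B" if "continuous_on K f" for f :: "'a \<Rightarrow> real"
    using compact_imp_bounded[OF compact_continuous_image[OF that compact_K]] unfolding bounded_pos by auto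
  have int: "integrable m f" if f: "continuous_on K f" for f :: "'a \<Rightarrow> real"
  proof -
    obtain B where "\<forall>x\<in>K. \<bar>f x\<bar> \<le> B" using bnd[OF f] by blast
    then show ?thesis by (intro integrable_const_bound[where B = B] meas f AE_I2) (simp add: sm)
  qed
  have unit: "integral\<^sup>L m f = L f" if f: "continuous_on K f" and f01: "\<And>x. x \<in> K \<Longrightarrow> 0 \<le> f x \<and> f x \<le> 1" for f
  proof -
    have "\<bar>integral\<^sup>L m f - L f\<bar> \<le> 1 / real N" if N: "N > 0" for N :: nat
    proof -
      define E where "E k = {x\<in>K. real k / N < f x}" for k
      have Em: "E k \<in> \<A>" for k
      proof -
        have "f -` {real k / N <..} \<inter> space m \<in> sets m" by (rule measurable_sets[OF meas[OF f]]) simp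
        moreover have "f -` {real k / N <..} \<inter> space m = E k" by (auto simp: E_def sm)
        ultimately show ?thesis by (simp add: sm)
      qed
      define P where "P k = measure m (E k)" for k
      have P: "outer (E k) = ennreal (P k)" for k using em[OF Em] emeasure_eq_measure by (simp add: P_def)
      have P01: "0 \<le> P k" "P k \<le> 1" for k by (auto simp: P_def)
      \<comment> \<open>The part of \<open>f\<close> between the heights k/N and (k+1)/N. It
        vanishes off \<open>E k\<close> and is full on \<open>E (Suc k)\<close>.\<close>
      define s where "s k x = max 0 (min (1 / N) (f x - real k / N))" for k x
      have sc: "continuous_on K (s k)" for k unfolding s_def by (intro continuous_intros f)
      have lo: "indicator (E (Suc k)) x / N \<le> s k x" and up: "s k x \<le> indicator (E k) x / N" if "x \<in> K" for k x
        using N that by (auto simp: s_def E_def indicator_def add_divide_distrib)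
      have sumsl: "(\<Sum>k<n. s k x) = min (real n / N) (f x)" if x: "x \<in> K" for n x
      proof (induction n)
        case 0 then show ?case using f01[OF x] by simp
      next
        case (Suc n)
        have *: "min a y + max 0 (min b (y - a)) = min (b + a) y" if "b \<ge> 0" for a b y :: real
          using that by (auto simp: min_def max_def)
        show ?case using Suc *[of "1 / N" "n / N" "f x"] by (simp add: s_def add_divide_distrib)
      qed
      have fs: "f x = (\<Sum>k<N. s k x)" if x: "x \<in> K" for x
        unfolding sumsl[OF x] using f01[OF x] N by simp
      have Lf: "L f = (\<Sum>k<N. L (s k))"
      proof -
        have "L f = L (\<lambda>x. \<Sum>k<N. s k x)" using fs by (intro cong f continuous_intros sc) auto
        also have "\<dots> = (\<Sum>k<N. L (s k))" by (intro sum sc) auto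
        finally show ?thesis .
      qed
      have If: "integral\<^sup>L m f = (\<Sum>k<N. integral\<^sup>L m (s k))"
      proof -
        have "integral\<^sup>L m f = integral\<^sup>L m (\<lambda>x. \<Sum>k<N. s k x)"
          by (rule Bochner_Integration.integral_cong[OF refl]) (simp add: sm fs)
        also have "\<dots> = (\<Sum>k<N. integral\<^sup>L m (s k))" by (intro Bochner_Integration.integral_sum int sc)
        finally show ?thesis .
      qed
      have Nc: "N * L (s k) = L (\<lambda>x. N * s k x)" for k using cmult[OF sc] by simp
      have L1: "L (s k) \<le> P k / N" for k
      proof -
        have "ennreal (L (\<lambda>x. N * s k x)) \<le> outer (E k)"
        proof (intro functional_le_outer continuous_intros sc)
          fix x assume "x \<in> K"
          then show "N * s k x \<le> (if x \<in> E k then 1 else 0)"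
            using up[of x k] N by (cases "x \<in> E k") (simp_all add: field_simps mult_nonneg_nonpos)
        qed
        then have "N * L (s k) \<le> P k" using P01 by (simp add: P Nc[symmetric])
        then show ?thesis using N by (simp add: field_simps)
      qed
      have L2: "P (Suc k) / N \<le> L (s k)" for k
      proof -
        have "outer (E (Suc k)) \<le> ennreal (L (\<lambda>x. N * s k x))"
        proof (rule outer_le_single)
          show "continuous_on K (\<lambda>x. N * s k x)" by (intro continuous_intros sc)
          show "0 \<le> N * s k x" for x by (simp add: s_def)
          show "1 \<le> N * s k x" if "x \<in> E (Suc k)" for x
          proof -
            have "x \<in> K" using that by (simp add: E_def)
            then show ?thesis using lo[of x k] that N by (simp add: field_simps)
          qed
        qed
        moreover have "0 \<le> L (\<lambda>x. N * s k x)" by (intro pos continuous_intros sc) (simp add: s_def)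
        ultimately have "P (Suc k) \<le> N * L (s k)" by (simp add: P Nc)
        then show ?thesis using N by (simp add: field_simps)
      qed
      have iE: "integral\<^sup>L m (\<lambda>x. indicator (E k) x / N) = P k / N" and "integrable m (\<lambda>x. indicator (E k) x / real N)" for k
        using Em[of k] sm by (auto simp: P_def less_top[symmetric])
      note iE' = this(2)
      have I1: "integral\<^sup>L m (s k) \<le> P k / N" for k
        unfolding iE[symmetric] by (intro integral_mono int sc iE' up) (simp add: sm)
      have I2: "P (Suc k) / N \<le> integral\<^sup>L m (s k)" for k
        unfolding iE[symmetric] by (intro integral_mono int sc iE' lo) (simp add: sm)
      have "\<bar>integral\<^sup>L m f - L f\<bar> = \<bar>\<Sum>k<N. integral\<^sup>L m (s k) - L (s k)\<bar>" by (simp add: Lf If sum_subtractf)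
      also have "\<dots> \<le> (\<Sum>k<N. P k / N - P (Suc k) / N)"
        by (rule order_trans[OF sum_abs]) (intro sum_mono, use I1 I2 L1 L2 in \<open>smt (verit)\<close>)
      also have "\<dots> = P 0 / N - P N / N" using sum_lessThan_telescope'[of "\<lambda>k. P k / N" N] by simp
      also have "\<dots> \<le> 1 / N" using P01[of 0] P01[of N] N by (simp add: diff_divide_distrib[symmetric] divide_right_mono)
      finally show ?thesis .
    qed
    then have "\<bar>integral\<^sup>L m f - L f\<bar> \<le> inverse (real (Suc n))" for n by (simp add: inverse_eq_divide del: of_nat_Suc)
    then have "\<bar>integral\<^sup>L m f - L f\<bar> \<le> 0" 
      by (intro LIMSEQ_le_const[OF LIMSEQ_inverse_real_of_nat]) auto
    then show ?thesis by simp
  qed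
  have "integral\<^sup>L m f = L f" if f: "continuous_on K f" for f
  proof -
    obtain B where B: "B > 0" "\<And>x. x \<in> K \<Longrightarrow> \<bar>f x\<bar> \<le> B" using bnd[OF f] by blast
    define g where "g x = (1 / (2 * B)) * (f x + B)" for x
    have g: "continuous_on K g" unfolding g_def by (intro continuous_intros f)
    have g01: "0 \<le> g x \<and> g x \<le> 1" if "x \<in> K" for x
      using B(1) B(2)[OF that] by (auto simp: g_def field_simps abs_le_iff)
    have "L g = (1 / (2 * B)) * (L f + B)"
      unfolding g_def using cmult[of "\<lambda>x. f x + B" "1 / (2 * B)"] add[OF f continuous_on_const[of K B]] const[of B] f
      by (simp add: continuous_intros)
    moreover have "integral\<^sup>L m g = (1 / (2 * B)) * (integral\<^sup>L m f + B)"
      unfolding g_def using int[OF f] prob_space by simp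
    ultimately show ?thesis using unit[OF g g01] B by simp
  qed
  with prob sm(1) show thesis using that unfolding \<A>_def by blast
qed

end

section \<open>The critical value as a convex function\<close>

lemma vsub_add_const:
  assumes "vsub \<epsilon> N g S w" shows "vsub \<epsilon> N g S (\<lambda>x. w x + c)"
  using assms unfolding vsub_def by simp

definition levels :: "real \<Rightarrow> real \<Rightarrow> 'a::euclidean_space set \<Rightarrow> ('a \<Rightarrow> real) \<Rightarrow> real set" where
  "levels \<epsilon> p S g = {c. \<exists>u. continuous_on S u \<and> vsub \<epsilon> (\<lambda>\<xi>. norm \<xi> powr p) (\<lambda>x. g x + c) S u}"

definition crit :: "real \<Rightarrow> real \<Rightarrow> 'a::euclidean_space set \<Rightarrow> ('a \<Rightarrow> real) \<Rightarrow> real" where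
  "crit \<epsilon> p S g = Inf (levels \<epsilon> p S g)"

lemma levels_mono:
  assumes "c \<in> levels \<epsilon> p S g" "\<And>x. x \<in> S \<Longrightarrow> g x + c \<le> g' x + c'"
  shows "c' \<in> levels \<epsilon> p S g'"
  using assms unfolding levels_def by (auto intro: vsub_mono)

text \<open>The zero function is a subsolution: a test function above which it has a local maximum
  has a local minimum there, hence zero gradient and nonnegative Laplacian.\<close>

lemma levels_ge:
  assumes \<epsilon>: "\<epsilon> > 0" and g: "\<And>x. x \<in> S \<Longrightarrow> 0 \<le> g x + c"
  shows "c \<in> levels \<epsilon> p S g"
proof -
  have "vsub \<epsilon> (\<lambda>\<xi>. norm \<xi> powr p) (\<lambda>x. g x + c) S (\<lambda>x. 0)"
    unfolding vsub_def
  proof (intro ballI allI impI)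
    fix x \<phi> assume x: "x \<in> S" and \<phi>: "Ck_on 2 \<phi> UNIV" and m: "\<forall>\<^sub>F y in nhds x. 0 - \<phi> y \<le> 0 - \<phi> x"
    obtain k H where C: "C2w \<phi> k H" using Ck_C2w[OF \<phi>] by metis
    obtain r where r: "r > 0" "\<And>y. dist y x < r \<Longrightarrow> \<phi> x \<le> \<phi> y"
      using m unfolding eventually_nhds_metric by auto
    have "(\<lambda>h. k x \<bullet> h) = (\<lambda>h. 0)"
      by (rule differential_zero_maxmin[OF _ open_ball[of x r] C2wD(1)[OF C]]) (use r in \<open>auto simp: dist_commute\<close>)
    then have "k x \<bullet> k x = 0" by metis
    then have "grad \<phi> x = 0" using C2w_grad[OF C] by simp
    note a = grad_laplacian_cmult[OF \<phi>, of "-1"]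
    have "laplacian (\<lambda>y. - 1 * \<phi> y) x \<le> 0"
      by (rule laplacian_nonpos_local_max[OF a(1)]) (use m in simp)
    then have "0 \<le> laplacian \<phi> x" unfolding a(3) by simp
    then have "0 \<le> \<epsilon> * laplacian \<phi> x" using \<epsilon> by simp
    with \<open>grad \<phi> x = 0\<close> g[OF x] show "norm (grad \<phi> x) powr p - \<epsilon> * laplacian \<phi> x \<le> g x + c" by simp
  qed
  then show ?thesis unfolding levels_def by (intro CollectI exI[of _ "\<lambda>x. 0"]) auto
qed

lemma levels_scale:
  fixes S :: "'a::euclidean_space set"
  assumes p: "p > 1" and s: "s > 0"
  defines "q \<equiv> p / (p - 1)"
  shows "c \<in> levels \<epsilon> p ((\<lambda>x. s *\<^sub>R x) ` S) f \<longleftrightarrow> s powr q * c \<in> levels \<epsilon> p S (\<lambda>x. s powr q * f (s *\<^sub>R x))"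
proof
  have scale: "t powr q * c \<in> levels \<epsilon> p {x. t *\<^sub>R x \<in> T} (\<lambda>x. t powr q * f (t *\<^sub>R x))"
    if t: "t > 0" and c: "c \<in> levels \<epsilon> p T f" for t c T and f :: "'a \<Rightarrow> real"
  proof -
    obtain u where u: "continuous_on T u" "vsub \<epsilon> (\<lambda>\<xi>. norm \<xi> powr p) (\<lambda>x. f x + c) T u"
      using c unfolding levels_def by auto
    have "continuous_on {x. t *\<^sub>R x \<in> T} (\<lambda>x. t powr (q - 2) * u (t *\<^sub>R x))"
      by (intro continuous_intros continuous_on_compose2[OF u(1)]) auto
    moreover have "vsub \<epsilon> (\<lambda>\<xi>. norm \<xi> powr p) (\<lambda>x. t powr q * f (t *\<^sub>R x) + t powr q * c) {x. t *\<^sub>R x \<in> T} (\<lambda>x. t powr (q - 2) * u (t *\<^sub>R x))"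
      using vsub_scale[OF p t u(2)] by (simp add: q_def distrib_left)
    ultimately show ?thesis unfolding levels_def by blast
  qed
  have im: "{x. s *\<^sub>R x \<in> (\<lambda>x. s *\<^sub>R x) ` S} = S" using s by auto
  show "s powr q * c \<in> levels \<epsilon> p S (\<lambda>x. s powr q * f (s *\<^sub>R x))" if "c \<in> levels \<epsilon> p ((\<lambda>x. s *\<^sub>R x) ` S) f"
    using scale[OF s that] unfolding im .
  assume "s powr q * c \<in> levels \<epsilon> p S (\<lambda>x. s powr q * f (s *\<^sub>R x))"
  from scale[OF _ this, of "1 / s"] s
  have "(1 / s) powr q * (s powr q * c) \<in> levels \<epsilon> p {x. (1 / s) *\<^sub>R x \<in> S} (\<lambda>x. (1 / s) powr q * (s powr q * f (s *\<^sub>R (1 / s) *\<^sub>R x)))"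
    by simp
  moreover have "(1 / s) powr q * (s powr q * y) = y" for y
    using s powr_mult[of "1 / s" s q] by (simp flip: mult.assoc)
  moreover have "{x. (1 / s) *\<^sub>R x \<in> S} = (\<lambda>x. s *\<^sub>R x) ` S"
  proof -
    have "x \<in> (\<lambda>x. s *\<^sub>R x) ` S" if "(1 / s) *\<^sub>R x \<in> S" for x
      using that s by (intro image_eqI[of _ _ "(1 / s) *\<^sub>R x"]) auto
    then show ?thesis using s by auto
  qed
  moreover have "s *\<^sub>R (1 / s) *\<^sub>R x = x" for x :: 'a using s by simp
  ultimately show "c \<in> levels \<epsilon> p ((\<lambda>x. s *\<^sub>R x) ` S) f" by simp
qed

locale viscous_domain =
  fixes \<epsilon> p :: real and \<Omega> :: "'a::euclidean_space set"
  assumes eps: "\<epsilon> > 0" and p2: "p > 2" and op: "open \<Omega>" and con: "connected \<Omega>" and ne: "\<Omega> \<noteq> {}"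
begin

definition admissible :: "('a \<Rightarrow> real) \<Rightarrow> bool" where
  "admissible g \<longleftrightarrow> continuous_on \<Omega> g \<and> (\<exists>B. \<forall>x\<in>\<Omega>. \<bar>g x\<bar> \<le> B)"

text \<open>For nonpositive \<open>c\<close> the right-hand sides are bounded above, so all
  subsolutions share an oscillation bound on one ball. A steep paraboloid then touches each of them
  inside that ball, and the inequality at the contact point bounds \<open>c\<close> from
  below.\<close>

lemma levels_bdd_below:
  assumes "admissible g" shows "bdd_below (levels \<epsilon> p \<Omega> g)"
proof -
  obtain B where B: "\<And>x. x \<in> \<Omega> \<Longrightarrow> \<bar>g x\<bar> \<le> B" using assms by (auto simp: admissible_def)
  obtain x0 where x0: "x0 \<in> \<Omega>" using ne by blast
  from vsub_equicontinuous[OF p2 eps op x0 zero_less_one, of B]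
  obtain d where d: "d > 0" "ball x0 d \<subseteq> \<Omega>" and eq: "\<forall>u g. continuous_on \<Omega> u \<longrightarrow> (\<forall>y\<in>\<Omega>. g y \<le> B) \<longrightarrow>
    vsub \<epsilon> (\<lambda>\<xi>. norm \<xi> powr p) g \<Omega> u \<longrightarrow> (\<forall>y\<in>ball x0 d. \<bar>u y - u x0\<bar> \<le> 1)"
    by (elim exE conjE)
  define r where "r = d / 2"
  have r: "r > 0" "cball x0 r \<subseteq> ball x0 d" using d by (auto simp: r_def)
  \<comment> \<open>The paraboloid rises by 3 up to the sphere, more than the oscillation 1 of the
    subsolution.\<close>
  define k where "k = 3 / r\<^sup>2"
  have "- (\<epsilon> * (2 * k * DIM('a))) - B \<le> c" if c: "c \<in> levels \<epsilon> p \<Omega> g" "c \<le> 0" for c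
  proof -
    obtain u where u: "continuous_on \<Omega> u" "vsub \<epsilon> (\<lambda>\<xi>. norm \<xi> powr p) (\<lambda>x. g x + c) \<Omega> u"
      using c unfolding levels_def by auto
    have osc: "\<bar>u y - u x0\<bar> \<le> 1" if "y \<in> cball x0 r" for y
    proof (rule eq[rule_format, OF u(1) _ u(2)])
      show "g y + c \<le> B" if "y \<in> \<Omega>" for y using B[OF that] c(2) by (simp add: abs_le_iff)
      show "y \<in> ball x0 d" using that r by blast
    qed
    define v where "v = (\<lambda>y. u y - (0 + k * (norm (y - x0))\<^sup>2))"
    note t = perturbed_test[OF grad_laplacian_const(1)[of 0], of k x0]
    have "continuous_on (cball x0 r) v" unfolding v_def
      using r d by (intro continuous_intros continuous_on_subset[OF u(1)]) auto
    moreover have "x0 \<in> cball x0 r" using r by simp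
    moreover have "v y < v x0" if y: "y \<in> sphere x0 r" for y
    proof -
      have "k * (norm (y - x0))\<^sup>2 = 3" using y r by (simp add: k_def dist_norm norm_minus_commute)
      then show ?thesis using osc[of y] y by (simp add: v_def abs_le_iff)
    qed
    ultimately obtain y where y: "y \<in> ball x0 r" "\<forall>\<^sub>F z in nhds y. v z \<le> v y"
      using interior_max by metis
    have y\<Omega>: "y \<in> \<Omega>" using y(1) r(2) d(2) ball_subset_cball by blast
    from vsubD[OF u(2) y\<Omega> t(1) y(2)[unfolded v_def]]
    have "- (\<epsilon> * (2 * k * DIM('a))) \<le> g y + c"
      unfolding t(3) grad_laplacian_const(3) by (smt (verit) powr_ge_zero)
    then show ?thesis using B[OF y\<Omega>] by (simp add: abs_le_iff)
  qed
  then show ?thesis by (intro bdd_belowI[of _ "min 0 (- (\<epsilon> * (2 * k * DIM('a))) - B)"]) (meson min.coboundedI1 min.coboundedI2 linear)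
qed

lemma levels_nonempty:
  assumes "admissible g" shows "levels \<epsilon> p \<Omega> g \<noteq> {}"
proof -
  obtain B where B: "\<And>x. x \<in> \<Omega> \<Longrightarrow> \<bar>g x\<bar> \<le> B" using assms by (auto simp: admissible_def)
  have "B \<in> levels \<epsilon> p \<Omega> g" using B by (intro levels_ge eps) (force simp: abs_le_iff)
  then show ?thesis by blast
qed

lemma crit_le: "admissible g \<Longrightarrow> c \<in> levels \<epsilon> p \<Omega> g \<Longrightarrow> crit \<epsilon> p \<Omega> g \<le> c"
  unfolding crit_def by (rule cInf_lower[OF _ levels_bdd_below])

text \<open>The infimum is attained: normalised subsolutions are locally equicontinuous, and their upper
  limit is a subsolution.\<close>

lemma crit_in_levels:
  assumes g: "admissible g" shows "crit \<epsilon> p \<Omega> g \<in> levels \<epsilon> p \<Omega> g"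
proof -
  define c0 where "c0 = crit \<epsilon> p \<Omega> g"
  obtain B where B: "\<And>x. x \<in> \<Omega> \<Longrightarrow> \<bar>g x\<bar> \<le> B" using g by (auto simp: admissible_def)
  have gc: "continuous_on \<Omega> g" using g by (simp add: admissible_def)
  obtain x0 where x0: "x0 \<in> \<Omega>" using ne by blast
  have "\<exists>c\<in>levels \<epsilon> p \<Omega> g. c < c0 + inverse (real (Suc k))" for k
    using cInf_lessD[OF levels_nonempty[OF g], of "c0 + inverse (real (Suc k))"] unfolding c0_def crit_def by auto
  then obtain c where c: "\<And>k. c k \<in> levels \<epsilon> p \<Omega> g" "\<And>k. c k < c0 + inverse (real (Suc k))" by metis
  have "\<forall>k. \<exists>u. continuous_on \<Omega> u \<and> vsub \<epsilon> (\<lambda>\<xi>. norm \<xi> powr p) (\<lambda>x. g x + c k) \<Omega> u"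
    using c(1) unfolding levels_def by blast
  then obtain w where w: "\<And>k. continuous_on \<Omega> (w k)" "\<And>k. vsub \<epsilon> (\<lambda>\<xi>. norm \<xi> powr p) (\<lambda>x. g x + c k) \<Omega> (w k)"
    by metis
  \<comment> \<open>Subsolutions are determined only up to constants. Fixing their values at
    \<open>x0\<close> allows oscillation bounds to yield bounds on the functions themselves.\<close>
  define u where "u k x = w k x + - w k x0" for k x
  have u: "continuous_on \<Omega> (u k)" "vsub \<epsilon> (\<lambda>\<xi>. norm \<xi> powr p) (\<lambda>x. g x + c k) \<Omega> (u k)" "u k x0 = 0" for k
  proof -
    show "continuous_on \<Omega> (u k)" unfolding u_def[abs_def] by (intro continuous_intros w)
    show "vsub \<epsilon> (\<lambda>\<xi>. norm \<xi> powr p) (\<lambda>x. g x + c k) \<Omega> (u k)"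
      unfolding u_def[abs_def] by (rule vsub_add_const[OF w(2)])
    show "u k x0 = 0" by (simp add: u_def)
  qed
  have gc1: "\<forall>y\<in>\<Omega>. g y + c k \<le> B + c0 + 1" for k
  proof
    fix y assume "y \<in> \<Omega>"
    have "inverse (real (Suc k)) \<le> 1" by (simp add: inverse_eq_divide)
    with B[OF \<open>y \<in> \<Omega>\<close>] c(2)[of k] show "g y + c k \<le> B + c0 + 1" by (simp add: abs_le_iff)
  qed
  have eq: "\<exists>d>0. ball x d \<subseteq> \<Omega> \<and> (\<forall>k. \<forall>y\<in>ball x d. \<bar>u k y - u k x\<bar> \<le> e)" if "x \<in> \<Omega>" "e > 0" for x e
    using vsub_equicontinuous[OF p2 eps op that, of "B + c0 + 1"]
  proof (elim exE conjE)
    fix d assume d: "d > 0" "ball x d \<subseteq> \<Omega>" and h: "\<forall>u g. continuous_on \<Omega> u \<longrightarrow> (\<forall>y\<in>\<Omega>. g y \<le> B + c0 + 1) \<longrightarrow>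
      vsub \<epsilon> (\<lambda>\<xi>. norm \<xi> powr p) g \<Omega> u \<longrightarrow> (\<forall>y\<in>ball x d. \<bar>u y - u x\<bar> \<le> e)"
    have "\<forall>y\<in>ball x d. \<bar>u k y - u k x\<bar> \<le> e" for k
      using h[THEN spec[of _ "u k"], THEN spec[of _ "\<lambda>x. g x + c k"]] u gc1 by blast
    with d show ?thesis by blast
  qed
  \<comment> \<open>Boundedness at one point spreads over a ball by equicontinuity, and from
    \<open>x0\<close> to all of \<open>\<Omega>\<close> by connectedness.\<close>
  have bdd: "\<exists>M. \<forall>k. \<bar>u k x\<bar> \<le> M" if "x \<in> \<Omega>" for x
  proof (rule connected_induction_simple[OF con, where P = "\<lambda>x. \<exists>M. \<forall>k. \<bar>u k x\<bar> \<le> M"])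
    show "\<exists>M. \<forall>k. \<bar>u k x0\<bar> \<le> M" using u(3) by (auto intro: exI[of _ 0])
    fix a assume a: "a \<in> \<Omega>"
    obtain d where d: "d > 0" "ball a d \<subseteq> \<Omega>" "\<And>k y. y \<in> ball a d \<Longrightarrow> \<bar>u k y - u k a\<bar> \<le> 1"
      using eq[OF a, of 1] by auto
    have "openin (top_of_set \<Omega>) (ball a d)" using d(2) by (simp add: open_openin_trans op)
    moreover have "\<exists>M. \<forall>k. \<bar>u k z\<bar> \<le> M" if yz: "y \<in> ball a d" "z \<in> ball a d" and y: "\<exists>M. \<forall>k. \<bar>u k y\<bar> \<le> M" for y z
    proof -
      obtain M where M: "\<And>k. \<bar>u k y\<bar> \<le> M" using y by blast
      have "\<bar>u k z\<bar> \<le> M + 2" for k using M[of k] d(3)[OF yz(1), of k] d(3)[OF yz(2), of k] by linarith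
      then show ?thesis by blast
    qed
    ultimately show "\<exists>T. openin (top_of_set \<Omega>) T \<and> a \<in> T \<and> (\<forall>x\<in>T. \<forall>y\<in>T. (\<exists>M. \<forall>k. \<bar>u k x\<bar> \<le> M) \<longrightarrow> (\<exists>M. \<forall>k. \<bar>u k y\<bar> \<le> M))"
      using d(1) by (intro exI[of _ "ball a d"] conjI ballI impI) (assumption | simp)+
  qed (use x0 that in auto)
  have "\<forall>x\<in>\<Omega>. \<exists>l. (\<forall>e>0. \<forall>\<^sub>F k in sequentially. u k x < l + e) \<and> (\<forall>e>0. \<exists>\<^sub>F k in sequentially. l - e < u k x)"
    using bdd bounded_limsup by meson
  then obtain U where U: "\<And>x e. x \<in> \<Omega> \<Longrightarrow> e > 0 \<Longrightarrow> \<forall>\<^sub>F k in sequentially. u k x < U x + e"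
    "\<And>x e. x \<in> \<Omega> \<Longrightarrow> e > 0 \<Longrightarrow> \<exists>\<^sub>F k in sequentially. U x - e < u k x"
    by metis
  have cN: "continuous_on UNIV (\<lambda>\<xi>::'a. norm \<xi> powr p)" using p2 by (intro continuous_on_norm_powr) simp
  have cl: "\<forall>\<^sub>F k in sequentially. c k \<le> c0 + e" if "e > 0" for e
  proof -
    have "\<forall>\<^sub>F k in sequentially. inverse (real (Suc k)) < e"
      using order_tendstoD(2)[OF LIMSEQ_inverse_real_of_nat that] .
    then show ?thesis by eventually_elim (use c(2) in \<open>smt (verit)\<close>)
  qed
  note V = vsub_limsup[OF op gc cN u(2) cl eq U]
  have "continuous_on \<Omega> U" by (rule V(1))
  moreover have "vsub \<epsilon> (\<lambda>\<xi>. norm \<xi> powr p) (\<lambda>x. g x + c0) \<Omega> U" by (rule V(2))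
  ultimately show ?thesis unfolding levels_def c0_def by blast
qed

lemma crit_mono:
  assumes "admissible g" "admissible g'" "\<And>x. x \<in> \<Omega> \<Longrightarrow> g x \<le> g' x + \<eta>"
  shows "crit \<epsilon> p \<Omega> g' \<le> crit \<epsilon> p \<Omega> g + \<eta>"
  using assms(3) by (intro crit_le assms levels_mono[OF crit_in_levels[OF assms(1)]]) force

lemma crit_add_const:
  assumes "admissible g" shows "crit \<epsilon> p \<Omega> (\<lambda>x. g x + c) = crit \<epsilon> p \<Omega> g - c"
proof -
  obtain B where "\<And>x. x \<in> \<Omega> \<Longrightarrow> \<bar>g x\<bar> \<le> B" using assms by (auto simp: admissible_def)
  then have "\<bar>g x + c\<bar> \<le> B + \<bar>c\<bar>" if "x \<in> \<Omega>" for x using that by (smt (verit))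
  then have "admissible (\<lambda>x. g x + c)"
    using assms unfolding admissible_def by (auto intro!: continuous_intros exI[of _ "B + \<bar>c\<bar>"])
  with crit_mono[of g "\<lambda>x. g x + c" "-c"] crit_mono[of "\<lambda>x. g x + c" g c] assms show ?thesis by simp
qed

lemma crit_zero_le: "crit \<epsilon> p \<Omega> (\<lambda>x. 0) \<le> 0"
  by (intro crit_le levels_ge eps) (auto simp: admissible_def)

lemma crit_convex:
  assumes g: "admissible g1" "admissible g2" and t: "0 \<le> t" "t \<le> 1"
  shows "crit \<epsilon> p \<Omega> (\<lambda>x. t * g1 x + (1 - t) * g2 x) \<le> t * crit \<epsilon> p \<Omega> g1 + (1 - t) * crit \<epsilon> p \<Omega> g2"
proof -
  consider "t = 0" | "t = 1" | "0 < t" "t < 1" using t by linarith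
  then show ?thesis
  proof cases
    case 3
    define c1 where "c1 = crit \<epsilon> p \<Omega> g1"
    define c2 where "c2 = crit \<epsilon> p \<Omega> g2"
    have gc: "continuous_on \<Omega> g1" "continuous_on \<Omega> g2" using g by (auto simp: admissible_def)
    obtain u1 where u1: "continuous_on \<Omega> u1" "vsub \<epsilon> (\<lambda>\<xi>. norm \<xi> powr p) (\<lambda>x. g1 x + c1) \<Omega> u1"
      using crit_in_levels[OF g(1)] unfolding levels_def c1_def by auto
    obtain u2 where u2: "continuous_on \<Omega> u2" "vsub \<epsilon> (\<lambda>\<xi>. norm \<xi> powr p) (\<lambda>x. g2 x + c2) \<Omega> u2"
      using crit_in_levels[OF g(2)] unfolding levels_def c2_def by auto
    have "\<exists>v. \<forall>\<xi>. norm \<eta> powr p + v \<bullet> (\<xi> - \<eta>) \<le> norm \<xi> powr p" for \<eta> :: 'a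
      using norm_powr_tangent[of p \<eta>] p2 by (auto intro!: exI[of _ "(p * norm \<eta> powr (p - 2)) *\<^sub>R \<eta>"])
    from vsub_convex[OF op eps u1(1) u2(1) _ _ u1(2) u2(2) this 3]
    have "vsub \<epsilon> (\<lambda>\<xi>. norm \<xi> powr p) (\<lambda>x. t * (g1 x + c1) + (1 - t) * (g2 x + c2)) \<Omega> (\<lambda>x. t * u1 x + (1 - t) * u2 x)"
      using gc by (simp add: continuous_intros)
    moreover have "(\<lambda>x. t * (g1 x + c1) + (1 - t) * (g2 x + c2)) = (\<lambda>x. t * g1 x + (1 - t) * g2 x + (t * c1 + (1 - t) * c2))"
      by (auto simp: algebra_simps)
    ultimately have "t * c1 + (1 - t) * c2 \<in> levels \<epsilon> p \<Omega> (\<lambda>x. t * g1 x + (1 - t) * g2 x)"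
      unfolding levels_def using u1 u2 by (intro CollectI exI[of _ "\<lambda>x. t * u1 x + (1 - t) * u2 x"]) (auto intro!: continuous_intros)
    moreover have "admissible (\<lambda>x. t * g1 x + (1 - t) * g2 x)"
    proof -
      obtain B1 B2 where B: "\<And>x. x \<in> \<Omega> \<Longrightarrow> \<bar>g1 x\<bar> \<le> B1" "\<And>x. x \<in> \<Omega> \<Longrightarrow> \<bar>g2 x\<bar> \<le> B2"
        using g unfolding admissible_def by metis
      have "\<bar>t * g1 x + (1 - t) * g2 x\<bar> \<le> t * B1 + (1 - t) * B2" if "x \<in> \<Omega>" for x
      proof -
        have "\<bar>t * g1 x + (1 - t) * g2 x\<bar> \<le> \<bar>t * g1 x\<bar> + \<bar>(1 - t) * g2 x\<bar>" by (rule abs_triangle_ineq)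
        also have "\<dots> \<le> t * B1 + (1 - t) * B2" 
          unfolding abs_mult using t B[OF that] by (intro add_mono mult_mono) auto
        finally show ?thesis .
      qed
      then show ?thesis unfolding admissible_def using gc by (auto intro!: continuous_intros)
    qed
    ultimately show ?thesis using crit_le unfolding c1_def c2_def by blast
  qed auto
qed

end

text \<open>The difference quotients of a convex function increase with the step and are bounded
  below by J(0) - J(-h), so the one-sided derivative is their infimum. Its subadditivity is midpoint
  convexity at small steps.\<close>

lemma directional_derivative:
  fixes J :: "'v::real_vector \<Rightarrow> real"
  assumes conv: "\<And>x y t. 0 \<le> t \<Longrightarrow> t \<le> 1 \<Longrightarrow> J (t *\<^sub>R x + (1 - t) *\<^sub>R y) \<le> t * J x + (1 - t) * J y"
  shows "\<exists>P. sublinear P \<and> (\<forall>h. P h \<le> J h - J 0) \<and> (\<forall>h. ((\<lambda>t. (J (t *\<^sub>R h) - J 0) / t) \<longlongrightarrow> P h) (at_right 0))"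
proof -
  define sl where "sl h t = (J (t *\<^sub>R h) - J 0) / t" for h t
  define P where "P h = (INF t\<in>{0<..}. sl h t)" for h
  have mono: "sl h s \<le> sl h t" if "0 < s" "s \<le> t" for h s t
  proof -
    have "J ((s / t) *\<^sub>R (t *\<^sub>R h) + (1 - s / t) *\<^sub>R 0) \<le> (s / t) * J (t *\<^sub>R h) + (1 - s / t) * J 0"
      using that by (intro conv) auto
    then have "J (s *\<^sub>R h) - J 0 \<le> (s / t) * (J (t *\<^sub>R h) - J 0)" using that by (simp add: algebra_simps)
    then show ?thesis using that by (simp add: sl_def field_simps)
  qed
  have lb: "J 0 - J (- h) \<le> sl h t" if t: "t > 0" for h t
  proof -
    have "J ((1 / (1 + t)) *\<^sub>R (t *\<^sub>R h) + (1 - 1 / (1 + t)) *\<^sub>R (- h)) \<le> (1 / (1 + t)) * J (t *\<^sub>R h) + (1 - 1 / (1 + t)) * J (- h)"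
      using t by (intro conv) auto
    moreover have e: "1 - 1 / (1 + t) = t / (1 + t)" using t by (simp add: field_simps)
    ultimately have "J 0 \<le> (1 / (1 + t)) * J (t *\<^sub>R h) + (t / (1 + t)) * J (- h)" unfolding e by simp
    also have "\<dots> = (J (t *\<^sub>R h) + t * J (- h)) / (1 + t)" by (simp add: add_divide_distrib)
    finally have "J 0 * (1 + t) \<le> J (t *\<^sub>R h) + t * J (- h)" using t by (simp add: pos_le_divide_eq)
    then show ?thesis using t by (simp add: sl_def field_simps)
  qed
  have bdd: "bdd_below (sl h ` {0<..})" for h using lb by (intro bdd_belowI2) auto
  have le: "P h \<le> sl h t" if "t > 0" for h t unfolding P_def using that by (intro cINF_lower bdd) auto
  have ge: "c \<le> P h" if "\<And>t. t > 0 \<Longrightarrow> c \<le> sl h t" for c h unfolding P_def using that by (intro cINF_greatest) auto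
  have add: "P (x + y) \<le> P x + P y" for x y
  proof -
    have "P (x + y) - sl y t \<le> P x" if t: "t > 0" for t
    proof (rule ge)
      fix s :: real assume s: "s > 0"
      \<comment> \<open>A common step for both directions: each slope first decreases to the step
        2r, where the midpoint inequality compares them with the slope of the sum at r.\<close>
      define r where "r = min s t / 2"
      have r: "r > 0" "2 * r \<le> s" "2 * r \<le> t" using s t by (auto simp: r_def)
      have "J ((1 / 2) *\<^sub>R ((2 * r) *\<^sub>R x) + (1 - 1 / 2) *\<^sub>R ((2 * r) *\<^sub>R y)) \<le> (1 / 2) * J ((2 * r) *\<^sub>R x) + (1 - 1 / 2) * J ((2 * r) *\<^sub>R y)"
        by (intro conv) auto
      then have "J (r *\<^sub>R (x + y)) - J 0 \<le> (J ((2 * r) *\<^sub>R x) - J 0) / 2 + (J ((2 * r) *\<^sub>R y) - J 0) / 2"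
        by (simp add: scaleR_right_distrib field_simps)
      then have "(J (r *\<^sub>R (x + y)) - J 0) / r \<le> ((J ((2 * r) *\<^sub>R x) - J 0) / 2 + (J ((2 * r) *\<^sub>R y) - J 0) / 2) / r"
        using r(1) by (intro divide_right_mono) auto
      then have "sl (x + y) r \<le> sl x (2 * r) + sl y (2 * r)"
        by (simp add: sl_def add_divide_distrib)
      also have "\<dots> \<le> sl x s + sl y t" using r by (intro add_mono mono) auto
      finally show "P (x + y) - sl y t \<le> sl x s" using le[OF r(1), of "x + y"] by simp
    qed
    then have "P (x + y) - P x \<le> P y" by (intro ge) (smt (verit))
    then show ?thesis by simp
  qed
  have hom: "P (c *\<^sub>R x) = c * P x" if "c \<ge> 0" for c x
  proof (cases "c = 0")
    case True
    have "P 0 = 0" using le[of 1 0] ge[of 0 0] by (simp add: sl_def)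
    then show ?thesis using True by simp
  next
    case False
    then have c: "c > 0" using that by simp
    have sc: "sl (c *\<^sub>R x) t = c * sl x (c * t)" if "t > 0" for t using c that by (simp add: sl_def field_simps mult.commute)
    have "c * P x \<le> P (c *\<^sub>R x)"
    proof (rule ge)
      fix t :: real assume "t > 0"
      then show "c * P x \<le> sl (c *\<^sub>R x) t" using le[of "c * t" x] c by (simp add: sc)
    qed
    moreover have "P (c *\<^sub>R x) / c \<le> P x"
    proof (rule ge)
      fix t :: real assume t: "t > 0"
      then have "P (c *\<^sub>R x) \<le> sl (c *\<^sub>R x) (t / c)" using c by (intro le) auto
      also have "\<dots> = c * sl x t" using sc[of "t / c"] t c by simp
      finally show "P (c *\<^sub>R x) / c \<le> sl x t" using c by (simp add: field_simps)
    qed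
    ultimately show ?thesis using c by (simp add: field_simps)
  qed
  have lim: "((\<lambda>t. sl h t) \<longlongrightarrow> P h) (at_right 0)" for h
  proof (rule tendstoI)
    fix e :: real assume e: "e > 0"
    have "(INF t\<in>{0<..}. sl h t) < P h + e" using e by (simp add: P_def)
    then obtain t0 where t0: "t0 > 0" "sl h t0 < P h + e" 
      using cInf_lessD[of "sl h ` {0<..}" "P h + e"] by auto
    have "dist (sl h t) (P h) < e" if "0 < t" "t < t0" for t
      using le[OF that(1), of h] mono[of t t0 h] that t0 by (simp add: dist_real_def)
    then show "\<forall>\<^sub>F t in at_right 0. dist (sl h t) (P h) < e"
      using t0(1) unfolding eventually_at_right_field by blast
  qed
  have "P h \<le> J h - J 0" for h using le[of 1 h] by (simp add: sl_def)
  with add hom lim show ?thesis unfolding sublinear_def sl_def by blast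
qed

text \<open>Transfers C(K) to a real vector space type, the bounded continuous functions on the
  whole space, on which the Hahn-Banach lemma can be applied.\<close>

lemma bcontfun_extension:
  fixes f :: "'a::euclidean_space \<Rightarrow> real"
  assumes "compact K" "continuous_on K f"
  obtains b :: "'a \<Rightarrow>\<^sub>C real" where "\<And>x. x \<in> K \<Longrightarrow> apply_bcontfun b x = f x"
proof -
  obtain B where B: "B > 0" "\<And>x. x \<in> K \<Longrightarrow> norm (f x) \<le> B"
    using compact_imp_bounded[OF compact_continuous_image[OF assms(2,1)]] unfolding bounded_pos by auto
  have "closedin (top_of_set UNIV) K" using assms(1) compact_imp_closed by (simp add: closed_closedin[symmetric])
  then obtain g where g: "continuous_on UNIV g" "\<And>x. x \<in> K \<Longrightarrow> g x = f x" "\<And>x. x \<in> UNIV \<Longrightarrow> norm (g x) \<le> B"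
    using Tietze[OF assms(2), of UNIV B] B by (metis less_imp_le)
  have "g \<in> bcontfun" using g by (intro bcontfun_normI) auto
  then obtain b where "g = apply_bcontfun b" by (rule bcontfunE)
  with g(2) show thesis by (intro that[of b]) auto
qed

context viscous_domain
begin

lemma admissible_if_continuous_on_closure:
  assumes b: "bounded \<Omega>" and g: "continuous_on (closure \<Omega>) g" shows "admissible g"
proof -
  have "compact (closure \<Omega>)" using b by simp
  from compact_imp_bounded[OF compact_continuous_image[OF g this]]
  obtain B where "\<And>x. x \<in> closure \<Omega> \<Longrightarrow> \<bar>g x\<bar> \<le> B" unfolding bounded_pos by auto
  then show ?thesis unfolding admissible_def 
    using continuous_on_subset[OF g closure_subset] closure_subset by blast
qed

text \<open>The measures below are the opposites of the subgradients of the convex function \<open>crit\<close> at \<open>f\<close>.\<close>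

lemma crit_subgradient_measure:
  fixes f h :: "'a \<Rightarrow> real"
  assumes bd: "bounded \<Omega>" and f: "continuous_on (closure \<Omega>) f" and h: "continuous_on (closure \<Omega>) h"
  shows "\<exists>m. prob_space m \<and> sets m = sets (restrict_space borel (closure \<Omega>)) \<and>
    (\<forall>g. continuous_on (closure \<Omega>) g \<longrightarrow> crit \<epsilon> p \<Omega> f - (\<integral>x. g x - f x \<partial>m) \<le> crit \<epsilon> p \<Omega> g) \<and>
    ((\<lambda>t. (crit \<epsilon> p \<Omega> (\<lambda>x. f x + t * h x) - crit \<epsilon> p \<Omega> f) / t) \<longlongrightarrow> - integral\<^sup>L m h) (at_right 0)"
proof -
  define K where "K = closure \<Omega>"
  have K: "compact K" using bd by (simp add: K_def)
  have OK: "\<Omega> \<subseteq> K" by (simp add: K_def closure_subset)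
  note adm = admissible_if_continuous_on_closure[OF bd, folded K_def]
  note f' = f[folded K_def] and h' = h[folded K_def]
  define J where "J b = crit \<epsilon> p \<Omega> (\<lambda>x. f x + apply_bcontfun b x)" for b :: "'a \<Rightarrow>\<^sub>C real"
  have admJ: "admissible (\<lambda>x. f x + apply_bcontfun b x)" for b
    by (intro adm continuous_on_add f' continuous_on_apply_bcontfun)
  have cong: "crit \<epsilon> p \<Omega> g = crit \<epsilon> p \<Omega> g'" if "admissible g" "admissible g'" "\<And>x. x \<in> \<Omega> \<Longrightarrow> g x = g' x" for g g'
    using crit_mono[of g g' 0] crit_mono[of g' g 0] that by (simp add: antisym)
  have J0: "J 0 = crit \<epsilon> p \<Omega> f" by (simp add: J_def)
  have "J (t *\<^sub>R x + (1 - t) *\<^sub>R y) \<le> t * J x + (1 - t) * J y" if "0 \<le> t" "t \<le> 1" for x y t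
  proof -
    have "(\<lambda>z. f z + apply_bcontfun (t *\<^sub>R x + (1 - t) *\<^sub>R y) z) 
      = (\<lambda>z. t * (f z + apply_bcontfun x z) + (1 - t) * (f z + apply_bcontfun y z))"
      by (auto simp: algebra_simps)
    then show ?thesis unfolding J_def using crit_convex[OF admJ admJ that] by simp
  qed
  from directional_derivative[of J, OF this] obtain P where P: "sublinear P" "\<And>b. P b \<le> J b - J 0" 
    "\<And>b. ((\<lambda>t. (J (t *\<^sub>R b) - J 0) / t) \<longlongrightarrow> P b) (at_right 0)" by blast
  obtain hb :: "'a \<Rightarrow>\<^sub>C real" where hb: "\<And>x. x \<in> K \<Longrightarrow> apply_bcontfun hb x = h x"
    using bcontfun_extension[OF K h'] by blast
  obtain \<Lambda> where \<Lambda>: "linear \<Lambda>" "\<And>b. \<Lambda> b \<le> P b" "\<Lambda> hb = P hb"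
    using hahn_banach_sublinear[OF P(1)] by blast
  have \<Lambda>J: "\<Lambda> b \<le> J b - J 0" for b using \<Lambda>(2)[of b] P(2)[of b] by simp
  \<comment> \<open>Raising the potential lowers the critical value, so \<open>\<Lambda>\<close> is
    nonpositive on nonnegative functions; this explains the minus sign in \<open>L\<close>.\<close>
  have pos: "\<Lambda> b \<le> 0" if "\<And>x. x \<in> K \<Longrightarrow> 0 \<le> apply_bcontfun b x" for b
  proof -
    have "J b \<le> J 0 + 0" unfolding J_def
      by (rule crit_mono[OF admJ admJ]) (use that OK in auto)
    with \<Lambda>J[of b] show ?thesis by simp
  qed
  have zero: "\<Lambda> b = \<Lambda> b'" if "\<And>x. x \<in> K \<Longrightarrow> apply_bcontfun b x = apply_bcontfun b' x" for b b'
    using pos[of "b - b'"] pos[of "b' - b"] that by (simp add: linear_diff[OF \<Lambda>(1)])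
  \<comment> \<open>The extension off \<open>K\<close> is arbitrary; \<open>zero\<close> shows that
    its choice does not affect \<open>\<Lambda>\<close>.\<close>
  define ext where "ext g = (SOME b :: 'a \<Rightarrow>\<^sub>C real. \<forall>x\<in>K. apply_bcontfun b x = g x)" for g
  have ext: "apply_bcontfun (ext g) x = g x" if gK: "continuous_on K g" "x \<in> K" for g x
  proof -
    obtain b :: "'a \<Rightarrow>\<^sub>C real" where "\<And>x. x \<in> K \<Longrightarrow> apply_bcontfun b x = g x"
      using bcontfun_extension[OF K gK(1)] by metis
    then have "\<exists>b :: 'a \<Rightarrow>\<^sub>C real. \<forall>x\<in>K. apply_bcontfun b x = g x" by blast
    from someI_ex[OF this] gK(2) show ?thesis unfolding ext_def by blast
  qed
  define L where "L g = - \<Lambda> (ext g)" for g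
  interpret F: positive_functional K L
  proof
    show "compact K" by (rule K)
    fix g1 g2 :: "'a \<Rightarrow> real" assume g: "continuous_on K g1" "continuous_on K g2"
    have "continuous_on K (\<lambda>x. g1 x + g2 x)" using g by (intro continuous_intros)
    then have "\<Lambda> (ext (\<lambda>x. g1 x + g2 x)) = \<Lambda> (ext g1 + ext g2)" using g ext by (intro zero) simp
    then show "L (\<lambda>x. g1 x + g2 x) = L g1 + L g2" by (simp add: L_def linear_add[OF \<Lambda>(1)])
  next
    fix g :: "'a \<Rightarrow> real" and c assume g: "continuous_on K g"
    have "continuous_on K (\<lambda>x. c * g x)" using g by (intro continuous_intros)
    then have "\<Lambda> (ext (\<lambda>x. c * g x)) = \<Lambda> (c *\<^sub>R ext g)" using g ext by (intro zero) simp
    then show "L (\<lambda>x. c * g x) = c * L g" by (simp add: L_def linear_scale[OF \<Lambda>(1)])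
  next
    fix g :: "'a \<Rightarrow> real" assume g: "continuous_on K g" "\<And>x. x \<in> K \<Longrightarrow> 0 \<le> g x"
    then show "0 \<le> L g" using pos[of "ext g"] ext[OF g(1)] by (simp add: L_def)
  next
    \<comment> \<open>Adding a constant shifts the critical value by exactly its opposite. The
      subgradient inequality for both signs then pins down the value of \<open>\<Lambda>\<close> and
      gives total mass 1.\<close>
    define one :: "'a \<Rightarrow>\<^sub>C real" where "one = const_bcontfun 1"
    have o: "apply_bcontfun one x = 1" for x by (simp add: one_def const_bcontfun.rep_eq)
    have "J one = J 0 - 1" "J (- one) = J 0 + 1"
      unfolding J_def using crit_add_const[OF adm[OF f'], of 1] crit_add_const[OF adm[OF f'], of "-1"] by (simp_all add: o)
    then have "\<Lambda> one = - 1" using \<Lambda>J[of one] \<Lambda>J[of "- one"] linear_neg[OF \<Lambda>(1), of one] by simp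
    moreover have "\<Lambda> (ext (\<lambda>x. 1)) = \<Lambda> one" using ext[OF continuous_on_const] by (intro zero) (simp add: o)
    ultimately show "L (\<lambda>x. 1) = 1" by (simp add: L_def)
  qed
  obtain m where m: "prob_space m" "sets m = sets (restrict_space borel K)" "\<And>g. continuous_on K g \<Longrightarrow> integral\<^sup>L m g = L g"
    using F.representation by blast
  have "crit \<epsilon> p \<Omega> f - (\<integral>x. g x - f x \<partial>m) \<le> crit \<epsilon> p \<Omega> g" if g: "continuous_on K g" for g
  proof -
    have c: "continuous_on K (\<lambda>x. g x - f x)" by (intro continuous_intros g f')
    have "\<Lambda> (ext (\<lambda>x. g x - f x)) \<le> J (ext (\<lambda>x. g x - f x)) - J 0" by (rule \<Lambda>J)
    also have "J (ext (\<lambda>x. g x - f x)) = crit \<epsilon> p \<Omega> g" unfolding J_def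
      by (rule cong[OF admJ adm[OF g]]) (use ext[OF c] OK in auto)
    finally show ?thesis using m(3)[OF c] by (simp add: L_def J0)
  qed
  moreover have "((\<lambda>t. (crit \<epsilon> p \<Omega> (\<lambda>x. f x + t * h x) - crit \<epsilon> p \<Omega> f) / t) \<longlongrightarrow> - integral\<^sup>L m h) (at_right 0)"
  proof -
    have "J (t *\<^sub>R hb) = crit \<epsilon> p \<Omega> (\<lambda>x. f x + t * h x)" for t unfolding J_def
    proof (rule cong[OF admJ adm])
      show "continuous_on K (\<lambda>x. f x + t * h x)" by (intro continuous_intros f' h')
    qed (use hb OK in auto)
    moreover have "- integral\<^sup>L m h = P hb"
      using m(3)[OF h'] zero[of "ext h" hb] ext[OF h'] hb \<Lambda>(3) by (simp add: L_def)
    ultimately show ?thesis using P(3)[of hb] by (simp add: J0)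
  qed
  ultimately show ?thesis using m(1,2) unfolding K_def by blast
qed

end

section \<open>Lagrangian and dilations\<close>

text \<open>Inverts the gradient of |eta|^p explicitly and evaluates the Legendre transform at the
  solution. This yields the conjugate power |v|^q together with its constant.\<close>

lemma norm_powr_gradient_surj:
  fixes v :: "'a::real_inner"
  assumes p: "p > 1"
  defines "q \<equiv> p / (p - 1)"
  obtains \<eta> where "v = (p * norm \<eta> powr (p - 2)) *\<^sub>R \<eta>" 
    "\<eta> \<bullet> v - norm \<eta> powr p = (p - 1) * p powr (- q) * norm v powr q"
proof (cases "v = 0")
  case True then show thesis using that[of 0] by simp
next
  case False
  define n where "n = norm v"
  define r where "r = 1 / (p - 1)"
  have n: "n > 0" using False by (simp add: n_def)
  have r: "r > 0" "r * (p - 1) = 1" "q = 1 + r" "r * p = q" using p by (auto simp: r_def q_def field_simps)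
  \<comment> \<open>The vector in the direction of \<open>v\<close> whose norm is (|v| /
    p)^(1/(p-1)), as the norm of the equation to be solved dictates.\<close>
  define \<eta> where "\<eta> = (p powr (- r) * n powr (r - 1)) *\<^sub>R v"
  have "n powr (r - 1) * n = n powr r" using powr_add[of n "r - 1" 1] n by simp
  then have nm: "norm \<eta> = p powr (- r) * n powr r" using p by (simp add: \<eta>_def n_def[symmetric] mult.assoc)
  have "p * norm \<eta> powr (p - 2) * (p powr (- r) * n powr (r - 1)) 
     = (p powr 1 * p powr (- r * (p - 2)) * p powr (- r)) * (n powr (r * (p - 2)) * n powr (r - 1))"
    using p n by (simp add: nm powr_mult powr_powr)
  also have "\<dots> = p powr (1 + (- r * (p - 2)) + (- r)) * n powr (r * (p - 2) + (r - 1))"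
    by (simp only: powr_add)
  also have "1 + (- r * (p - 2)) + (- r) = 0" using r(2) by (simp add: algebra_simps)
  also have "r * (p - 2) + (r - 1) = 0" using r(2) by (simp add: algebra_simps)
  finally have 1: "p * norm \<eta> powr (p - 2) * (p powr (- r) * n powr (r - 1)) = 1" using p n by simp
  have "(p * norm \<eta> powr (p - 2)) *\<^sub>R \<eta> = v"
    unfolding \<eta>_def scaleR_scaleR using 1 by (simp add: \<eta>_def)
  moreover have "\<eta> \<bullet> v - norm \<eta> powr p = (p - 1) * p powr (- q) * norm v powr q"
  proof -
    have "n powr (r - 1) * n\<^sup>2 = n powr q" using powr_add[of n "r - 1" 2] n r(3) by simp
    then have "\<eta> \<bullet> v = p powr (- r) * n powr q" by (simp add: \<eta>_def dot_square_norm n_def[symmetric] mult.assoc)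
    moreover have "p powr (- r) = p * p powr (- q)" using powr_add[of p 1 "- q"] p r(3) by simp
    moreover have "norm \<eta> powr p = p powr (- q) * n powr q"
      using p n by (simp add: nm powr_mult powr_powr r(4))
    ultimately show ?thesis by (simp add: n_def algebra_simps)
  qed
  ultimately show thesis using that[of \<eta>] by simp
qed

text \<open>By the tangent inequality the supremum defining \<open>Lag\<close> is attained at
  \<open>\<eta>\<close>. Attainment matters formally as well: it fixes the value of a real supremum,
  which would be arbitrary for an unbounded set.\<close>

lemma Lag_at_gradient:
  fixes \<eta> :: "'a::euclidean_space"
  assumes p: "p > 1" and v: "v = (p * norm \<eta> powr (p - 2)) *\<^sub>R \<eta>"
  shows "Lag p f x v = \<eta> \<bullet> v - Ham p f x \<eta>" "\<xi> \<bullet> v - Ham p f x \<xi> \<le> Lag p f x v"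
proof -
  have le: "\<xi> \<bullet> v - Ham p f x \<xi> \<le> \<eta> \<bullet> v - Ham p f x \<eta>" for \<xi>
    using norm_powr_tangent[OF p, of \<eta> \<xi>] by (simp add: Ham_def v[symmetric] inner_diff_right inner_commute)
  show L: "Lag p f x v = \<eta> \<bullet> v - Ham p f x \<eta>"
    unfolding Lag_def by (rule cSup_eq_maximum) (use le in auto)
  show "\<xi> \<bullet> v - Ham p f x \<xi> \<le> Lag p f x v" unfolding L by (rule le)
qed

lemma Lag_eq:
  fixes v :: "'a::euclidean_space"
  assumes p: "p > 1"
  shows "Lag p f x v = (p - 1) * p powr (- (p / (p - 1))) * norm v powr (p / (p - 1)) + f x"
proof -
  obtain \<eta> where e: "v = (p * norm \<eta> powr (p - 2)) *\<^sub>R \<eta>" 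
    "\<eta> \<bullet> v - norm \<eta> powr p = (p - 1) * p powr (- (p / (p - 1))) * norm v powr (p / (p - 1))"
    using norm_powr_gradient_surj[OF p] by blast
  show ?thesis using Lag_at_gradient(1)[OF p e(1), of f x] e(2) by (simp add: Ham_def)
qed

lemma Lag_ge: "p > 1 \<Longrightarrow> \<xi> \<bullet> v - Ham p f x \<xi> \<le> Lag p f x v"
  using norm_powr_gradient_surj[of p v] Lag_at_gradient(2) by metis

text \<open>The Legendre transform of t L + h is t H(x, xi / t) - h. The supremum is attained at the
  velocity dual to xi / t.\<close>

lemma Ham_of_eq:
  fixes \<xi> :: "'a::euclidean_space"
  assumes p: "p > 1" and t: "t > 0" and \<phi>: "\<And>v. \<phi> (x, v) = t * Lag p f x v + h x"
  shows "Ham_of \<phi> x \<xi> = t * norm ((1 / t) *\<^sub>R \<xi>) powr p - (t * f x + h x)"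
proof -
  define \<eta> where "\<eta> = (1 / t) *\<^sub>R \<xi>"
  have \<xi>: "\<xi> = t *\<^sub>R \<eta>" using t by (simp add: \<eta>_def)
  have le: "\<xi> \<bullet> v - \<phi> (x, v) \<le> t * Ham p f x \<eta> - h x" for v
  proof -
    have "t * (\<eta> \<bullet> v - Ham p f x \<eta>) \<le> t * Lag p f x v" using t by (intro mult_left_mono Lag_ge p) auto
    then show ?thesis by (simp add: \<phi> \<xi> algebra_simps)
  qed
  have "\<xi> \<bullet> ((p * norm \<eta> powr (p - 2)) *\<^sub>R \<eta>) - \<phi> (x, (p * norm \<eta> powr (p - 2)) *\<^sub>R \<eta>) = t * Ham p f x \<eta> - h x"
    unfolding \<phi> Lag_at_gradient(1)[OF p refl] by (simp add: \<xi> algebra_simps)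
  from this[symmetric] have m: "t * Ham p f x \<eta> - h x \<in> range (\<lambda>v. \<xi> \<bullet> v - \<phi> (x, v))" by (rule range_eqI)
  have "Ham_of \<phi> x \<xi> = t * Ham p f x \<eta> - h x"
    unfolding Ham_of_def by (rule cSup_eq_maximum[OF m]) (use le in auto)
  then show ?thesis by (simp add: Ham_def \<eta>_def algebra_simps)
qed

lemma vsub_homogeneous:
  assumes t: "t > 0" and u: "vsub \<epsilon> (\<lambda>\<xi>. t * N ((1 / t) *\<^sub>R \<xi>)) g S u"
  shows "vsub \<epsilon> N (\<lambda>x. g x / t) S (\<lambda>x. u x / t)"
  unfolding vsub_def
proof (intro ballI allI impI)
  fix x \<phi> assume x: "x \<in> S" and \<phi>: "Ck_on 2 \<phi> UNIV" and m: "\<forall>\<^sub>F y in nhds x. u y / t - \<phi> y \<le> u x / t - \<phi> x"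
  note a = grad_laplacian_cmult[OF \<phi>, of t]
  have "\<forall>\<^sub>F y in nhds x. u y - t * \<phi> y \<le> u x - t * \<phi> x"
    using m
  proof eventually_elim
    case (elim y)
    from mult_left_mono[OF this, of t] show ?case using t by (simp add: algebra_simps)
  qed
  from vsubD[OF u x a(1) this] show "N (grad \<phi> x) - \<epsilon> * laplacian \<phi> x \<le> g x / t"
    unfolding a(2,3) using t by (simp add: field_simps)
qed

text \<open>The kinetic part of L is homogeneous of degree q in v, so by Euler v.D_v L = q (L - f),
  while D_x L is the gradient of \<open>f\<close>.\<close>

lemma scaling_Lag_eq:
  fixes x v :: "'a::euclidean_space"
  assumes p: "p > 1" and f: "f differentiable (at x)"
  shows "scaling_Lag p f (x, v) = p / (p - 1) * Lag p f x v - (p / (p - 1) * f x + x \<bullet> grad f x)"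
proof -
  define q where "q = p / (p - 1)"
  define k where "k = (p - 1) * p powr (- q)"
  have L: "Lag p f y w = k * norm w powr q + f y" for y w :: 'a
    using Lag_eq[OF p, of f y w] by (simp add: q_def k_def)
  have "((\<lambda>y. k * norm v powr q + f y) has_derivative (\<lambda>h. 0 + grad f x \<bullet> h)) (at x)"
    by (intro derivative_intros has_derivative_grad[OF f])
  then have 1: "grad (\<lambda>y. Lag p f y v) x = grad f x" unfolding L by (intro grad_eqI) simp
  have 2: "v \<bullet> grad (\<lambda>w. Lag p f x w) v = q * (k * norm v powr q)"
  proof (cases "v = 0")
    case False
    define n where "n = norm v"
    have n: "n > 0" using False by (simp add: n_def)
    have "(norm has_derivative (\<lambda>h. h \<bullet> sgn v)) (at v)" using False by (rule has_derivative_norm)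
    then have "((\<lambda>w. norm w powr q) has_derivative (\<lambda>h. q * n powr (q - 1) * (h \<bullet> sgn v))) (at v)"
      using has_derivative_compose[of norm _ v UNIV "\<lambda>z. z powr q"] has_real_derivative_powr[of n q] n
      by (simp add: has_field_derivative_def n_def)
    then have "((\<lambda>w. k * norm w powr q + f x) has_derivative (\<lambda>h. k * (q * n powr (q - 1) * (h \<bullet> sgn v)) + 0)) (at v)"
      by (intro has_derivative_add has_derivative_mult_right has_derivative_const)
    moreover have "(\<lambda>h. k * (q * n powr (q - 1) * (h \<bullet> sgn v)) + 0) = (\<lambda>h. (k * (q * n powr (q - 1))) *\<^sub>R sgn v \<bullet> h)"
      by (auto simp: inner_commute)
    ultimately have "((\<lambda>w. k * norm w powr q + f x) has_derivative (\<lambda>h. (k * (q * n powr (q - 1))) *\<^sub>R sgn v \<bullet> h)) (at v)"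
      by simp
    then have "grad (\<lambda>w. Lag p f x w) v = (k * (q * n powr (q - 1))) *\<^sub>R sgn v" unfolding L by (rule grad_eqI)
    moreover have "v \<bullet> sgn v = n" using n by (simp add: sgn_div_norm dot_square_norm n_def power2_eq_square)
    moreover have "n powr (q - 1) * n = n powr q" using powr_add[of n "q - 1" 1] n by simp
    ultimately show ?thesis by (simp add: n_def[symmetric] algebra_simps)
  qed simp
  show ?thesis unfolding scaling_Lag_def case_prod_conv 1 2 unfolding L q_def[symmetric] by (simp add: algebra_simps)
qed

text \<open>First-order expansion of s^q f(s x) at s = 1, uniform in x: the derivative in s is
  uniformly continuous on a compact set of pairs (s, x), and the mean value inequality integrates
  the bound.\<close>

lemma scaling_expansion:
  fixes f :: "'a::euclidean_space \<Rightarrow> real"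
  assumes K: "compact K" and U: "open U" "K \<subseteq> U" 
    and f: "\<And>x. x \<in> U \<Longrightarrow> f differentiable (at x)" and gf: "continuous_on U (grad f)" and e: "e > 0"
  shows "\<exists>d>0. \<forall>l. \<bar>l\<bar> < d \<longrightarrow> (\<forall>x\<in>K. (1 + l) *\<^sub>R x \<in> U \<and>
    \<bar>(1 + l) powr q * f ((1 + l) *\<^sub>R x) - f x - l * (q * f x + x \<bullet> grad f x)\<bar> \<le> e * \<bar>l\<bar>)"
proof -
  obtain r where r: "r > 0" "(\<Union>x\<in>K. cball x r) \<subseteq> U"
    using compact_subset_open_imp_cball_epsilon_subset[OF K U] by blast
  obtain B where B: "B > 0" "\<And>x. x \<in> K \<Longrightarrow> norm x \<le> B" using compact_imp_bounded[OF K] unfolding bounded_pos by auto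
  define d0 where "d0 = min (1 / 2) (r / B)"
  have d0: "d0 > 0" "d0 \<le> 1 / 2" "d0 * B \<le> r" using r B by (auto simp: d0_def min_def field_simps)
  have inU: "s *\<^sub>R x \<in> U" if "\<bar>s - 1\<bar> \<le> d0" "x \<in> K" for s x
  proof -
    have "dist x (s *\<^sub>R x) = \<bar>s - 1\<bar> * norm x"
      by (metis dist_commute dist_norm norm_scaleR scaleR_left_diff_distrib scaleR_one)
    also have "\<dots> \<le> d0 * B" using that B(2) d0 by (intro mult_mono) auto
    also have "\<dots> \<le> r" by (rule d0)
    finally have "s *\<^sub>R x \<in> cball x r" by simp
    then show ?thesis using r(2) that(2) by blast
  qed
  define T where "T = {1 - d0..1 + d0} \<times> K"
  have T: "compact T" unfolding T_def by (intro compact_Times K) auto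
  have Ts: "fst z > 0" "fst z *\<^sub>R snd z \<in> U" if "z \<in> T" for z
    using that d0 inU[of "fst z" "snd z"] by (auto simp: T_def)
  have fc: "continuous_on U f" 
    using f by (intro continuous_at_imp_continuous_on ballI differentiable_imp_continuous_within) 
  define \<Gamma> where "\<Gamma> z = q * fst z powr (q - 1) * f (fst z *\<^sub>R snd z) + fst z powr q * (snd z \<bullet> grad f (fst z *\<^sub>R snd z))" for z
  have "continuous_on T \<Gamma>" unfolding \<Gamma>_def
    by (intro continuous_intros continuous_on_compose2[OF fc] continuous_on_compose2[OF gf] image_subsetI)
      (use Ts in \<open>fastforce+\<close>)
  from compact_uniformly_continuous[OF this T] 
  obtain d1 where d1: "d1 > 0" "\<And>z z'. z \<in> T \<Longrightarrow> z' \<in> T \<Longrightarrow> dist z' z < d1 \<Longrightarrow> dist (\<Gamma> z') (\<Gamma> z) < e"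
    unfolding uniformly_continuous_on_def using e by metis
  show ?thesis
  proof (rule exI[of _ "min d0 d1"], intro conjI allI impI ballI)
    show "min d0 d1 > 0" using d0 d1 by simp
    fix l x assume l: "\<bar>l\<bar> < min d0 d1" and x: "x \<in> K"
    show "(1 + l) *\<^sub>R x \<in> U" using inU[of "1 + l" x] l x by simp
    define g1 where "g1 = q * f x + x \<bullet> grad f x"
    \<comment> \<open>With the linear part subtracted, the derivative of \<open>h\<close> is the
      deviation of \<open>\<Gamma>\<close> from its value at s = 1, which is at most
      \<open>e\<close>.\<close>
    define h where "h s = s powr q * f (s *\<^sub>R x) - s * g1" for s
    define I where "I = {1 - \<bar>l\<bar>..1 + \<bar>l\<bar>}"
    have sT: "(s, x) \<in> T" and s0: "s > 0" and sd: "\<bar>s - 1\<bar> < d1" if "s \<in> I" for s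
      using that l x d0 unfolding I_def T_def by auto
    have 1: "\<Gamma> (1, x) = g1" by (simp add: \<Gamma>_def g1_def)
    have oT: "(1, x) \<in> T" using d0 x by (simp add: T_def)
    have der: "(h has_field_derivative (\<Gamma> (s, x) - g1)) (at s within I)" if s: "s \<in> I" for s
    proof -
      have sU: "s *\<^sub>R x \<in> U" using Ts(2)[OF sT[OF s]] by simp
      have "((\<lambda>s. s *\<^sub>R x) has_derivative (\<lambda>c. c *\<^sub>R x)) (at s)" by (auto intro!: derivative_eq_intros)
      from has_derivative_compose[OF this has_derivative_grad[OF f[OF sU]]]
      have "((\<lambda>s. f (s *\<^sub>R x)) has_real_derivative (x \<bullet> grad f (s *\<^sub>R x))) (at s)"
        by (simp add: has_field_derivative_def inner_commute mult_commute_abs)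
      then have "(h has_real_derivative (q * s powr (q - 1) * f (s *\<^sub>R x) + (x \<bullet> grad f (s *\<^sub>R x)) * s powr q - 1 * g1)) (at s)"
        unfolding h_def by (intro DERIV_diff DERIV_mult DERIV_cmult_right DERIV_ident has_real_derivative_powr s0 s)
      then show ?thesis by (simp add: \<Gamma>_def has_field_derivative_at_within mult.commute)
    qed
    have "norm (h (1 + l) - h 1) \<le> e * norm (1 + l - 1)"
    proof (rule field_differentiable_bound[of I, OF _ der])
      fix s assume s: "s \<in> I"
      have "dist (s, x) (1, x) < d1" using sd[OF s] by (simp add: dist_Pair_Pair dist_real_def)
      from d1(2)[OF oT sT[OF s] this] show "norm (\<Gamma> (s, x) - g1) \<le> e" unfolding 1 by (simp add: dist_norm)
    qed (auto simp: I_def)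
    then show "\<bar>(1 + l) powr q * f ((1 + l) *\<^sub>R x) - f x - l * (q * f x + x \<bullet> grad f x)\<bar> \<le> e * \<bar>l\<bar>"
      by (simp add: h_def g1_def algebra_simps)
  qed
qed

section \<open>The scaled eigenvalue in terms of critical values\<close>

lemma eigenvalue_eq_Least_levels:
  assumes "open S" "\<epsilon> > 0"
  shows "eigenvalue \<epsilon> (Ham p f) S = (LEAST c. c \<in> levels \<epsilon> p S f)"
  unfolding eigenvalue_def levels_def
  using visc_subsol_iff_vsub[OF assms, of "Ham p f" "\<lambda>\<xi>. norm \<xi> powr p" f] by (simp add: Ham_def)

context viscous_domain
begin

lemma scaled_eigenvalue_eq:
  fixes l :: real
  assumes l: "l > - 1"
  defines "q \<equiv> p / (p - 1)"
  assumes adm: "admissible (\<lambda>x. (1 + l) powr q * f ((1 + l) *\<^sub>R x))"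
  shows "scaled_eigenvalue \<epsilon> p f \<Omega> l = (1 + l) powr (- q) * crit \<epsilon> p \<Omega> (\<lambda>x. (1 + l) powr q * f ((1 + l) *\<^sub>R x))"
proof -
  define s where "s = 1 + l"
  have s: "s > 0" using l by (simp add: s_def)
  define G where "G x = s powr q * f (s *\<^sub>R x)" for x
  have G: "admissible G" using adm by (simp add: G_def[abs_def] s_def)
  have o: "open ((\<lambda>x. s *\<^sub>R x) ` \<Omega>)" using s op by (intro open_scaling) auto
  have lev: "c \<in> levels \<epsilon> p ((\<lambda>x. s *\<^sub>R x) ` \<Omega>) f \<longleftrightarrow> s powr q * c \<in> levels \<epsilon> p \<Omega> G" for c
    using levels_scale[of p s c \<epsilon> \<Omega> f] p2 s by (simp add: q_def G_def[abs_def])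
  have inv: "s powr q * (s powr (- q) * y) = y" "s powr (- q) * (s powr q * y) = y" for y
    using s by (simp_all flip: mult.assoc powr_add)
  have "(LEAST c. c \<in> levels \<epsilon> p ((\<lambda>x. s *\<^sub>R x) ` \<Omega>) f) = s powr (- q) * crit \<epsilon> p \<Omega> G"
  proof (rule Least_equality)
    show "s powr (- q) * crit \<epsilon> p \<Omega> G \<in> levels \<epsilon> p ((\<lambda>x. s *\<^sub>R x) ` \<Omega>) f"
      unfolding lev inv by (rule crit_in_levels[OF G])
    fix c assume "c \<in> levels \<epsilon> p ((\<lambda>x. s *\<^sub>R x) ` \<Omega>) f"
    then have "crit \<epsilon> p \<Omega> G \<le> s powr q * c" unfolding lev by (rule crit_le[OF G])
    then have "s powr (- q) * crit \<epsilon> p \<Omega> G \<le> s powr (- q) * (s powr q * c)" by (rule mult_left_mono) simp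
    then show "s powr (- q) * crit \<epsilon> p \<Omega> G \<le> c" unfolding inv .
  qed
  then show ?thesis
    unfolding scaled_eigenvalue_def s_def[symmetric] G_def[symmetric, abs_def] eigenvalue_eq_Least_levels[OF o eps] .
qed

lemma eigenvalue_eq_crit:
  assumes "admissible f" shows "eigenvalue \<epsilon> (Ham p f) \<Omega> = crit \<epsilon> p \<Omega> f"
  unfolding eigenvalue_eq_Least_levels[OF op eps]
  using crit_in_levels[OF assms] crit_le[OF assms] by (intro Least_equality)

text \<open>The filter \<open>F\<close> serves both one-sided limits. Replacing \<open>G l\<close>
  by its linearisation changes the critical value by at most the supremum of the difference, hence
  by o(l); the remaining quotient follows from the product rule with the factor (1+l)^(-q).\<close>

lemma scaled_eigenvalue_limit:
  fixes f :: "'a \<Rightarrow> real"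
  assumes bd: "bounded \<Omega>" and U: "open U" "closure \<Omega> \<subseteq> U" 
    and f: "\<And>x. x \<in> U \<Longrightarrow> f differentiable (at x)" and gf: "continuous_on U (grad f)" and F: "F \<le> at 0"
  defines "q \<equiv> p / (p - 1)"
  defines "g1 \<equiv> \<lambda>x. q * f x + x \<bullet> grad f x"
  assumes lim: "((\<lambda>l. (crit \<epsilon> p \<Omega> (\<lambda>x. f x + l * g1 x) - crit \<epsilon> p \<Omega> f) / l) \<longlongrightarrow> D) F"
  shows "((\<lambda>l. (scaled_eigenvalue \<epsilon> p f \<Omega> l - scaled_eigenvalue \<epsilon> p f \<Omega> 0) / l) \<longlongrightarrow> D - q * crit \<epsilon> p \<Omega> f) F"
proof -
  define K where "K = closure \<Omega>"
  have K: "compact K" "K \<subseteq> U" using bd U by (auto simp: K_def)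
  have OK: "\<Omega> \<subseteq> K" by (simp add: K_def closure_subset)
  note adm = admissible_if_continuous_on_closure[OF bd, folded K_def]
  have fc: "continuous_on U f" 
    using f by (intro continuous_at_imp_continuous_on ballI differentiable_imp_continuous_within) 
  have fK: "continuous_on K f" and gK: "continuous_on K (grad f)"
    using fc gf K(2) by (auto intro: continuous_on_subset)
  have g1K: "continuous_on K g1" unfolding g1_def by (intro continuous_intros fK gK)
  define G where "G l x = (1 + l) powr q * f ((1 + l) *\<^sub>R x)" for l x
  have exp: "\<exists>d>0. \<forall>l. \<bar>l\<bar> < d \<longrightarrow> (\<forall>x\<in>K. (1 + l) *\<^sub>R x \<in> U \<and> \<bar>G l x - f x - l * g1 x\<bar> \<le> e * \<bar>l\<bar>)"
    if "e > 0" for e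
    unfolding G_def g1_def by (rule scaling_expansion[OF K(1) U(1) K(2) f gf that])
  obtain d0 where d0: "d0 > 0" "\<And>l x. \<bar>l\<bar> < d0 \<Longrightarrow> x \<in> K \<Longrightarrow> (1 + l) *\<^sub>R x \<in> U"
    using exp[OF zero_less_one] by metis
  have admG: "admissible (G l)" if "\<bar>l\<bar> < d0" for l
    unfolding G_def using d0(2)[OF that] by (intro adm continuous_intros continuous_on_compose2[OF fc]) auto
  have admF: "admissible (\<lambda>x. f x + l * g1 x)" for l by (intro adm continuous_intros fK g1K)
  define R where "R l = (crit \<epsilon> p \<Omega> (G l) - crit \<epsilon> p \<Omega> (\<lambda>x. f x + l * g1 x)) / l" for l
  have F_ev: "eventually P F" if "eventually P (at 0)" for P using that F by (simp add: le_filter_def)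
  have small: "\<forall>\<^sub>F l in F. \<bar>l\<bar> < d \<and> l \<noteq> 0" if "d > 0" for d :: real
    using that by (intro F_ev) (auto simp: eventually_at dist_real_def)
  have R: "(R \<longlongrightarrow> 0) F"
  proof (rule tendstoI)
    fix e :: real assume e: "e > 0"
    then obtain d where d: "d > 0" "\<And>l x. \<bar>l\<bar> < d \<Longrightarrow> x \<in> K \<Longrightarrow> \<bar>G l x - f x - l * g1 x\<bar> \<le> (e / 2) * \<bar>l\<bar>"
      using exp[OF half_gt_zero] by metis
    have "\<forall>\<^sub>F l in F. \<bar>l\<bar> < min d d0 \<and> l \<noteq> 0" using d d0 by (intro small) auto
    then show "\<forall>\<^sub>F l in F. dist (R l) 0 < e"
    proof eventually_elim
      case (elim l)
      then have l: "\<bar>l\<bar> < d" "\<bar>l\<bar> < d0" "l \<noteq> 0" by auto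
      have b: "\<bar>G l x - (f x + l * g1 x)\<bar> \<le> (e / 2) * \<bar>l\<bar>" if "x \<in> \<Omega>" for x
        using d(2)[OF l(1), of x] that OK by (auto simp: diff_diff_eq)
      have b': "f x + l * g1 x \<le> G l x + (e / 2) * \<bar>l\<bar>" "G l x \<le> (f x + l * g1 x) + (e / 2) * \<bar>l\<bar>"
        if "x \<in> \<Omega>" for x using b[OF that] unfolding abs_le_iff by linarith+
      have "crit \<epsilon> p \<Omega> (G l) \<le> crit \<epsilon> p \<Omega> (\<lambda>x. f x + l * g1 x) + (e / 2) * \<bar>l\<bar>"
        by (rule crit_mono[OF admF admG[OF l(2)]]) (rule b')
      moreover have "crit \<epsilon> p \<Omega> (\<lambda>x. f x + l * g1 x) \<le> crit \<epsilon> p \<Omega> (G l) + (e / 2) * \<bar>l\<bar>"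
        by (rule crit_mono[OF admG[OF l(2)] admF]) (rule b')
      ultimately have "\<bar>crit \<epsilon> p \<Omega> (G l) - crit \<epsilon> p \<Omega> (\<lambda>x. f x + l * g1 x)\<bar> \<le> (e / 2) * \<bar>l\<bar>"
        unfolding abs_le_iff by linarith
      then have "\<bar>R l\<bar> \<le> e / 2" using l(3) by (simp add: R_def abs_divide divide_le_eq)
      then show ?case using e by simp
    qed
  qed
  have pw: "((\<lambda>l. (1 + l) powr (- q)) \<longlongrightarrow> (1 + 0) powr (- q)) F"
  proof (rule tendsto_mono[OF F])
    show "((\<lambda>l::real. (1 + l) powr (- q)) \<longlongrightarrow> (1 + 0) powr (- q)) (at 0)" by (intro tendsto_intros) auto
  qed
  have dpw: "((\<lambda>l. ((1 + l) powr (- q) - 1) / l) \<longlongrightarrow> - q) F"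
  proof (rule tendsto_mono[OF F])
    have "((\<lambda>l. (1 + l) powr (- q)) has_real_derivative - q) (at 0)"
      by (auto intro!: derivative_eq_intros)
    then show "((\<lambda>l. ((1 + l) powr (- q) - 1) / l) \<longlongrightarrow> - q) (at 0)" by (simp add: DERIV_def)
  qed
  have "((\<lambda>l. (1 + l) powr (- q) * (R l + (crit \<epsilon> p \<Omega> (\<lambda>x. f x + l * g1 x) - crit \<epsilon> p \<Omega> f) / l)
      + crit \<epsilon> p \<Omega> f * (((1 + l) powr (- q) - 1) / l)) \<longlongrightarrow> (1 + 0) powr (- q) * (0 + D) + crit \<epsilon> p \<Omega> f * (- q)) F"
    by (rule tendsto_add[OF tendsto_mult[OF pw tendsto_add[OF R lim]] tendsto_mult[OF tendsto_const dpw]])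
  moreover have "\<forall>\<^sub>F l in F. (1 + l) powr (- q) * (R l + (crit \<epsilon> p \<Omega> (\<lambda>x. f x + l * g1 x) - crit \<epsilon> p \<Omega> f) / l)
      + crit \<epsilon> p \<Omega> f * (((1 + l) powr (- q) - 1) / l) = (scaled_eigenvalue \<epsilon> p f \<Omega> l - scaled_eigenvalue \<epsilon> p f \<Omega> 0) / l"
  proof -
    have "\<forall>\<^sub>F l in F. \<bar>l\<bar> < min d0 1 \<and> l \<noteq> 0" using d0 by (intro small) auto
    then show ?thesis
    proof eventually_elim
      case (elim l)
      have "scaled_eigenvalue \<epsilon> p f \<Omega> l = (1 + l) powr (- q) * crit \<epsilon> p \<Omega> (G l)"
        unfolding G_def q_def by (rule scaled_eigenvalue_eq) (use elim admG[of l] in \<open>auto simp: G_def[abs_def] q_def\<close>)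
      moreover have "scaled_eigenvalue \<epsilon> p f \<Omega> 0 = crit \<epsilon> p \<Omega> f"
        using scaled_eigenvalue_eq[of 0 f] adm[OF fK] by simp
      moreover have "R l + (crit \<epsilon> p \<Omega> (\<lambda>x. f x + l * g1 x) - crit \<epsilon> p \<Omega> f) / l = (crit \<epsilon> p \<Omega> (G l) - crit \<epsilon> p \<Omega> f) / l"
        by (simp add: R_def add_divide_distrib[symmetric])
      ultimately show ?case using elim by (simp add: field_simps)
    qed
  qed
  ultimately have "((\<lambda>l. (scaled_eigenvalue \<epsilon> p f \<Omega> l - scaled_eigenvalue \<epsilon> p f \<Omega> 0) / l) \<longlongrightarrow> (1 + 0) powr (- q) * (0 + D) + crit \<epsilon> p \<Omega> f * (- q)) F"
    by (rule Lim_transform_eventually)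
  then show ?thesis by (simp add: algebra_simps)
qed

text \<open>Dilating by a factor less than \<open>1\<close> makes a subsolution continuous up to the boundary.\<close>

lemma levels_continuous_to_closure:
  fixes g :: "'a \<Rightarrow> real"
  assumes bd: "bounded \<Omega>" and star: "\<And>s x. 0 \<le> s \<Longrightarrow> s < 1 \<Longrightarrow> x \<in> closure \<Omega> \<Longrightarrow> s *\<^sub>R x \<in> \<Omega>"
    and g: "continuous_on (closure \<Omega>) g" and c: "c \<in> levels \<epsilon> p \<Omega> g" and \<delta>: "\<delta> > 0"
  shows "\<exists>w. continuous_on (closure \<Omega>) w \<and> vsub \<epsilon> (\<lambda>\<xi>. norm \<xi> powr p) (\<lambda>x. g x + c + \<delta>) \<Omega> w"
proof -
  define K where "K = closure \<Omega>"
  define q where "q = p / (p - 1)"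
  have OK: "\<Omega> \<subseteq> K" by (simp add: K_def closure_subset)
  obtain u where u: "continuous_on \<Omega> u" "vsub \<epsilon> (\<lambda>\<xi>. norm \<xi> powr p) (\<lambda>x. g x + c) \<Omega> u"
    using c unfolding levels_def by auto
  define T where "T = {1 / 2..1 :: real} \<times> K"
  have T: "compact T" unfolding T_def using bd by (intro compact_Times) (auto simp: K_def)
  have inK: "s *\<^sub>R x \<in> K" if "0 \<le> s" "s \<le> 1" "x \<in> K" for s x
    using star[of s x] that OK by (cases "s = 1") (auto simp: K_def)
  \<comment> \<open>The right-hand side after dilation by s. Its uniform continuity in (s, x)
    provides one s below 1 for which it exceeds \<open>g x + c\<close> by less than
    \<open>\<delta>\<close> everywhere.\<close>
  define \<Gamma> where "\<Gamma> z = fst z powr q * (g (fst z *\<^sub>R snd z) + c)" for z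
  have "continuous_on T \<Gamma>" unfolding \<Gamma>_def
    by (intro continuous_intros continuous_on_compose2[OF g[folded K_def]]) (auto simp: T_def intro!: inK)
  from compact_uniformly_continuous[OF this T] 
  obtain d where d: "d > 0" "\<And>z z'. z \<in> T \<Longrightarrow> z' \<in> T \<Longrightarrow> dist z' z < d \<Longrightarrow> dist (\<Gamma> z') (\<Gamma> z) < \<delta>"
    unfolding uniformly_continuous_on_def using \<delta> by metis
  define s where "s = max (1 / 2) (1 - d / 2)"
  have s: "1 / 2 \<le> s" "s < 1" "1 - s < d" using d(1) by (auto simp: s_def)
  define w where "w x = s powr (q - 2) * u (s *\<^sub>R x)" for x
  have "vsub \<epsilon> (\<lambda>\<xi>. norm \<xi> powr p) (\<lambda>x. s powr q * (g (s *\<^sub>R x) + c)) {x. s *\<^sub>R x \<in> \<Omega>} w"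
    using vsub_scale[OF _ _ u(2), of s] p2 s unfolding w_def q_def by simp
  then have "vsub \<epsilon> (\<lambda>\<xi>. norm \<xi> powr p) (\<lambda>x. g x + c + \<delta>) \<Omega> w"
  proof (rule vsub_mono)
    show "\<Omega> \<subseteq> {x. s *\<^sub>R x \<in> \<Omega>}" using star[of s] s OK by (auto simp: K_def)
    fix x assume "x \<in> \<Omega>"
    then have x: "x \<in> K" using OK by blast
    have "dist (s, x) (1, x) < d" using s by (simp add: dist_Pair_Pair dist_real_def)
    then have "dist (\<Gamma> (s, x)) (\<Gamma> (1, x)) < \<delta>" using s x by (intro d(2)) (auto simp: T_def)
    then show "s powr q * (g (s *\<^sub>R x) + c) \<le> g x + c + \<delta>" by (simp add: \<Gamma>_def dist_real_def abs_less_iff)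
  qed
  moreover have "continuous_on (closure \<Omega>) w" unfolding w_def
    using star[of s] s by (intro continuous_intros continuous_on_compose2[OF u(1)]) auto
  ultimately show ?thesis by blast
qed

end

section \<open>Viscosity Mather measures\<close>

context viscous_domain
begin

lemma integrable_continuous_fst:
  fixes g :: "'a \<Rightarrow> real" and \<nu> :: "('a \<times> 'a) measure"
  assumes bd: "bounded \<Omega>" and \<nu>: "prob_space \<nu>" "sets \<nu> = sets (restrict_space borel (closure \<Omega> \<times> UNIV))"
    and g: "continuous_on (closure \<Omega>) g"
  shows "integrable \<nu> (\<lambda>z. g (fst z))"
proof -
  interpret prob_space \<nu> by (rule \<nu>(1))
  have "compact (closure \<Omega>)" using bd by simp
  from compact_imp_bounded[OF compact_continuous_image[OF g this]]
  obtain B where B: "\<And>x. x \<in> closure \<Omega> \<Longrightarrow> \<bar>g x\<bar> \<le> B" unfolding bounded_pos by auto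
  have "continuous_on (closure \<Omega> \<times> UNIV) (\<lambda>z. g (fst z))"
    by (intro continuous_on_compose2[OF g] continuous_intros) auto
  then have "(\<lambda>z. g (fst z)) \<in> borel_measurable \<nu>"
    using borel_measurable_continuous_on_restrict measurable_cong_sets[OF \<nu>(2) refl] by blast
  moreover have "space \<nu> = closure \<Omega> \<times> UNIV"
    using sets_eq_imp_space_eq[OF \<nu>(2)] by (simp add: space_restrict_space)
  ultimately show ?thesis by (intro integrable_const_bound[where B = B] AE_I2) (auto simp: B)
qed

lemma Mather_measuresD:
  assumes "\<nu> \<in> Mather_measures \<epsilon> p f \<Omega>"
  shows "prob_space \<nu>" "sets \<nu> = sets (restrict_space borel (closure \<Omega> \<times> UNIV))" "space \<nu> = closure \<Omega> \<times> UNIV"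
    "integrable \<nu> (\<lambda>z. Lag p f (fst z) (snd z))" "integral\<^sup>L \<nu> (\<lambda>z. Lag p f (fst z) (snd z)) = - eigenvalue \<epsilon> (Ham p f) \<Omega>"
    "g \<in> G0 \<epsilon> p f \<Omega> \<Longrightarrow> integral\<^sup>L \<nu> g \<ge> 0"
proof -
  show "prob_space \<nu>" and s: "sets \<nu> = sets (restrict_space borel (closure \<Omega> \<times> UNIV))"
    "integrable \<nu> (\<lambda>z. Lag p f (fst z) (snd z))" "integral\<^sup>L \<nu> (\<lambda>z. Lag p f (fst z) (snd z)) = - eigenvalue \<epsilon> (Ham p f) \<Omega>"
    "g \<in> G0 \<epsilon> p f \<Omega> \<Longrightarrow> integral\<^sup>L \<nu> g \<ge> 0"
    using assms unfolding Mather_measures_def G0_dual_def radon_measure_on_def by (auto simp: case_prod_beta')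
  show "space \<nu> = closure \<Omega> \<times> UNIV"
    using sets_eq_imp_space_eq[OF s(1)] by (simp add: space_restrict_space)
qed

text \<open>The function L + (g - f) + c + delta, with c the critical value of \<open>g\<close>,
  belongs to \<open>G0\<close>: its Hamiltonian is |xi|^p - g - c - delta, and the small delta buys
  a subsolution continuous up to the boundary. Nonnegativity of its integral is the subgradient
  inequality, up to delta.\<close>

lemma Mather_measure_subgradient:
  fixes f g :: "'a \<Rightarrow> real"
  assumes bd: "bounded \<Omega>" and star: "\<And>s x. 0 \<le> s \<Longrightarrow> s < 1 \<Longrightarrow> x \<in> closure \<Omega> \<Longrightarrow> s *\<^sub>R x \<in> \<Omega>"
    and f: "continuous_on (closure \<Omega>) f" and g: "continuous_on (closure \<Omega>) g" 
    and \<nu>: "\<nu> \<in> Mather_measures \<epsilon> p f \<Omega>"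
  shows "crit \<epsilon> p \<Omega> f - (\<integral>z. g (fst z) - f (fst z) \<partial>\<nu>) \<le> crit \<epsilon> p \<Omega> g"
proof (rule field_le_epsilon)
  fix \<delta> :: real assume \<delta>: "\<delta> > 0"
  note M = Mather_measuresD[OF \<nu>]
  interpret prob_space \<nu> by (rule M(1))
  have p1: "p > 1" using p2 by simp
  define c where "c = crit \<epsilon> p \<Omega> g"
  have adm: "admissible f" "admissible g" using admissible_if_continuous_on_closure[OF bd] f g by auto
  obtain w where w: "continuous_on (closure \<Omega>) w" "vsub \<epsilon> (\<lambda>\<xi>. norm \<xi> powr p) (\<lambda>x. g x + c + \<delta>) \<Omega> w"
    using levels_continuous_to_closure[OF bd star g crit_in_levels[OF adm(2)] \<delta>] unfolding c_def by blast
  define h where "h x = (g x - f x) + (c + \<delta>)" for x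
  have hc: "continuous_on (closure \<Omega>) h" unfolding h_def by (intro continuous_intros f g)
  define \<phi> where "\<phi> = (\<lambda>z. Lag p f (fst z) (snd z) + h (fst z))"
  have "visc_subsol \<epsilon> (Ham_of \<phi>) \<Omega> 0 w"
  proof (subst visc_subsol_iff_vsub[OF op eps])
    show "Ham_of \<phi> x \<xi> = norm \<xi> powr p - (f x + h x)" for x \<xi>
      using Ham_of_eq[of p 1 \<phi> x f h \<xi>] p1 by (simp add: \<phi>_def)
    show "vsub \<epsilon> (\<lambda>\<xi>. norm \<xi> powr p) (\<lambda>x. f x + h x + 0) \<Omega> w"
      using w(2) by (simp add: h_def algebra_simps)
  qed
  moreover have "\<phi> \<in> Phi_plus p f \<Omega>"
    unfolding Phi_plus_def using hc by (intro CollectI exI[of _ 1] conjI exI[of _ h]) (auto simp: \<phi>_def)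
  ultimately have "\<phi> \<in> G0 \<epsilon> p f \<Omega>" unfolding G0_def using w(1) by blast
  then have "0 \<le> integral\<^sup>L \<nu> \<phi>" by (rule M(6))
  also have "integral\<^sup>L \<nu> \<phi> = integral\<^sup>L \<nu> (\<lambda>z. Lag p f (fst z) (snd z)) + integral\<^sup>L \<nu> (\<lambda>z. h (fst z))"
    unfolding \<phi>_def by (intro Bochner_Integration.integral_add M(4) integrable_continuous_fst bd M hc)
  also have "integral\<^sup>L \<nu> (\<lambda>z. h (fst z)) = (\<integral>z. g (fst z) - f (fst z) \<partial>\<nu>) + (c + \<delta>)"
  proof -
    have "integrable \<nu> (\<lambda>z. g (fst z) - f (fst z))"
      using integrable_continuous_fst[OF bd M(1,2) g] integrable_continuous_fst[OF bd M(1,2) f] by simp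
    then show ?thesis unfolding h_def by (simp add: prob_space)
  qed
  also have "integral\<^sup>L \<nu> (\<lambda>z. Lag p f (fst z) (snd z)) = - crit \<epsilon> p \<Omega> f"
    using M(5) eigenvalue_eq_crit[OF adm(1)] by simp
  finally show "crit \<epsilon> p \<Omega> f - (\<integral>z. g (fst z) - f (fst z) \<partial>\<nu>) \<le> crit \<epsilon> p \<Omega> g + \<delta>" by (simp add: c_def)
qed

text \<open>The integrand is q L minus a function of x, and the integral of L is the same for all
  Mather measures. Comparing Mather measures thus comes down to their marginals in x.\<close>

lemma Mather_measure_scaling_Lag:
  fixes f :: "'a \<Rightarrow> real"
  assumes bd: "bounded \<Omega>" and f: "\<And>x. x \<in> closure \<Omega> \<Longrightarrow> f differentiable (at x)" 
    and gf: "continuous_on (closure \<Omega>) (grad f)" and \<nu>: "\<nu> \<in> Mather_measures \<epsilon> p f \<Omega>"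
  defines "q \<equiv> p / (p - 1)"
  defines "g1 \<equiv> \<lambda>x. q * f x + x \<bullet> grad f x"
  shows "integrable \<nu> (scaling_Lag p f)"
    "integral\<^sup>L \<nu> (scaling_Lag p f) = - (\<integral>z. g1 (fst z) \<partial>\<nu>) - q * crit \<epsilon> p \<Omega> f"
proof -
  note M = Mather_measuresD[OF \<nu>]
  have fc: "continuous_on (closure \<Omega>) f" 
    using f by (intro continuous_at_imp_continuous_on ballI differentiable_imp_continuous_within) 
  have g1: "continuous_on (closure \<Omega>) g1" unfolding g1_def by (intro continuous_intros fc gf)
  have i: "integrable \<nu> (\<lambda>z. g1 (fst z))" by (rule integrable_continuous_fst[OF bd M(1,2) g1])
  have eq: "scaling_Lag p f z = q * Lag p f (fst z) (snd z) - g1 (fst z)" if "z \<in> space \<nu>" for z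
    using scaling_Lag_eq[of p f "fst z" "snd z"] f[of "fst z"] that p2 by (auto simp: M(3) q_def g1_def)
  have 1: "integrable \<nu> (\<lambda>z. q * Lag p f (fst z) (snd z) - g1 (fst z))" using M(4) i by simp
  show "integrable \<nu> (scaling_Lag p f)"
    using 1 Bochner_Integration.integrable_cong[OF refl eq, of \<nu>] by simp
  have "integral\<^sup>L \<nu> (scaling_Lag p f) = (\<integral>z. q * Lag p f (fst z) (snd z) - g1 (fst z) \<partial>\<nu>)"
    by (rule Bochner_Integration.integral_cong[OF refl eq])
  also have "\<dots> = q * (- eigenvalue \<epsilon> (Ham p f) \<Omega>) - (\<integral>z. g1 (fst z) \<partial>\<nu>)"
    using M(4) M(5) i by simp
  also have "eigenvalue \<epsilon> (Ham p f) \<Omega> = crit \<epsilon> p \<Omega> f"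
    using eigenvalue_eq_crit admissible_if_continuous_on_closure[OF bd fc] by simp
  finally show "integral\<^sup>L \<nu> (scaling_Lag p f) = - (\<integral>z. g1 (fst z) \<partial>\<nu>) - q * crit \<epsilon> p \<Omega> f" by simp
qed

text \<open>Only the marginal in \<open>x\<close> and the integral of the kinetic part of \<open>L\<close> matter for a Mather measure,
  so that a single velocity suffices to realise a given marginal.\<close>

lemma Mather_measure_with_marginal:
  fixes f :: "'a \<Rightarrow> real"
  assumes bd: "bounded \<Omega>" and f: "continuous_on (closure \<Omega>) f" 
    and m: "prob_space m" "sets m = sets (restrict_space borel (closure \<Omega>))"
    and sub: "\<And>g. continuous_on (closure \<Omega>) g \<Longrightarrow> crit \<epsilon> p \<Omega> f - (\<integral>x. g x - f x \<partial>m) \<le> crit \<epsilon> p \<Omega> g"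
  shows "\<exists>\<mu>\<in>Mather_measures \<epsilon> p f \<Omega>. \<forall>g :: 'a \<Rightarrow> real. continuous_on (closure \<Omega>) g \<longrightarrow> (\<integral>z. g (fst z) \<partial>\<mu>) = integral\<^sup>L m g"
proof -
  interpret m: prob_space m by (rule m(1))
  define K where "K = closure \<Omega>"
  have K: "compact K" using bd by (simp add: K_def)
  note f' = f[folded K_def] and m' = m(2)[folded K_def] and sub' = sub[folded K_def]
  have sp: "space m = K" using sets_eq_imp_space_eq[OF m'] by (simp add: space_restrict_space)
  have int: "integrable m g" if g: "continuous_on K g" for g :: "'a \<Rightarrow> real"
  proof -
    obtain B where B: "\<And>x. x \<in> K \<Longrightarrow> \<bar>g x\<bar> \<le> B" 
      using compact_imp_bounded[OF compact_continuous_image[OF g K]] unfolding bounded_pos by auto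
    have "g \<in> borel_measurable m"
      using borel_measurable_continuous_on_restrict[OF g] measurable_cong_sets[OF m' refl] by blast
    then show ?thesis by (intro m.integrable_const_bound[where B = B] AE_I2) (auto simp: B sp)
  qed
  have p1: "p > 1" using p2 by simp
  define q where "q = p / (p - 1)"
  define k where "k = (p - 1) * p powr (- q)"
  have k: "k > 0" using p1 by (simp add: k_def)
  have q: "q > 0" using p1 by (simp add: q_def)
  have Lag: "Lag p f x v = k * norm v powr q + f x" for x v :: 'a
    using Lag_eq[OF p1, of f x v] by (simp add: q_def k_def)
  \<comment> \<open>The kinetic energy that a Mather measure with marginal \<open>m\<close> must
    carry. The subgradient inequality tested with g = 0, together with \<open>crit_zero_le\<close>,
    makes it nonnegative.\<close>
  define A where "A = - crit \<epsilon> p \<Omega> f - integral\<^sup>L m f"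
  have A: "A \<ge> 0" using sub'[OF continuous_on_const[of K 0]] crit_zero_le by (simp add: A_def)
  obtain b :: 'a where b: "b \<in> Basis" using nonempty_Basis by blast
  \<comment> \<open>A constant velocity whose kinetic energy is exactly \<open>A\<close>; the
    direction \<open>b\<close> is arbitrary.\<close>
  define v0 where "v0 = ((A / k) powr (1 / q)) *\<^sub>R b"
  have "norm v0 powr q = A / k" using b A k q by (simp add: v0_def powr_powr)
  then have v0: "k * norm v0 powr q = A" using k by simp
  define X where "X = restrict_space borel (K \<times> UNIV :: ('a \<times> 'a) set)"
  have "continuous_on K (\<lambda>x. (x, v0))" by (intro continuous_intros)
  then have "(\<lambda>x. (x, v0)) \<in> borel_measurable m"
    using borel_measurable_continuous_on_restrict measurable_cong_sets[OF m' refl] by blast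
  then have mX: "(\<lambda>x. (x, v0)) \<in> measurable m X"
    unfolding X_def by (intro measurable_restrict_space2) (auto simp: sp)
  define \<mu> where "\<mu> = distr m X (\<lambda>x. (x, v0))"
  have \<mu>: "prob_space \<mu>" unfolding \<mu>_def by (rule m.prob_space_distr[OF mX])
  have s\<mu>: "sets \<mu> = sets (restrict_space borel (K \<times> UNIV))" by (simp add: \<mu>_def X_def)
  have sp\<mu>: "space \<mu> = K \<times> UNIV" by (simp add: \<mu>_def X_def space_restrict_space)
  \<comment> \<open>Stated for every real t in order to cover three uses: t = 0 gives the marginal,
    t = 1 with h = 0 the integral of L, and positive t the elements of \<open>G0\<close>.\<close>
  have key: "integrable \<mu> \<phi> \<and> integral\<^sup>L \<mu> \<phi> = t * (- crit \<epsilon> p \<Omega> f) + integral\<^sup>L m h"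
    if t: "\<And>x v. x \<in> K \<Longrightarrow> \<phi> (x, v) = t * Lag p f x v + h x" and h: "continuous_on K h" for \<phi> t h
  proof -
    define F where "F z = t * (k * norm (snd z) powr q + f (fst z)) + h (fst z)" for z :: "'a \<times> 'a"
    have eq: "\<phi> z = F z" if "z \<in> space \<mu>" for z using that t[of "fst z" "snd z"] by (auto simp: sp\<mu> F_def Lag)
    have "continuous_on (K \<times> UNIV) F" unfolding F_def
      by (intro continuous_intros continuous_on_compose2[OF f'] continuous_on_compose2[OF h] 
          continuous_on_compose2[OF continuous_on_norm_powr[OF q, of UNIV]]) auto
    then have FX: "F \<in> borel_measurable X" unfolding X_def by (rule borel_measurable_continuous_on_restrict)
    have Fx: "F (x, v0) = t * (A + f x) + h x" for x by (simp add: F_def v0)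
    have iF: "integrable \<mu> F" unfolding \<mu>_def integrable_distr_eq[OF mX FX] Fx
      by (intro int continuous_intros f' h)
    have "integral\<^sup>L \<mu> F = (\<integral>x. t * (A + f x) + h x \<partial>m)" unfolding \<mu>_def integral_distr[OF mX FX] Fx ..
    also have "\<dots> = t * (A + integral\<^sup>L m f) + integral\<^sup>L m h" using int[OF f'] int[OF h] by (simp add: m.prob_space)
    finally have "integral\<^sup>L \<mu> F = t * (- crit \<epsilon> p \<Omega> f) + integral\<^sup>L m h" by (simp add: A_def)
    then show ?thesis using iF Bochner_Integration.integrable_cong[of \<mu> \<mu> \<phi> F, OF refl eq] 
      Bochner_Integration.integral_cong[of \<mu> \<mu> \<phi> F, OF refl eq] by simp
  qed
  have marg: "(\<integral>z. g (fst z) \<partial>\<mu>) = integral\<^sup>L m g" if g: "continuous_on K g" for g :: "'a \<Rightarrow> real"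
    using key[of "\<lambda>z. g (fst z)" 0 g] g by simp
  have L: "integrable \<mu> (\<lambda>(x, v). Lag p f x v) \<and> (\<integral>(x, v). Lag p f x v \<partial>\<mu>) = - crit \<epsilon> p \<Omega> f"
    using key[of "\<lambda>(x, v). Lag p f x v" 1 "\<lambda>x. 0"] by simp
  \<comment> \<open>Dividing the subsolution by t puts 0 among the levels of f + h / t, so the
    critical value of this function is nonpositive; the subgradient inequality at it is the required
    sign.\<close>
  have G: "integrable \<mu> \<phi> \<and> integral\<^sup>L \<mu> \<phi> \<ge> 0" if \<phi>: "\<phi> \<in> G0 \<epsilon> p f \<Omega>" for \<phi>
  proof -
    from \<phi> obtain t h u where t: "t > 0" and h: "continuous_on K h" and eq: "\<And>x v. x \<in> K \<Longrightarrow> \<phi> (x, v) = t * Lag p f x v + h x"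
      and u: "continuous_on K u" "visc_subsol \<epsilon> (Ham_of \<phi>) \<Omega> 0 u"
      unfolding G0_def Phi_plus_def K_def by blast
    have OK: "\<Omega> \<subseteq> K" by (simp add: K_def closure_subset)
    have H: "Ham_of \<phi> x \<xi> = t * norm ((1 / t) *\<^sub>R \<xi>) powr p - (t * f x + h x)" if "x \<in> \<Omega>" for x \<xi>
      by (rule Ham_of_eq[OF p1 t eq]) (use that OK in blast)
    have "vsub \<epsilon> (\<lambda>\<xi>. t * norm ((1 / t) *\<^sub>R \<xi>) powr p) (\<lambda>x. t * f x + h x + 0) \<Omega> u"
      using visc_subsol_iff_vsub[of \<Omega> \<epsilon> "Ham_of \<phi>" "\<lambda>\<xi>. t * norm ((1 / t) *\<^sub>R \<xi>) powr p" "\<lambda>x. t * f x + h x", OF op eps H]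
        u(2) by blast
    from vsub_homogeneous[OF t this] have "vsub \<epsilon> (\<lambda>\<xi>. norm \<xi> powr p) (\<lambda>x. (f x + h x / t) + 0) \<Omega> (\<lambda>x. u x / t)"
      using t by (simp add: add_divide_distrib)
    moreover have "continuous_on \<Omega> (\<lambda>x. u x / t)" using t by (intro continuous_intros continuous_on_subset[OF u(1) OK]) auto
    ultimately have "0 \<in> levels \<epsilon> p \<Omega> (\<lambda>x. f x + h x / t)" unfolding levels_def by blast
    moreover have c: "continuous_on K (\<lambda>x. f x + h x / t)" using t by (intro continuous_intros f' h) auto
    ultimately have "crit \<epsilon> p \<Omega> (\<lambda>x. f x + h x / t) \<le> 0"
      using crit_le admissible_if_continuous_on_closure[OF bd] unfolding K_def by blast
    with sub'[OF c] have "crit \<epsilon> p \<Omega> f \<le> integral\<^sup>L m h / t" by simp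
    then have "t * crit \<epsilon> p \<Omega> f \<le> integral\<^sup>L m h" using t by (simp add: field_simps)
    with key[OF eq h] show ?thesis by simp
  qed
  have "emeasure \<mu> C < \<infinity>" for C
  proof -
    interpret prob_space \<mu> by (rule \<mu>)
    show ?thesis using emeasure_finite[of C] by (simp add: less_top[symmetric])
  qed
  then have "\<mu> \<in> Mather_measures \<epsilon> p f \<Omega>"
    unfolding Mather_measures_def G0_dual_def radon_measure_on_def K_def[symmetric]
    using s\<mu> L G \<mu> eigenvalue_eq_crit admissible_if_continuous_on_closure[OF bd f] by auto
  with marg show ?thesis unfolding K_def by blast
qed

end

theorem theorem1p2:
  fixes U \<Omega> :: "'a::euclidean_space set"
    and f :: "'a \<Rightarrow> real"
    and \<epsilon> p \<kappa> \<epsilon>\<^sub>0 :: real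
  assumes "\<epsilon> > 0" and "p > 2"
    and "open U" and "bounded U" and "smooth_boundary U"
    and "C1_closure f U"
    and "open \<Omega>" and "bounded \<Omega>" and "connected \<Omega>" and "C2_boundary \<Omega>"
    and "closure \<Omega> \<subseteq> U"
    and "star_shaped_at_0 \<Omega>"
    and "\<kappa> > 0" and "cball 0 \<kappa> \<subseteq> \<Omega>"
    and "\<forall>s>0. \<forall>x\<in>(\<lambda>y. (1 + s) *\<^sub>R y) ` frontier \<Omega>. infdist x (closure \<Omega>) \<ge> \<kappa> * s"
    and "0 < \<epsilon>\<^sub>0" and "\<epsilon>\<^sub>0 < 1"
    and "\<forall>l. \<bar>l\<bar> < \<epsilon>\<^sub>0 \<longrightarrow> (\<lambda>x. (1 + l) *\<^sub>R x) ` \<Omega> \<subseteq> U"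
  shows "(\<forall>\<mu>\<in>Mather_measures \<epsilon> p f \<Omega>. integrable \<mu> (scaling_Lag p f)) \<and>
    (\<exists>\<mu>\<in>Mather_measures \<epsilon> p f \<Omega>.
       (\<forall>\<nu>\<in>Mather_measures \<epsilon> p f \<Omega>.
          integral\<^sup>L \<nu> (scaling_Lag p f) \<le> integral\<^sup>L \<mu> (scaling_Lag p f)) \<and>
       ((\<lambda>l. (scaled_eigenvalue \<epsilon> p f \<Omega> l - scaled_eigenvalue \<epsilon> p f \<Omega> 0) / l)
          \<longlongrightarrow> integral\<^sup>L \<mu> (scaling_Lag p f)) (at_right 0)) \<and>
    (\<exists>\<mu>\<in>Mather_measures \<epsilon> p f \<Omega>.
       (\<forall>\<nu>\<in>Mather_measures \<epsilon> p f \<Omega>.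
          integral\<^sup>L \<mu> (scaling_Lag p f) \<le> integral\<^sup>L \<nu> (scaling_Lag p f)) \<and>
       ((\<lambda>l. (scaled_eigenvalue \<epsilon> p f \<Omega> l - scaled_eigenvalue \<epsilon> p f \<Omega> 0) / l)
          \<longlongrightarrow> integral\<^sup>L \<mu> (scaling_Lag p f)) (at_left 0))"
proof -
  have zero: "0 \<in> \<Omega>" using \<open>\<kappa> > 0\<close> \<open>cball 0 \<kappa> \<subseteq> \<Omega>\<close> by auto
  interpret viscous_domain \<epsilon> p \<Omega>
    by unfold_locales (use assms zero in auto)
  note bd = \<open>bounded \<Omega>\<close> and U = \<open>open U\<close> \<open>closure \<Omega> \<subseteq> U\<close>
  define K where "K = closure \<Omega>"
  \<comment> \<open>Star-shapedness alone places s x in the closure. If s x lay on the frontier,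
    then x, an outward dilation of it, would have positive distance from the closure, to which it
    belongs.\<close>
  have star: "s *\<^sub>R x \<in> \<Omega>" if s: "0 \<le> s" "s < 1" and x: "x \<in> closure \<Omega>" for s x
  proof (rule ccontr)
    assume n: "s *\<^sub>R x \<notin> \<Omega>"
    then have "s \<noteq> 0" using zero by auto
    then have s0: "s > 0" using s by simp
    have "(\<lambda>x. s *\<^sub>R x) ` \<Omega> \<subseteq> \<Omega>"
      using \<open>star_shaped_at_0 \<Omega>\<close> s unfolding star_shaped_at_0_def closed_segment_def by fastforce
    then have "(\<lambda>x. s *\<^sub>R x) ` closure \<Omega> \<subseteq> closure \<Omega>" by (metis closure_mono closure_scaleR)
    then have "s *\<^sub>R x \<in> closure \<Omega>" using x by blast
    then have fr: "s *\<^sub>R x \<in> frontier \<Omega>" using n \<open>open \<Omega>\<close> by (simp add: frontier_def interior_open)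
    define t where "t = 1 / s - 1"
    have t: "t > 0" using s s0 by (simp add: t_def field_simps)
    have "x = (1 + t) *\<^sub>R (s *\<^sub>R x)" using s0 by (simp add: t_def)
    then have "x \<in> (\<lambda>y. (1 + t) *\<^sub>R y) ` frontier \<Omega>" using fr by blast
    then have "infdist x (closure \<Omega>) \<ge> \<kappa> * t" using assms(15) t by blast
    moreover have "\<kappa> * t > 0" using t \<open>\<kappa> > 0\<close> by simp
    ultimately show False using x by simp
  qed
  have C1: "Ck_on 1 f U" using \<open>C1_closure f U\<close> by (simp add: C1_closure_def)
  have fd: "f differentiable (at x)" if "x \<in> U" for x using C1 that by simp
  have gU: "continuous_on U (grad f)" unfolding grad_def using C1 by (intro continuous_intros) simp
  have fdK: "f differentiable (at x)" if "x \<in> closure \<Omega>" for x using fd U that by blast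
  have fK: "continuous_on K f" unfolding K_def
    using fdK by (intro continuous_at_imp_continuous_on ballI differentiable_imp_continuous_within) 
  have gK: "continuous_on K (grad f)" using gU U by (auto simp: K_def intro: continuous_on_subset)
  define q where "q = p / (p - 1)"
  define g1 where "g1 = (\<lambda>x. q * f x + x \<bullet> grad f x)"
  have g1K: "continuous_on K g1" unfolding g1_def by (intro continuous_intros fK gK)
  define c where "c g = crit \<epsilon> p \<Omega> g" for g
  have Msc: "integrable \<nu> (scaling_Lag p f)" 
    "integral\<^sup>L \<nu> (scaling_Lag p f) = - (\<integral>z. g1 (fst z) \<partial>\<nu>) - q * c f"
    if "\<nu> \<in> Mather_measures \<epsilon> p f \<Omega>" for \<nu>
    unfolding c_def q_def g1_def
    by (rule Mather_measure_scaling_Lag(1)[OF bd fdK gK[unfolded K_def] that], assumption)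
      (rule Mather_measure_scaling_Lag(2)[OF bd fdK gK[unfolded K_def] that])
  have lim: "((\<lambda>l. (scaled_eigenvalue \<epsilon> p f \<Omega> l - scaled_eigenvalue \<epsilon> p f \<Omega> 0) / l) \<longlongrightarrow> D - q * c f) F"
    if "F \<le> at 0" "((\<lambda>l. (c (\<lambda>x. f x + l * g1 x) - c f) / l) \<longlongrightarrow> D) F" for D F
    unfolding c_def q_def by (rule scaled_eigenvalue_limit[OF bd U fd gU that(1) that(2)[unfolded c_def g1_def q_def]])
  have sub: "- t * (\<integral>z. g1 (fst z) \<partial>\<nu>) \<le> c (\<lambda>x. f x + t * g1 x) - c f" 
    if \<nu>: "\<nu> \<in> Mather_measures \<epsilon> p f \<Omega>" for \<nu> t
  proof -
    have "continuous_on K (\<lambda>x. f x + t * g1 x)" by (intro continuous_intros fK g1K)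
    from Mather_measure_subgradient[OF bd star fK[unfolded K_def] this[unfolded K_def] \<nu>]
    show ?thesis by (simp add: c_def)
  qed
  \<comment> \<open>The sign \<open>\<sigma>\<close> lets one construction serve both limits: 1
    gives the right derivative, and -1 the left one via the opposite direction.\<close>
  have ext: "\<exists>\<mu>\<in>Mather_measures \<epsilon> p f \<Omega>. 
      ((\<lambda>t. (c (\<lambda>x. f x + t * (\<sigma> * g1 x)) - c f) / t) \<longlongrightarrow> - (\<sigma> * (\<integral>z. g1 (fst z) \<partial>\<mu>))) (at_right 0)" for \<sigma>
  proof -
    have h: "continuous_on K (\<lambda>x. \<sigma> * g1 x)" by (intro continuous_intros g1K)
    from crit_subgradient_measure[OF bd fK[unfolded K_def] h[unfolded K_def]]
    obtain m where m: "prob_space m" "sets m = sets (restrict_space borel (closure \<Omega>))"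
      "\<And>g. continuous_on (closure \<Omega>) g \<Longrightarrow> crit \<epsilon> p \<Omega> f - (\<integral>x. g x - f x \<partial>m) \<le> crit \<epsilon> p \<Omega> g"
      "((\<lambda>t. (c (\<lambda>x. f x + t * (\<sigma> * g1 x)) - c f) / t) \<longlongrightarrow> - integral\<^sup>L m (\<lambda>x. \<sigma> * g1 x)) (at_right 0)"
      unfolding c_def by blast
    obtain \<mu> where \<mu>: "\<mu> \<in> Mather_measures \<epsilon> p f \<Omega>" 
      "\<And>g :: 'a \<Rightarrow> real. continuous_on (closure \<Omega>) g \<Longrightarrow> (\<integral>z. g (fst z) \<partial>\<mu>) = integral\<^sup>L m g"
      using Mather_measure_with_marginal[OF bd fK[unfolded K_def] m(1-3)] by blast
    have "integral\<^sup>L m (\<lambda>x. \<sigma> * g1 x) = \<sigma> * (\<integral>z. g1 (fst z) \<partial>\<mu>)"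
      using \<mu>(2)[OF h[unfolded K_def]] by auto
    with m(4) \<mu>(1) show ?thesis by auto
  qed
  \<comment> \<open>Every Mather measure, as a subgradient, bounds the difference quotients from
    below and hence their limit. The measure from \<open>ext\<close> attains this bound and is
    therefore extremal.\<close>
  have bound: "- (\<sigma> * (\<integral>z. g1 (fst z) \<partial>\<nu>)) \<le> D"
    if "\<nu> \<in> Mather_measures \<epsilon> p f \<Omega>" and D: "((\<lambda>t. (c (\<lambda>x. f x + t * (\<sigma> * g1 x)) - c f) / t) \<longlongrightarrow> D) (at_right 0)" for \<nu> \<sigma> D
  proof (rule tendsto_lowerbound[OF D _ trivial_limit_at_right_real])
    have "- (\<sigma> * (\<integral>z. g1 (fst z) \<partial>\<nu>)) \<le> (c (\<lambda>x. f x + t * (\<sigma> * g1 x)) - c f) / t" if "t > 0" for t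
      using sub[OF \<open>\<nu> \<in> _\<close>, of "t * \<sigma>"] that by (simp add: field_simps)
    then show "\<forall>\<^sub>F t in at_right 0. - (\<sigma> * (\<integral>z. g1 (fst z) \<partial>\<nu>)) \<le> (c (\<lambda>x. f x + t * (\<sigma> * g1 x)) - c f) / t"
      using eventually_at_right_less by (rule eventually_mono[rotated])
  qed
  obtain \<mu>1 where \<mu>1: "\<mu>1 \<in> Mather_measures \<epsilon> p f \<Omega>" 
    "((\<lambda>t. (c (\<lambda>x. f x + t * (1 * g1 x)) - c f) / t) \<longlongrightarrow> - (1 * (\<integral>z. g1 (fst z) \<partial>\<mu>1))) (at_right 0)"
    using ext[of 1] by blast
  obtain \<mu>2 where \<mu>2: "\<mu>2 \<in> Mather_measures \<epsilon> p f \<Omega>" 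
    "((\<lambda>t. (c (\<lambda>x. f x + t * (- 1 * g1 x)) - c f) / t) \<longlongrightarrow> - (- 1 * (\<integral>z. g1 (fst z) \<partial>\<mu>2))) (at_right 0)"
    using ext[of "- 1"] by blast
  show ?thesis
  proof (intro conjI ballI)
    show "integrable \<mu> (scaling_Lag p f)" if "\<mu> \<in> Mather_measures \<epsilon> p f \<Omega>" for \<mu> using Msc(1)[OF that] .
    show "\<exists>\<mu>\<in>Mather_measures \<epsilon> p f \<Omega>.
       (\<forall>\<nu>\<in>Mather_measures \<epsilon> p f \<Omega>. integral\<^sup>L \<nu> (scaling_Lag p f) \<le> integral\<^sup>L \<mu> (scaling_Lag p f)) \<and>
       ((\<lambda>l. (scaled_eigenvalue \<epsilon> p f \<Omega> l - scaled_eigenvalue \<epsilon> p f \<Omega> 0) / l)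
          \<longlongrightarrow> integral\<^sup>L \<mu> (scaling_Lag p f)) (at_right 0)"
    proof (intro bexI[of _ \<mu>1] conjI ballI \<mu>1(1))
      show "integral\<^sup>L \<nu> (scaling_Lag p f) \<le> integral\<^sup>L \<mu>1 (scaling_Lag p f)" if "\<nu> \<in> Mather_measures \<epsilon> p f \<Omega>" for \<nu>
        using bound[OF that \<mu>1(2)] by (simp add: Msc(2)[OF that] Msc(2)[OF \<mu>1(1)])
      have "((\<lambda>l. (c (\<lambda>x. f x + l * g1 x) - c f) / l) \<longlongrightarrow> - (\<integral>z. g1 (fst z) \<partial>\<mu>1)) (at_right 0)"
        using \<mu>1(2) by simp
      from lim[OF at_le[OF subset_UNIV] this]
      show "((\<lambda>l. (scaled_eigenvalue \<epsilon> p f \<Omega> l - scaled_eigenvalue \<epsilon> p f \<Omega> 0) / l)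
          \<longlongrightarrow> integral\<^sup>L \<mu>1 (scaling_Lag p f)) (at_right 0)" by (simp add: Msc(2)[OF \<mu>1(1)])
    qed
    show "\<exists>\<mu>\<in>Mather_measures \<epsilon> p f \<Omega>.
       (\<forall>\<nu>\<in>Mather_measures \<epsilon> p f \<Omega>. integral\<^sup>L \<mu> (scaling_Lag p f) \<le> integral\<^sup>L \<nu> (scaling_Lag p f)) \<and>
       ((\<lambda>l. (scaled_eigenvalue \<epsilon> p f \<Omega> l - scaled_eigenvalue \<epsilon> p f \<Omega> 0) / l)
          \<longlongrightarrow> integral\<^sup>L \<mu> (scaling_Lag p f)) (at_left 0)"
    proof (intro bexI[of _ \<mu>2] conjI ballI \<mu>2(1))
      show "integral\<^sup>L \<mu>2 (scaling_Lag p f) \<le> integral\<^sup>L \<nu> (scaling_Lag p f)" if "\<nu> \<in> Mather_measures \<epsilon> p f \<Omega>" for \<nu>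
        using bound[OF that \<mu>2(2)] by (simp add: Msc(2)[OF that] Msc(2)[OF \<mu>2(1)])
      \<comment> \<open>The left difference quotient in direction g1 is minus the right one in
        direction -g1; the change of sign turns the maximum into a minimum.\<close>
      have "((\<lambda>l. - ((c (\<lambda>x. f x + l * (- 1 * g1 x)) - c f) / l)) \<longlongrightarrow> - (\<integral>z. g1 (fst z) \<partial>\<mu>2)) (at_right 0)"
        using tendsto_minus[OF \<mu>2(2)] by simp
      then have "((\<lambda>l. (c (\<lambda>x. f x + l * g1 x) - c f) / l) \<longlongrightarrow> - (\<integral>z. g1 (fst z) \<partial>\<mu>2)) (at_left 0)"
        unfolding filterlim_at_left_to_right by simp
      from lim[OF at_le[OF subset_UNIV] this]
      show "((\<lambda>l. (scaled_eigenvalue \<epsilon> p f \<Omega> l - scaled_eigenvalue \<epsilon> p f \<Omega> 0) / l)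
          \<longlongrightarrow> integral\<^sup>L \<mu>2 (scaling_Lag p f)) (at_left 0)" by (simp add: Msc(2)[OF \<mu>2(1)])
    qed
  qed
qed

end
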